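(* Let $G$ be a discrete group, let $X$ be a compact Hausdorff space, and suppose $G$ acts on $X$ in such a way that the action is minimal and for every finite set $S \subset G \setminus \{1\}$, the set $\{x \in X : gx \neq x \text{ for all } g \in S\}$ is dense in $X$. Let $D$ be a purely infinite simple unital C*-algebra, and let $\alpha \colon G \to \mathrm{Aut}(C(X,D))$ be an action of $G$ on $C(X,D)$ which lies over the given action of $G$ on $X$. Then the reduced crossed product $C^*_{\mathrm{r}}\bigl(G, C(X,D), \alpha\bigr)$ is purely infinite and simple.
   Context: An action $\alpha \colon G \to \mathrm{Aut}(C(X,D))$ lies over an action $(g,x) \mapsto gx$ of $G$ on $X$ if there is a function $(g,x) \mapsto \alpha_{g,x}$ from $G \times X$ to $\mathrm{Aut}(D)$ such that $\alpha_g(a)(x) = \alpha_{g,x}\bigl(a(g^{-1}x)\bigr)$ for all $g \in G$, $x \in X$, and $a \in C(X,D)$. *)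

theory Defs
  imports "HOL-Analysis.Analysis"
begin

section \<open>C*-algebras and Hilbert spaces\<close>

class scaleC =
  fixes scaleC :: "complex \<Rightarrow> 'a \<Rightarrow> 'a" (infixr "*\<^sub>C" 75)

class complex_normed_vector = real_normed_vector + scaleC +
  assumes scaleC_add_right: "a *\<^sub>C (x + y) = a *\<^sub>C x + a *\<^sub>C y"
    and scaleC_add_left: "(a + b) *\<^sub>C x = a *\<^sub>C x + b *\<^sub>C x"
    and scaleC_scaleC: "a *\<^sub>C b *\<^sub>C x = (a * b) *\<^sub>C x"
    and scaleR_scaleC: "r *\<^sub>R x = complex_of_real r *\<^sub>C x"
    and norm_scaleC: "norm (a *\<^sub>C x) = cmod a * norm x"

text \<open>Units are not part of this class: a nonzero unital C*-algebra is a type of sort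
  \<open>{cstar_algebra, real_normed_algebra_1}\<close>.\<close>

class cstar_algebra = complex_normed_vector + banach + real_normed_algebra +
  fixes star :: "'a \<Rightarrow> 'a"
  assumes mult_scaleC_left: "(a *\<^sub>C x) * y = a *\<^sub>C (x * y)"
    and mult_scaleC_right: "x * (a *\<^sub>C y) = a *\<^sub>C (x * y)"
    and star_star: "star (star x) = x"
    and star_add: "star (x + y) = star x + star y"
    and star_scaleC: "star (a *\<^sub>C x) = cnj a *\<^sub>C star x"
    and star_mult: "star (x * y) = star y * star x"
    and cstar_identity: "norm (star x * x) = (norm x)\<^sup>2"

class chilbert_space = complex_normed_vector + banach +
  fixes cinner :: "'a \<Rightarrow> 'a \<Rightarrow> complex"
  assumes cinner_commute: "cinner x y = cnj (cinner y x)"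
    and cinner_add_right: "cinner x (y + z) = cinner x y + cinner x z"
    and cinner_scaleC_right: "cinner x (a *\<^sub>C y) = a * cinner x y"
    and cinner_self: "cinner x x = complex_of_real ((norm x)\<^sup>2)"

lemma scaleC_one: "1 *\<^sub>C x = (x :: 'a::complex_normed_vector)"
  using scaleR_scaleC[of 1 x] by simp

lemma scaleC_minus1: "(-1) *\<^sub>C x = - (x :: 'a::complex_normed_vector)"
  using scaleR_scaleC[of "-1" x] by simp

lemma scaleC_zero_right: "a *\<^sub>C 0 = (0 :: 'a::complex_normed_vector)"
  using scaleC_add_right[of a 0 0] by simp

lemma scaleC_minus_right: "a *\<^sub>C (- x) = - (a *\<^sub>C x :: 'a::complex_normed_vector)"
  by (metis add.right_inverse minus_unique scaleC_add_right scaleC_zero_right)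

lemma scaleC_diff_right: "a *\<^sub>C (x - y) = a *\<^sub>C x - (a *\<^sub>C y :: 'a::complex_normed_vector)"
  using scaleC_add_right[of a x "-y"] by (simp add: scaleC_minus_right)

lemma scaleC_scaleR: "a *\<^sub>C (r *\<^sub>R x) = r *\<^sub>R (a *\<^sub>C x :: 'a::complex_normed_vector)"
  by (simp add: scaleR_scaleC scaleC_scaleC mult.commute)

lemma bounded_linear_scaleC: "bounded_linear (\<lambda>x :: 'a::complex_normed_vector. a *\<^sub>C x)"
  by (rule bounded_linear_intro[where K = "cmod a"])
     (auto simp: scaleC_add_right scaleC_scaleR norm_scaleC)

lemma tendsto_scaleC:
  "(f \<longlongrightarrow> (x :: 'a::complex_normed_vector)) F \<Longrightarrow> ((\<lambda>n. a *\<^sub>C f n) \<longlongrightarrow> a *\<^sub>C x) F"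
  by (rule bounded_linear.tendsto[OF bounded_linear_scaleC])

lemma cinner_add_left: "cinner (x + y) z = cinner x z + cinner (y :: 'a::chilbert_space) z"
  by (metis cinner_commute cinner_add_right complex_cnj_add)

lemma cinner_scaleC_left: "cinner (a *\<^sub>C x) y = cnj a * cinner (x :: 'a::chilbert_space) y"
  by (metis cinner_commute cinner_scaleC_right complex_cnj_mult)

lemma cinner_minus_right: "cinner x (- y) = - cinner x (y :: 'a::chilbert_space)"
  using cinner_scaleC_right[of x "-1" y] by (simp add: scaleC_minus1)

lemma cinner_minus_left: "cinner (- x) y = - cinner x (y :: 'a::chilbert_space)"
  using cinner_scaleC_left[of "-1" x y] by (simp add: scaleC_minus1)

lemma cinner_diff_right: "cinner x (y - z) = cinner x y - cinner x (z :: 'a::chilbert_space)"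
  using cinner_add_right[of x y "-z"] by (simp add: cinner_minus_right)

lemma cinner_diff_left: "cinner (x - y) z = cinner x z - cinner y (z :: 'a::chilbert_space)"
  using cinner_add_left[of x "-y" z] by (simp add: cinner_minus_left)

lemma cinner_scaleR_right: "cinner x (r *\<^sub>R y) = r * cinner x (y :: 'a::chilbert_space)"
  by (simp add: scaleR_scaleC cinner_scaleC_right)

lemma cinner_scaleR_left: "cinner (r *\<^sub>R x) y = r * cinner x (y :: 'a::chilbert_space)"
  by (simp add: scaleR_scaleC cinner_scaleC_left)

lemma cinner_zero_right [simp]: "cinner x 0 = (0 :: complex)" for x :: "'a::chilbert_space"
  using cinner_scaleR_right[of x 0 0] by simp

lemma cinner_zero_left [simp]: "cinner 0 x = (0 :: complex)" for x :: "'a::chilbert_space"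
  using cinner_scaleR_left[of 0 0 x] by simp

lemma norm_add_sq:
  "(norm (x + y))\<^sup>2 = (norm x)\<^sup>2 + 2 * Re (cinner x y) + (norm (y :: 'a::chilbert_space))\<^sup>2"
proof -
  have "Re (cinner (x + y) (x + y)) = Re (cinner x x) + Re (cinner x y) + Re (cinner y x) + Re (cinner y y)"
    by (simp add: cinner_add_left cinner_add_right)
  moreover have "Re (cinner y x) = Re (cinner x y)"
    by (subst cinner_commute) simp
  ultimately show ?thesis by (simp add: cinner_self)
qed

lemma Re_cinner_le: "Re (cinner x y) \<le> norm x * norm (y :: 'a::chilbert_space)"
proof -
  have "(norm (x + y))\<^sup>2 \<le> (norm x + norm y)\<^sup>2"
    by (intro power_mono norm_triangle_ineq) auto
  then show ?thesis by (simp add: norm_add_sq power2_sum)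
qed

lemma cmod_cinner_le: "cmod (cinner x y) \<le> norm x * norm (y :: 'a::chilbert_space)"
proof (cases "cinner x y = 0")
  case False
  define c where "c = cnj (sgn (cinner x y))"
  have c: "cmod c = 1" using False by (simp add: c_def norm_sgn)
  have "cinner x (c *\<^sub>C y) = complex_of_real (cmod (cinner x y))"
    using False complex_norm_square[of "cinner x y"]
    by (simp add: c_def cinner_scaleC_right sgn_eq mult.commute power2_eq_square
        nonzero_divide_eq_eq)
  then show ?thesis
    using Re_cinner_le[of x "c *\<^sub>C y"] c by (simp add: norm_scaleC)
qed simp

lemma cinner_ext: "(\<And>y. cinner x y = cinner x' y) \<Longrightarrow> x = (x' :: 'a::chilbert_space)"
proof -
  assume "\<And>y. cinner x y = cinner x' y"
  then have "cinner (x - x') (x - x') = 0" by (simp add: cinner_diff_left)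
  then show ?thesis by (simp add: cinner_self)
qed

lemma riesz:
  fixes \<phi> :: "'a::chilbert_space \<Rightarrow> complex"
  assumes \<phi>: "bounded_linear \<phi>" and \<phi>C: "\<And>c x. \<phi> (c *\<^sub>C x) = c * \<phi> x"
  shows "\<exists>z. \<forall>y. \<phi> y = cinner z y"
proof -
  interpret \<phi>: bounded_linear \<phi> by fact
  define J where "J x = (norm x)\<^sup>2 - 2 * Re (\<phi> x)" for x
  obtain K where K: "\<And>x. norm (\<phi> x) \<le> norm x * K" using \<phi>.bounded by auto
  have lower: "J x \<ge> - K\<^sup>2" for x
  proof -
    have "Re (\<phi> x) \<le> norm x * K" using K[of x] complex_Re_le_cmod[of "\<phi> x"] by linarith
    moreover have "0 \<le> (norm x - K)\<^sup>2" by simp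
    ultimately show ?thesis by (simp add: J_def power2_diff)
  qed
  define m where "m = Inf (range J)"
  have bdd: "bdd_below (range J)" by (rule bdd_belowI2[where m = "- K\<^sup>2"]) (rule lower)
  have mJ: "m \<le> J x" for x unfolding m_def by (rule cInf_lower) (auto simp: bdd)
  have "\<exists>x. J x < m + 1 / Suc n" for n
    using cInf_lessD[of "range J" "m + 1 / Suc n"] by (auto simp: m_def)
  then obtain X where X: "\<And>n. J (X n) < m + 1 / Suc n" by metis
  have par: "(norm (x - y))\<^sup>2 = 2 * (J x + J y - 2 * J ((1/2) *\<^sub>R (x + y)))" for x y
  proof -
    have 1: "(norm (x + y))\<^sup>2 = (norm x)\<^sup>2 + 2 * Re (cinner x y) + (norm y)\<^sup>2" by (rule norm_add_sq)
    have 2: "(norm (x - y))\<^sup>2 = (norm x)\<^sup>2 - 2 * Re (cinner x y) + (norm y)\<^sup>2"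
      using norm_add_sq[of x "-y"] by (simp add: cinner_minus_right)
    have 3: "J ((1/2) *\<^sub>R (x + y)) = (1/4) * (norm (x + y))\<^sup>2 - Re (\<phi> x) - Re (\<phi> y)"
      unfolding J_def \<phi>.scaleR \<phi>.add norm_scaleR power_mult_distrib
      by (simp add: power2_eq_square field_simps)
    show ?thesis unfolding 3 unfolding 1 2 J_def by (simp add: algebra_simps)
  qed
  have dist: "(norm (X n - X k))\<^sup>2 \<le> 4 / Suc (min n k)" for n k
  proof -
    have "1 / real (Suc n) \<le> 1 / Suc (min n k)" "1 / real (Suc k) \<le> 1 / Suc (min n k)"
      by (auto simp: frac_le)
    then show ?thesis
      unfolding par using X[of n] X[of k] mJ[of "(1/2) *\<^sub>R (X n + X k)"] by argo
  qed
  have "Cauchy X"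
  proof (rule metric_CauchyI)
    fix e :: real assume e: "e > 0"
    obtain M where M: "4 / e\<^sup>2 < real M" using reals_Archimedean2 by blast
    have "dist (X n) (X k) < e" if "n \<ge> M" "k \<ge> M" for n k
    proof -
      have "4 / real (Suc (min n k)) \<le> 4 / real (Suc M)" using that by (intro frac_le) auto
      also have "\<dots> < e\<^sup>2" using M e by (simp add: field_simps add_strict_increasing)
      finally have "(norm (X n - X k))\<^sup>2 < e\<^sup>2" using dist[of n k] by linarith
      then show ?thesis using e by (simp add: dist_norm power_less_imp_less_base)
    qed
    then show "\<exists>M. \<forall>m\<ge>M. \<forall>n\<ge>M. dist (X m) (X n) < e" by blast
  qed
  then obtain z where z: "X \<longlonglongrightarrow> z" using Cauchy_convergent convergent_def by blast
  have "(\<lambda>n. J (X n)) \<longlonglongrightarrow> J z"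
    unfolding J_def by (intro tendsto_intros \<phi>.tendsto z)
  moreover have "(\<lambda>n. m + 1 / real (Suc n)) \<longlonglongrightarrow> m"
    using LIMSEQ_inverse_real_of_nat_add[of m] by (simp add: inverse_eq_divide)
  ultimately have "J z \<le> m"
    by (rule LIMSEQ_le) (use X less_imp_le in blast)
  then have zmin: "J z \<le> J x" for x using mJ[of x] by linarith
  have re: "Re (\<phi> y) = Re (cinner z y)" for y
  proof (cases "y = 0")
    case True then show ?thesis by (simp add: \<phi>.zero)
  next
    case False
    define d where "d = Re (cinner z y) - Re (\<phi> y)"
    define t where "t = - d / (norm y)\<^sup>2"
    have "J (z + t *\<^sub>R y) = J z + (t\<^sup>2 * (norm y)\<^sup>2 + 2 * t * d)"
      unfolding J_def norm_add_sq \<phi>.add \<phi>.scaleR d_def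
      by (simp add: cinner_scaleR_right power_mult_distrib algebra_simps)
    moreover have "t\<^sup>2 * (norm y)\<^sup>2 + 2 * t * d = - (d\<^sup>2 / (norm y)\<^sup>2)"
      using False by (simp add: t_def power2_eq_square field_simps)
    ultimately have "d\<^sup>2 / (norm y)\<^sup>2 \<le> 0" using zmin[of "z + t *\<^sub>R y"] by linarith
    then have "d = 0" using False by (simp add: divide_le_0_iff)
    then show ?thesis by (simp add: d_def)
  qed
  have "\<phi> y = cinner z y" for y
  proof (rule complex_eqI)
    show "Re (\<phi> y) = Re (cinner z y)" by (rule re)
    show "Im (\<phi> y) = Im (cinner z y)"
      using re[of "\<i> *\<^sub>C y"] by (simp add: \<phi>C cinner_scaleC_right)
  qed
  then show ?thesis by blast
qed

section \<open>The C*-algebra of bounded operators on a Hilbert space\<close>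

typedef (overloaded) 'h bop =
    "{T :: 'h::chilbert_space \<Rightarrow>\<^sub>L 'h. \<forall>c x. blinfun_apply T (c *\<^sub>C x) = c *\<^sub>C blinfun_apply T x}"
  morphisms blinfun_of_bop Bop
  by (rule exI[of _ 0]) (simp add: scaleC_zero_right)

setup_lifting type_definition_bop

lift_definition bop_apply :: "'h::chilbert_space bop \<Rightarrow> 'h \<Rightarrow> 'h" is blinfun_apply .

lemma bop_eqI: "(\<And>x. bop_apply S x = bop_apply T x) \<Longrightarrow> S = T"
  by transfer (rule blinfun_eqI)

lemma bop_exists:
  assumes "bounded_linear f" "\<And>c x. f (c *\<^sub>C x) = c *\<^sub>C f x"
  shows "\<exists>T. \<forall>x. bop_apply T x = f x"
proof (intro exI allI)
  fix x
  have "Blinfun f \<in> {T. \<forall>c x. blinfun_apply T (c *\<^sub>C x) = c *\<^sub>C blinfun_apply T x}"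
    by (simp add: assms bounded_linear_Blinfun_apply)
  then show "bop_apply (Bop (Blinfun f)) x = f x"
    by (simp add: bop_apply.rep_eq Bop_inverse bounded_linear_Blinfun_apply assms)
qed

instantiation bop :: (chilbert_space) real_normed_algebra
begin

lift_definition zero_bop :: "'a bop" is 0 by (simp add: scaleC_zero_right)
lift_definition plus_bop :: "'a bop \<Rightarrow> 'a bop \<Rightarrow> 'a bop" is "(+)"
  by (simp add: blinfun.add_left scaleC_add_right)
lift_definition uminus_bop :: "'a bop \<Rightarrow> 'a bop" is uminus
  by (simp add: blinfun.minus_left scaleC_minus_right)
lift_definition minus_bop :: "'a bop \<Rightarrow> 'a bop \<Rightarrow> 'a bop" is "(-)"
  by (simp add: blinfun.diff_left scaleC_diff_right)
lift_definition scaleR_bop :: "real \<Rightarrow> 'a bop \<Rightarrow> 'a bop" is scaleR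
  by (simp add: blinfun.scaleR_left scaleC_scaleR)
lift_definition norm_bop :: "'a bop \<Rightarrow> real" is norm .
lift_definition dist_bop :: "'a bop \<Rightarrow> 'a bop \<Rightarrow> real" is dist .
lift_definition times_bop :: "'a bop \<Rightarrow> 'a bop \<Rightarrow> 'a bop" is "(o\<^sub>L)" by simp

definition sgn_bop :: "'a bop \<Rightarrow> 'a bop" where "sgn_bop T = scaleR (inverse (norm T)) T"
definition uniformity_bop :: "('a bop \<times> 'a bop) filter"
  where "uniformity_bop = (INF e\<in>{0 <..}. principal {(x, y). dist x y < e})"
definition open_bop :: "'a bop set \<Rightarrow> bool"
  where "open_bop S = (\<forall>x\<in>S. \<forall>\<^sub>F (x', y) in uniformity. x' = x \<longrightarrow> y \<in> S)"

instance
proof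
  fix a b :: real and x y z :: "'a bop"
  show "x + y + z = x + (y + z)" by transfer simp
  show "x + y = y + x" by transfer simp
  show "0 + x = x" by transfer simp
  show "- x + x = 0" by transfer simp
  show "x - y = x + - y" by transfer simp
  show "a *\<^sub>R (x + y) = a *\<^sub>R x + a *\<^sub>R y" by transfer (simp add: algebra_simps)
  show "(a + b) *\<^sub>R x = a *\<^sub>R x + b *\<^sub>R x" by transfer (simp add: algebra_simps)
  show "a *\<^sub>R b *\<^sub>R x = (a * b) *\<^sub>R x" by transfer simp
  show "1 *\<^sub>R x = x" by transfer simp
  show "x * y * z = x * (y * z)" by transfer (rule blinfun_eqI, simp)
  show "(x + y) * z = x * z + y * z"
    by transfer (rule blinfun_eqI, simp add: blinfun.add_left)
  show "x * (y + z) = x * y + x * z"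
    by transfer (rule blinfun_eqI, simp add: blinfun.add_left blinfun.add_right)
  show "a *\<^sub>R x * y = a *\<^sub>R (x * y)"
    by transfer (rule blinfun_eqI, simp add: blinfun.scaleR_left)
  show "x * a *\<^sub>R y = a *\<^sub>R (x * y)"
    by transfer (rule blinfun_eqI, simp add: blinfun.scaleR_left blinfun.scaleR_right)
  show "dist x y = norm (x - y)" by transfer (rule dist_norm)
  show "sgn x = scaleR (inverse (norm x)) x" by (rule sgn_bop_def)
  show "norm x = 0 \<longleftrightarrow> x = 0" by transfer simp
  show "norm (x + y) \<le> norm x + norm y" by transfer (rule norm_triangle_ineq)
  show "norm (a *\<^sub>R x) = \<bar>a\<bar> * norm x" by transfer simp
  show "norm (x * y) \<le> norm x * norm y" by transfer (rule norm_blinfun_compose)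
qed (rule uniformity_bop_def open_bop_def)+

end

lemma bop_apply_simps:
  "bop_apply 0 x = 0"
  "bop_apply (S + T) x = bop_apply S x + bop_apply T x"
  "bop_apply (- S) x = - bop_apply S x"
  "bop_apply (S - T) x = bop_apply S x - bop_apply T x"
  "bop_apply (r *\<^sub>R S) x = r *\<^sub>R bop_apply S x"
  "bop_apply (S * T) x = bop_apply S (bop_apply T x)"
  by (transfer, simp add: blinfun.add_left blinfun.minus_left blinfun.diff_left blinfun.scaleR_left)+

lemma bop_apply_scaleC: "bop_apply T (c *\<^sub>C x) = c *\<^sub>C bop_apply T x"
  by transfer simp

lemma bounded_linear_bop_apply: "bounded_linear (bop_apply T)"
  by transfer (rule blinfun.bounded_linear_right)

lemma norm_bop_apply: "norm (bop_apply T x) \<le> norm T * norm x"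
  by transfer (rule norm_blinfun)

lemma norm_bop_bound: "0 \<le> b \<Longrightarrow> (\<And>x. norm (bop_apply T x) \<le> b * norm x) \<Longrightarrow> norm T \<le> b"
  by transfer (rule norm_blinfun_bound)

instance bop :: (chilbert_space) banach
proof
  fix X :: "nat \<Rightarrow> 'a bop"
  assume "Cauchy X"
  then have "Cauchy (\<lambda>n. blinfun_of_bop (X n))"
    unfolding Cauchy_def by (simp add: dist_bop.rep_eq)
  then obtain L where L: "(\<lambda>n. blinfun_of_bop (X n)) \<longlonglongrightarrow> L"
    using Cauchy_convergent convergent_def by blast
  have "blinfun_apply L (c *\<^sub>C x) = c *\<^sub>C blinfun_apply L x" for c x
  proof (rule LIMSEQ_unique)
    show "(\<lambda>n. blinfun_apply (blinfun_of_bop (X n)) (c *\<^sub>C x)) \<longlonglongrightarrow> blinfun_apply L (c *\<^sub>C x)"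
      by (intro blinfun.tendsto L tendsto_const)
    have "(\<lambda>n. c *\<^sub>C blinfun_apply (blinfun_of_bop (X n)) x) \<longlonglongrightarrow> c *\<^sub>C blinfun_apply L x"
      by (intro tendsto_scaleC blinfun.tendsto L tendsto_const)
    then show "(\<lambda>n. blinfun_apply (blinfun_of_bop (X n)) (c *\<^sub>C x)) \<longlonglongrightarrow> c *\<^sub>C blinfun_apply L x"
      by (simp add: blinfun_of_bop[simplified])
  qed
  then have "blinfun_of_bop (Bop L) = L" by (simp add: Bop_inverse)
  then have "X \<longlonglongrightarrow> Bop L"
    using L by (simp add: tendsto_iff dist_bop.rep_eq)
  then show "convergent X" by (rule convergentI)
qed

lemma bop_adjoint_exists: "\<exists>S. \<forall>x y. cinner (bop_apply S x) y = cinner x (bop_apply T y)"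
proof -
  have bl: "bounded_linear (\<lambda>y. cinner x (bop_apply T y))" for x
  proof (rule bounded_linear_intro[where K = "norm x * norm T"])
    fix y z r
    show "cinner x (bop_apply T (y + z)) = cinner x (bop_apply T y) + cinner x (bop_apply T z)"
      by (simp add: linear_simps(1)[OF bounded_linear_bop_apply] cinner_add_right)
    show "cinner x (bop_apply T (r *\<^sub>R y)) = r *\<^sub>R cinner x (bop_apply T y)"
      by (simp add: linear_simps(5)[OF bounded_linear_bop_apply] cinner_scaleR_right scaleR_conv_of_real)
    have "cmod (cinner x (bop_apply T y)) \<le> norm x * norm (bop_apply T y)" by (rule cmod_cinner_le)
    also have "\<dots> \<le> norm x * (norm T * norm y)" by (intro mult_left_mono norm_bop_apply) simp
    finally show "norm (cinner x (bop_apply T y)) \<le> norm y * (norm x * norm T)" by (simp add: mult_ac)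
  qed
  have "\<exists>z. \<forall>y. cinner x (bop_apply T y) = cinner z y" for x
    by (rule riesz[OF bl]) (simp add: bop_apply_scaleC cinner_scaleC_right)
  then obtain S where S: "\<And>x y. cinner (S x) y = cinner x (bop_apply T y)" by metis
  have "bounded_linear S"
  proof (rule bounded_linear_intro[where K = "norm T"])
    fix x y r
    show "S (x + y) = S x + S y" by (rule cinner_ext) (simp add: S cinner_add_left)
    show "S (r *\<^sub>R x) = r *\<^sub>R S x" by (rule cinner_ext) (simp add: S cinner_scaleR_left)
    have "(norm (S x))\<^sup>2 = Re (cinner (S x) (S x))" by (simp add: cinner_self)
    also have "\<dots> \<le> norm x * norm (bop_apply T (S x))" unfolding S by (rule Re_cinner_le)
    also have "\<dots> \<le> norm x * (norm T * norm (S x))" by (intro mult_left_mono norm_bop_apply) simp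
    finally have "norm (S x) * norm (S x) \<le> (norm x * norm T) * norm (S x)"
      by (simp add: power2_eq_square mult_ac)
    then show "norm (S x) \<le> norm x * norm T"
      by (cases "norm (S x) = 0") (auto simp: mult_le_cancel_right)
  qed
  moreover have "S (c *\<^sub>C x) = c *\<^sub>C S x" for c x
    by (rule cinner_ext) (simp add: S cinner_scaleC_left)
  ultimately show ?thesis using bop_exists[of S] S by metis
qed

instantiation bop :: (chilbert_space) cstar_algebra
begin

lift_definition scaleC_bop :: "complex \<Rightarrow> 'a bop \<Rightarrow> 'a bop" is
  "\<lambda>c T. Blinfun (\<lambda>x. c *\<^sub>C blinfun_apply T x)"
proof (goal_cases)
  case (1 c T)
  have "bounded_linear (\<lambda>x. c *\<^sub>C blinfun_apply T x)"
    by (rule bounded_linear_compose[OF bounded_linear_scaleC blinfun.bounded_linear_right])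
  then show ?case using 1
    by (simp add: bounded_linear_Blinfun_apply scaleC_scaleC mult.commute)
qed

definition star_bop :: "'a bop \<Rightarrow> 'a bop" where
  "star_bop T = (THE S. \<forall>x y. cinner (bop_apply S x) y = cinner x (bop_apply T y))"

lemma bop_apply_scaleC_left: "bop_apply (c *\<^sub>C T) x = c *\<^sub>C bop_apply T x" for T :: "'a bop"
  by (simp add: bop_apply.rep_eq scaleC_bop.rep_eq bounded_linear_Blinfun_apply
      bounded_linear_compose[OF bounded_linear_scaleC blinfun.bounded_linear_right])

lemma cinner_star_left: "cinner (bop_apply (star T) x) y = cinner x (bop_apply T y)" for T :: "'a bop"
proof -
  have "\<exists>!S. \<forall>x y. cinner (bop_apply S x) y = cinner x (bop_apply T y)"
    using bop_adjoint_exists[of T] by (metis bop_eqI cinner_ext)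
  from theI'[OF this] show ?thesis by (simp add: star_bop_def)
qed

lemma bop_star_eqI: "(\<And>x y. cinner (bop_apply S x) y = cinner x (bop_apply T y)) \<Longrightarrow> S = star T"
  for T :: "'a bop"
  by (metis bop_eqI cinner_ext cinner_star_left)

lemma cinner_star_right: "cinner x (bop_apply (star T) y) = cinner (bop_apply T x) y" for T :: "'a bop"
  by (metis cinner_star_left cinner_commute)

instance
proof
  fix a b :: complex and r :: real and x y :: "'a bop"
  show "a *\<^sub>C (x + y) = a *\<^sub>C x + a *\<^sub>C y"
    by (rule bop_eqI) (simp add: bop_apply_simps bop_apply_scaleC_left scaleC_add_right)
  show "(a + b) *\<^sub>C x = a *\<^sub>C x + b *\<^sub>C x"
    by (rule bop_eqI) (simp add: bop_apply_simps bop_apply_scaleC_left scaleC_add_left)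
  show "a *\<^sub>C b *\<^sub>C x = (a * b) *\<^sub>C x"
    by (rule bop_eqI) (simp add: bop_apply_simps bop_apply_scaleC_left scaleC_scaleC)
  show rC: "r *\<^sub>R x = complex_of_real r *\<^sub>C x" for r and x :: "'a bop"
    by (rule bop_eqI) (simp add: bop_apply_simps bop_apply_scaleC_left scaleR_scaleC)
  have le: "norm (a *\<^sub>C x) \<le> cmod a * norm x" for a and x :: "'a bop"
    by (rule norm_bop_bound)
       (auto simp: bop_apply_scaleC_left norm_scaleC mult.assoc intro!: mult_left_mono norm_bop_apply)
  show "norm (a *\<^sub>C x) = cmod a * norm x"
  proof (cases "a = 0")
    case True
    then show ?thesis using le[of a x] by simp
  next
    case False
    have "inverse a *\<^sub>C a *\<^sub>C x = x"
      using False rC[of 1 x]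
      by (intro bop_eqI) (simp add: bop_apply_scaleC_left scaleC_scaleC scaleC_one)
    then have "norm x \<le> cmod (inverse a) * norm (a *\<^sub>C x)" by (metis le)
    then have "cmod a * norm x \<le> norm (a *\<^sub>C x)" using False
      by (simp add: norm_inverse norm_divide field_simps)
    then show ?thesis using le[of a x] by simp
  qed
  show "a *\<^sub>C x * y = a *\<^sub>C (x * y)"
    by (rule bop_eqI) (simp add: bop_apply_simps bop_apply_scaleC_left)
  show "x * a *\<^sub>C y = a *\<^sub>C (x * y)"
    by (rule bop_eqI) (simp add: bop_apply_simps bop_apply_scaleC_left bop_apply_scaleC)
  show "star (star x) = x"
    by (rule bop_star_eqI[symmetric]) (simp add: cinner_star_right)
  show "star (x + y) = star x + star y"
    by (rule bop_star_eqI[symmetric])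
       (simp add: bop_apply_simps cinner_add_left cinner_add_right cinner_star_left)
  show "star (a *\<^sub>C x) = cnj a *\<^sub>C star x"
    by (rule bop_star_eqI[symmetric])
       (simp add: bop_apply_scaleC_left cinner_scaleC_left cinner_scaleC_right cinner_star_left)
  show "star (x * y) = star y * star x"
    by (rule bop_star_eqI[symmetric]) (simp add: bop_apply_simps cinner_star_left)
  have sq: "(norm x)\<^sup>2 \<le> norm (star x * x)" for x :: "'a bop"
  proof -
    have "norm x \<le> sqrt (norm (star x * x))"
    proof (rule norm_bop_bound)
      fix v
      have "(norm (bop_apply x v))\<^sup>2 = Re (cinner (bop_apply (star x * x) v) v)"
        by (simp add: bop_apply_simps cinner_star_left cinner_self)
      also have "\<dots> \<le> norm (bop_apply (star x * x) v) * norm v" by (rule Re_cinner_le)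
      also have "\<dots> \<le> norm (star x * x) * norm v * norm v" by (intro mult_right_mono norm_bop_apply) simp
      finally have "sqrt ((norm (bop_apply x v))\<^sup>2) \<le> sqrt (norm (star x * x) * norm v * norm v)"
        by (rule real_sqrt_le_mono)
      then show "norm (bop_apply x v) \<le> sqrt (norm (star x * x)) * norm v"
        by (simp add: real_sqrt_mult mult.assoc)
    qed simp
    then have "(norm x)\<^sup>2 \<le> (sqrt (norm (star x * x)))\<^sup>2" by (rule power_mono) simp
    then show ?thesis by simp
  qed
  have sle: "norm x \<le> norm (star x)" for x :: "'a bop"
  proof -
    have "norm x * norm x \<le> norm (star x) * norm x"
      using sq[of x] norm_mult_ineq[of "star x" x] by (simp add: power2_eq_square)
    then show ?thesis by (cases "norm x = 0") (auto simp: mult_le_cancel_right)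
  qed
  have "norm (star x) \<le> norm x" using sle[of "star x"] \<open>star (star x) = x\<close> by simp
  then have "norm (star x * x) \<le> (norm x)\<^sup>2"
    using norm_mult_ineq[of "star x" x] mult_right_mono[of "norm (star x)" "norm x" "norm x"]
    by (simp add: power2_eq_square)
  then show "norm (star x * x) = (norm x)\<^sup>2" using sq[of x] by simp
qed

end


section \<open>Square-summable functions with values in a Hilbert space\<close>

typedef (overloaded) ('g, 'h) ell2 =
    "{f :: 'g \<Rightarrow> 'h::chilbert_space. (\<lambda>g. (norm (f g))\<^sup>2) summable_on UNIV}"
  morphisms ell2_apply Ell2
  by (rule exI[of _ "\<lambda>_. 0"]) simp

setup_lifting type_definition_ell2

lemma ell2_eqI: "(\<And>g. ell2_apply f g = ell2_apply f' g) \<Longrightarrow> f = f'"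
  by transfer auto

lemma square_summable_bound:
  fixes f :: "'g \<Rightarrow> 'h::real_normed_vector"
  assumes "0 \<le> K" and bd: "\<And>S. finite S \<Longrightarrow> L2_set (\<lambda>g. norm (f g)) S \<le> K"
  shows "(\<lambda>g. (norm (f g))\<^sup>2) summable_on UNIV" "sqrt (\<Sum>\<^sub>\<infinity>g. (norm (f g))\<^sup>2) \<le> K"
proof -
  have *: "(\<Sum>g\<in>S. (norm (f g))\<^sup>2) \<le> K\<^sup>2" if "finite S" for S
    using bd[OF that] sqrt_le_D by (fastforce simp: L2_set_def)
  show 1: "(\<lambda>g. (norm (f g))\<^sup>2) summable_on UNIV"
    by (rule nonneg_bdd_above_summable_on) (auto intro!: bdd_aboveI2[where M = "K\<^sup>2"] *)
  have "(\<Sum>\<^sub>\<infinity>g. (norm (f g))\<^sup>2) \<le> K\<^sup>2"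
    by (rule infsum_le_finite_sums[OF 1]) (simp add: *)
  then show "sqrt (\<Sum>\<^sub>\<infinity>g. (norm (f g))\<^sup>2) \<le> K"
    using assms(1) real_le_lsqrt by blast
qed

lemma L2_set_le_infsum:
  fixes f :: "'g \<Rightarrow> 'h::real_normed_vector"
  assumes "(\<lambda>g. (norm (f g))\<^sup>2) summable_on UNIV" "finite S"
  shows "L2_set (\<lambda>g. norm (f g)) S \<le> sqrt (\<Sum>\<^sub>\<infinity>g. (norm (f g))\<^sup>2)"
  unfolding L2_set_def by (intro real_sqrt_le_mono finite_sum_le_infsum assms) auto

lemma square_summable_add:
  fixes f f' :: "'g \<Rightarrow> 'h::real_normed_vector"
  assumes "(\<lambda>g. (norm (f g))\<^sup>2) summable_on UNIV" "(\<lambda>g. (norm (f' g))\<^sup>2) summable_on UNIV"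
  shows "(\<lambda>g. (norm (f g + f' g))\<^sup>2) summable_on UNIV"
    "sqrt (\<Sum>\<^sub>\<infinity>g. (norm (f g + f' g))\<^sup>2) \<le> sqrt (\<Sum>\<^sub>\<infinity>g. (norm (f g))\<^sup>2) + sqrt (\<Sum>\<^sub>\<infinity>g. (norm (f' g))\<^sup>2)"
proof -
  have *: "L2_set (\<lambda>g. norm (f g + f' g)) S \<le> sqrt (\<Sum>\<^sub>\<infinity>g. (norm (f g))\<^sup>2) + sqrt (\<Sum>\<^sub>\<infinity>g. (norm (f' g))\<^sup>2)"
    if S: "finite S" for S
  proof -
    have "L2_set (\<lambda>g. norm (f g + f' g)) S \<le> L2_set (\<lambda>g. norm (f g) + norm (f' g)) S"
      by (intro L2_set_mono norm_triangle_ineq) auto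
    also have "\<dots> \<le> L2_set (\<lambda>g. norm (f g)) S + L2_set (\<lambda>g. norm (f' g)) S"
      by (rule L2_set_triangle_ineq)
    also have "\<dots> \<le> sqrt (\<Sum>\<^sub>\<infinity>g. (norm (f g))\<^sup>2) + sqrt (\<Sum>\<^sub>\<infinity>g. (norm (f' g))\<^sup>2)"
      by (intro add_mono L2_set_le_infsum assms S)
    finally show ?thesis .
  qed
  have nn: "0 \<le> sqrt (\<Sum>\<^sub>\<infinity>g. (norm (f g))\<^sup>2) + sqrt (\<Sum>\<^sub>\<infinity>g. (norm (f' g))\<^sup>2)"
    by (intro add_nonneg_nonneg) (auto intro: infsum_nonneg)
  show "(\<lambda>g. (norm (f g + f' g))\<^sup>2) summable_on UNIV" by (rule square_summable_bound(1)[OF nn *])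
  show "sqrt (\<Sum>\<^sub>\<infinity>g. (norm (f g + f' g))\<^sup>2) \<le> sqrt (\<Sum>\<^sub>\<infinity>g. (norm (f g))\<^sup>2) + sqrt (\<Sum>\<^sub>\<infinity>g. (norm (f' g))\<^sup>2)"
    by (rule square_summable_bound(2)[OF nn *])
qed

lemma square_summable_cinner:
  fixes f f' :: "'g \<Rightarrow> 'h::chilbert_space"
  assumes "(\<lambda>g. (norm (f g))\<^sup>2) summable_on UNIV" "(\<lambda>g. (norm (f' g))\<^sup>2) summable_on UNIV"
  shows "(\<lambda>g. cinner (f g) (f' g)) summable_on UNIV"
proof (rule abs_summable_summable[OF Infinite_Sum.abs_summable_on_comparison_test'])
  show "(\<lambda>g. (norm (f g))\<^sup>2 + (norm (f' g))\<^sup>2) summable_on UNIV" by (intro summable_on_add assms)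
  fix g
  have "0 \<le> (norm (f g) - norm (f' g))\<^sup>2" by simp
  then have "2 * (norm (f g) * norm (f' g)) \<le> (norm (f g))\<^sup>2 + (norm (f' g))\<^sup>2"
    by (simp add: power2_diff)
  moreover have "0 \<le> norm (f g) * norm (f' g)" by simp
  ultimately show "norm (cinner (f g) (f' g)) \<le> (norm (f g))\<^sup>2 + (norm (f' g))\<^sup>2"
    using cmod_cinner_le[of "f g" "f' g"] by linarith
qed

instantiation ell2 :: (type, chilbert_space) complex_normed_vector
begin

lift_definition zero_ell2 :: "('a, 'b) ell2" is "\<lambda>_. 0" by simp
lift_definition plus_ell2 :: "('a, 'b) ell2 \<Rightarrow> ('a, 'b) ell2 \<Rightarrow> ('a, 'b) ell2"
  is "\<lambda>f f' g. f g + f' g" by (rule square_summable_add(1))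
lift_definition uminus_ell2 :: "('a, 'b) ell2 \<Rightarrow> ('a, 'b) ell2" is "\<lambda>f g. - f g" by simp
lift_definition minus_ell2 :: "('a, 'b) ell2 \<Rightarrow> ('a, 'b) ell2 \<Rightarrow> ('a, 'b) ell2"
  is "\<lambda>f f' g. f g - f' g"
proof -
  fix f f' :: "'a \<Rightarrow> 'b"
  assume "(\<lambda>g. (norm (f g))\<^sup>2) summable_on UNIV" "(\<lambda>g. (norm (f' g))\<^sup>2) summable_on UNIV"
  then show "(\<lambda>g. (norm (f g - f' g))\<^sup>2) summable_on UNIV"
    using square_summable_add(1)[of f "\<lambda>g. - f' g"] by simp
qed
lift_definition scaleR_ell2 :: "real \<Rightarrow> ('a, 'b) ell2 \<Rightarrow> ('a, 'b) ell2" is "\<lambda>r f g. r *\<^sub>R f g"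
  by (simp add: power_mult_distrib summable_on_cmult_right)
lift_definition scaleC_ell2 :: "complex \<Rightarrow> ('a, 'b) ell2 \<Rightarrow> ('a, 'b) ell2" is "\<lambda>c f g. c *\<^sub>C f g"
  by (simp add: norm_scaleC power_mult_distrib summable_on_cmult_right)
lift_definition norm_ell2 :: "('a, 'b) ell2 \<Rightarrow> real" is "\<lambda>f. sqrt (\<Sum>\<^sub>\<infinity>g. (norm (f g))\<^sup>2)" .

definition dist_ell2 :: "('a, 'b) ell2 \<Rightarrow> ('a, 'b) ell2 \<Rightarrow> real" where "dist_ell2 f f' = norm (f - f')"
definition sgn_ell2 :: "('a, 'b) ell2 \<Rightarrow> ('a, 'b) ell2" where "sgn_ell2 f = scaleR (inverse (norm f)) f"
definition uniformity_ell2 :: "(('a, 'b) ell2 \<times> ('a, 'b) ell2) filter"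
  where "uniformity_ell2 = (INF e\<in>{0 <..}. principal {(x, y). dist x y < e})"
definition open_ell2 :: "('a, 'b) ell2 set \<Rightarrow> bool"
  where "open_ell2 S = (\<forall>x\<in>S. \<forall>\<^sub>F (x', y) in uniformity. x' = x \<longrightarrow> y \<in> S)"

instance
proof
  fix r r' :: real and a b :: complex and x y z :: "('a, 'b) ell2"
  show "x + y + z = x + (y + z)" by transfer (simp add: add.assoc)
  show "x + y = y + x" by transfer (simp add: add.commute)
  show "0 + x = x" by transfer simp
  show "- x + x = 0" by transfer simp
  show "x - y = x + - y" by transfer simp
  show "r *\<^sub>R (x + y) = r *\<^sub>R x + r *\<^sub>R y" by transfer (simp add: scaleR_add_right)
  show "(r + r') *\<^sub>R x = r *\<^sub>R x + r' *\<^sub>R x" by transfer (simp add: scaleR_add_left)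
  show "r *\<^sub>R r' *\<^sub>R x = (r * r') *\<^sub>R x" by transfer simp
  show "1 *\<^sub>R x = x" by transfer simp
  show "a *\<^sub>C (x + y) = a *\<^sub>C x + a *\<^sub>C y" by transfer (simp add: scaleC_add_right)
  show "(a + b) *\<^sub>C x = a *\<^sub>C x + b *\<^sub>C x" by transfer (simp add: scaleC_add_left)
  show "a *\<^sub>C b *\<^sub>C x = (a * b) *\<^sub>C x" by transfer (simp add: scaleC_scaleC)
  show "r *\<^sub>R x = complex_of_real r *\<^sub>C x" by transfer (simp add: scaleR_scaleC)
  show "dist x y = norm (x - y)" by (rule dist_ell2_def)
  show "sgn x = scaleR (inverse (norm x)) x" by (rule sgn_ell2_def)
  show "norm x = 0 \<longleftrightarrow> x = 0"
  proof transfer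
    fix f :: "'a \<Rightarrow> 'b" assume s: "(\<lambda>g. (norm (f g))\<^sup>2) summable_on UNIV"
    have "f g = 0" if "(\<Sum>\<^sub>\<infinity>g. (norm (f g))\<^sup>2) \<le> 0" for g
      using nonneg_infsum_le_0D[OF that s, of g] by simp
    then show "(sqrt (\<Sum>\<^sub>\<infinity>g. (norm (f g))\<^sup>2) = 0) = (f = (\<lambda>_. 0))" by auto
  qed
  show "norm (x + y) \<le> norm x + norm y" by transfer (rule square_summable_add(2))
  show "norm (r *\<^sub>R x) = \<bar>r\<bar> * norm x"
    by transfer (simp add: power_mult_distrib infsum_cmult_right' real_sqrt_mult)
  show "norm (a *\<^sub>C x) = cmod a * norm x"
    by transfer (simp add: norm_scaleC power_mult_distrib infsum_cmult_right' real_sqrt_mult)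
qed (rule uniformity_ell2_def open_ell2_def)+

end

lemma ell2_apply_simps:
  "ell2_apply 0 g = 0"
  "ell2_apply (f + f') g = ell2_apply f g + ell2_apply f' g"
  "ell2_apply (- f) g = - ell2_apply f g"
  "ell2_apply (f - f') g = ell2_apply f g - ell2_apply f' g"
  "ell2_apply (r *\<^sub>R f) g = r *\<^sub>R ell2_apply f g"
  "ell2_apply (c *\<^sub>C f) g = c *\<^sub>C ell2_apply f g"
  by (transfer, simp)+

lemma L2_set_ell2_le: "L2_set (\<lambda>g. norm (ell2_apply f g)) S \<le> norm f"
proof (cases "finite S")
  case True
  then show ?thesis by transfer (rule L2_set_le_infsum)
qed simp

lemma norm_ell2_apply_le: "norm (ell2_apply f g) \<le> norm f"
  using L2_set_ell2_le[of f "{g}"] by simp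

instantiation ell2 :: (type, chilbert_space) chilbert_space
begin

lift_definition cinner_ell2 :: "('a, 'b) ell2 \<Rightarrow> ('a, 'b) ell2 \<Rightarrow> complex"
  is "\<lambda>f f'. \<Sum>\<^sub>\<infinity>g. cinner (f g) (f' g)" .

instance
proof
  fix a :: complex and x y z :: "('a, 'b) ell2"
  show "cinner x y = cnj (cinner y x)"
    by transfer (simp add: cinner_commute[symmetric] flip: infsum_cnj)
  show "cinner x (y + z) = cinner x y + cinner x z"
    by transfer (simp add: cinner_add_right infsum_add square_summable_cinner)
  show "cinner x (a *\<^sub>C y) = a * cinner x y"
    by transfer (simp add: cinner_scaleC_right infsum_cmult_right')
  show "cinner x x = complex_of_real ((norm x)\<^sup>2)"
  proof transfer
    fix f :: "'a \<Rightarrow> 'b" assume s: "(\<lambda>g. (norm (f g))\<^sup>2) summable_on UNIV"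
    have "((\<lambda>g. complex_of_real ((norm (f g))\<^sup>2)) has_sum complex_of_real (\<Sum>\<^sub>\<infinity>g. (norm (f g))\<^sup>2)) UNIV"
      by (intro has_sum_of_real has_sum_infsum s)
    then show "(\<Sum>\<^sub>\<infinity>g. cinner (f g) (f g)) = complex_of_real ((sqrt (\<Sum>\<^sub>\<infinity>g. (norm (f g))\<^sup>2))\<^sup>2)"
      by (simp add: cinner_self infsumI infsum_nonneg)
  qed
next
  fix X :: "nat \<Rightarrow> ('a, 'b) ell2"
  assume C: "Cauchy X"
  have "Cauchy (\<lambda>n. ell2_apply (X n) g)" for g
  proof (rule metric_CauchyI)
    fix e :: real assume "e > 0"
    then obtain M where M: "\<And>m n. m \<ge> M \<Longrightarrow> n \<ge> M \<Longrightarrow> dist (X m) (X n) < e"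
      using C unfolding Cauchy_def by blast
    have "dist (ell2_apply (X m) g) (ell2_apply (X n) g) < e" if "m \<ge> M" "n \<ge> M" for m n
      using M[OF that] norm_ell2_apply_le[of "X m - X n" g] by (simp add: dist_norm ell2_apply_simps)
    then show "\<exists>M. \<forall>m\<ge>M. \<forall>n\<ge>M. dist (ell2_apply (X m) g) (ell2_apply (X n) g) < e" by blast
  qed
  then have "\<exists>l. (\<lambda>n. ell2_apply (X n) g) \<longlonglongrightarrow> l" for g
    using Cauchy_convergent convergent_def by blast
  then obtain L where L: "\<And>g. (\<lambda>n. ell2_apply (X n) g) \<longlonglongrightarrow> L g" by metis
  have key: "L2_set (\<lambda>g. norm (ell2_apply (X n) g - L g)) S \<le> e"
    if M: "\<And>m n. m \<ge> M \<Longrightarrow> n \<ge> M \<Longrightarrow> dist (X m) (X n) < e" and "n \<ge> M" and "finite S" for M n e S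
  proof (rule LIMSEQ_le_const2)
    show "(\<lambda>m. L2_set (\<lambda>g. norm (ell2_apply (X n) g - ell2_apply (X m) g)) S)
        \<longlonglongrightarrow> L2_set (\<lambda>g. norm (ell2_apply (X n) g - L g)) S"
      unfolding L2_set_def by (intro tendsto_intros L)
    have "L2_set (\<lambda>g. norm (ell2_apply (X n) g - ell2_apply (X m) g)) S \<le> e" if "m \<ge> M" for m
      using L2_set_ell2_le[of "X n - X m" S] M[OF \<open>n \<ge> M\<close> that]
      by (simp add: dist_norm ell2_apply_simps)
    then show "\<exists>N. \<forall>m\<ge>N. L2_set (\<lambda>g. norm (ell2_apply (X n) g - ell2_apply (X m) g)) S \<le> e" by blast
  qed
  have summ: "(\<lambda>g. (norm (L g))\<^sup>2) summable_on UNIV"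
  proof -
    obtain M where M: "\<And>m n. m \<ge> M \<Longrightarrow> n \<ge> M \<Longrightarrow> dist (X m) (X n) < 1"
      using C unfolding Cauchy_def by (metis zero_less_one)
    have "(\<lambda>g. (norm (ell2_apply (X M) g - L g))\<^sup>2) summable_on UNIV"
      by (rule square_summable_bound(1)[of 1]) (use key[OF M] in auto)
    then have "(\<lambda>g. (norm (L g - ell2_apply (X M) g))\<^sup>2) summable_on UNIV"
      by (simp add: norm_minus_commute)
    from square_summable_add(1)[OF this ell2_apply[of "X M", simplified]] show ?thesis by simp
  qed
  define l where "l = Ell2 L"
  have l: "ell2_apply l = L" using summ by (simp add: l_def Ell2_inverse)
  have "X \<longlonglongrightarrow> l"
  proof (rule metric_LIMSEQ_I)
    fix e :: real assume e: "e > 0"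
    then have "e/2 > 0" by simp
    then obtain M where M: "\<And>m n. m \<ge> M \<Longrightarrow> n \<ge> M \<Longrightarrow> dist (X m) (X n) < e/2"
      using C unfolding Cauchy_def by blast
    have "dist (X n) l < e" if "n \<ge> M" for n
    proof -
      have "norm (X n - l) \<le> e/2"
        unfolding norm_ell2.rep_eq
        by (rule square_summable_bound(2)) (use e key[OF M that] in \<open>auto simp: ell2_apply_simps l\<close>)
      then show ?thesis using e by (simp add: dist_norm)
    qed
    then show "\<exists>M. \<forall>n\<ge>M. dist (X n) l < e" by blast
  qed
  then show "convergent X" by (rule convergentI)
qed

end


section \<open>The C*-algebra of continuous functions\<close>

text \<open>The distribution proves completeness only over a metric domain. On a compact space every
  continuous function is bounded, so \<open>'x \<Rightarrow>\<^sub>C 'd\<close> is then the algebra \<open>C(X, D)\<close>.\<close>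

instance bcontfun :: (topological_space, complete_space) complete_space
proof
  fix f :: "nat \<Rightarrow> ('a, 'b) bcontfun"
  assume "Cauchy f"
  then obtain g where "uniform_limit UNIV f g sequentially"
    using uniformly_convergent_eq_cauchy[of "\<lambda>_. True" f]
    unfolding Cauchy_def uniform_limit_sequentially_iff
    by (metis dist_fun_lt_imp_dist_val_lt)
  from uniform_limit_bcontfunE[OF this sequentially_bot]
  obtain l' where "g = apply_bcontfun l'" "(f \<longlonglongrightarrow> l')" by metis
  then show "convergent f"
    by (intro convergentI)
qed

instance bcontfun :: (topological_space, banach) banach ..

lemma norm_star: "norm (star x) = norm (x :: 'a::cstar_algebra)"
proof -
  have le: "norm y \<le> norm (star y)" for y :: 'a
  proof -
    have "norm y * norm y \<le> norm (star y) * norm y"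
      using norm_mult_ineq[of "star y" y] by (simp add: cstar_identity power2_eq_square)
    then show ?thesis by (cases "norm y = 0") (auto simp: mult_le_cancel_right)
  qed
  from le[of x] le[of "star x"] show ?thesis by (simp add: star_star)
qed

lemma bounded_linear_star: "bounded_linear (star :: 'a::cstar_algebra \<Rightarrow> 'a)"
  by (rule bounded_linear_intro[where K = 1])
     (auto simp: star_add scaleR_scaleC star_scaleC norm_star)

unbundle bcontfun.lifting

instantiation bcontfun :: (topological_space, real_normed_algebra) real_normed_algebra
begin

lift_definition times_bcontfun :: "('a \<Rightarrow>\<^sub>C 'b) \<Rightarrow> ('a \<Rightarrow>\<^sub>C 'b) \<Rightarrow> 'a \<Rightarrow>\<^sub>C 'b" is "\<lambda>f g x. f x * g x"
proof -
  fix f g :: "'a \<Rightarrow> 'b"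
  assume f: "f \<in> bcontfun" and g: "g \<in> bcontfun"
  obtain K where K: "\<And>x. norm (f x) \<le> K" using f by (auto simp: bcontfun_def bounded_iff)
  obtain L where L: "\<And>x. norm (g x) \<le> L" using g by (auto simp: bcontfun_def bounded_iff)
  show "(\<lambda>x. f x * g x) \<in> bcontfun"
  proof (rule bcontfun_normI)
    show "continuous_on UNIV (\<lambda>x. f x * g x)"
      using f g by (auto simp: bcontfun_def intro!: continuous_intros)
    show "norm (f x * g x) \<le> K * L" for x
      by (rule order_trans[OF norm_mult_ineq mult_mono'[OF K L]]) auto
  qed
qed

instance
proof
  fix r :: real and f g h :: "'a \<Rightarrow>\<^sub>C 'b"
  show "f * g * h = f * (g * h)" by transfer (simp add: mult.assoc)
  show "(f + g) * h = f * h + g * h" by transfer (simp add: algebra_simps)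
  show "f * (g + h) = f * g + f * h" by transfer (simp add: algebra_simps)
  show "r *\<^sub>R f * g = r *\<^sub>R (f * g)" by transfer simp
  show "f * r *\<^sub>R g = r *\<^sub>R (f * g)" by transfer simp
  show "norm (f * g) \<le> norm f * norm g"
  proof (rule norm_bound)
    fix x
    have "norm (f x * g x) \<le> norm (f x) * norm (g x)" by (rule norm_mult_ineq)
    also have "\<dots> \<le> norm f * norm g" by (intro mult_mono norm_bounded) auto
    finally show "norm ((f * g) x) \<le> norm f * norm g" by (simp add: times_bcontfun.rep_eq)
  qed
qed

end

instantiation bcontfun :: (topological_space, real_normed_algebra_1) real_normed_algebra_1
begin

lift_definition one_bcontfun :: "'a \<Rightarrow>\<^sub>C 'b" is "\<lambda>_. 1" by (rule const_bcontfun)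

instance
proof
  fix f :: "'a \<Rightarrow>\<^sub>C 'b"
  show "1 * f = f" by transfer simp
  show "f * 1 = f" by transfer simp
  have "apply_bcontfun (0 :: 'a \<Rightarrow>\<^sub>C 'b) x \<noteq> apply_bcontfun 1 x" for x
    by (simp add: one_bcontfun.rep_eq)
  then show "(0 :: 'a \<Rightarrow>\<^sub>C 'b) \<noteq> 1" by metis
  show "norm (1 :: 'a \<Rightarrow>\<^sub>C 'b) = 1"
  proof (rule antisym)
    show "norm (1 :: 'a \<Rightarrow>\<^sub>C 'b) \<le> 1" by (rule norm_bound) (simp add: one_bcontfun.rep_eq)
    show "1 \<le> norm (1 :: 'a \<Rightarrow>\<^sub>C 'b)"
      using norm_bounded[of "1 :: 'a \<Rightarrow>\<^sub>C 'b" undefined] by (simp add: one_bcontfun.rep_eq)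
  qed
qed

end

instantiation bcontfun :: (topological_space, cstar_algebra) cstar_algebra
begin

lift_definition scaleC_bcontfun :: "complex \<Rightarrow> ('a \<Rightarrow>\<^sub>C 'b) \<Rightarrow> 'a \<Rightarrow>\<^sub>C 'b" is "\<lambda>c f x. c *\<^sub>C f x"
proof -
  fix c and f :: "'a \<Rightarrow> 'b"
  assume f: "f \<in> bcontfun"
  obtain K where K: "\<And>x. norm (f x) \<le> K" using f by (auto simp: bcontfun_def bounded_iff)
  show "(\<lambda>x. c *\<^sub>C f x) \<in> bcontfun"
  proof (rule bcontfun_normI)
    show "continuous_on UNIV (\<lambda>x. c *\<^sub>C f x)"
      using f by (auto simp: bcontfun_def intro!: bounded_linear.continuous_on[OF bounded_linear_scaleC])
    show "norm (c *\<^sub>C f x) \<le> cmod c * K" for x by (simp add: norm_scaleC K mult_left_mono)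
  qed
qed

lift_definition star_bcontfun :: "('a \<Rightarrow>\<^sub>C 'b) \<Rightarrow> 'a \<Rightarrow>\<^sub>C 'b" is "\<lambda>f x. star (f x)"
proof -
  fix f :: "'a \<Rightarrow> 'b"
  assume f: "f \<in> bcontfun"
  obtain K where K: "\<And>x. norm (f x) \<le> K" using f by (auto simp: bcontfun_def bounded_iff)
  show "(\<lambda>x. star (f x)) \<in> bcontfun"
  proof (rule bcontfun_normI)
    show "continuous_on UNIV (\<lambda>x. star (f x))"
      using f by (auto simp: bcontfun_def intro!: bounded_linear.continuous_on[OF bounded_linear_star])
    show "norm (star (f x)) \<le> K" for x by (simp add: norm_star K)
  qed
qed

instance
proof
  fix a b :: complex and r :: real and f g :: "'a \<Rightarrow>\<^sub>C 'b"
  show "a *\<^sub>C (f + g) = a *\<^sub>C f + a *\<^sub>C g" by transfer (simp add: scaleC_add_right)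
  show "(a + b) *\<^sub>C f = a *\<^sub>C f + b *\<^sub>C f" by transfer (simp add: scaleC_add_left)
  show "a *\<^sub>C b *\<^sub>C f = (a * b) *\<^sub>C f" by transfer (simp add: scaleC_scaleC)
  show "r *\<^sub>R f = complex_of_real r *\<^sub>C f" by transfer (simp add: scaleR_scaleC)
  have le: "norm (a *\<^sub>C f) \<le> cmod a * norm f" for a and f :: "'a \<Rightarrow>\<^sub>C 'b"
    by (rule norm_bound) (simp add: scaleC_bcontfun.rep_eq norm_scaleC norm_bounded mult_left_mono)
  show "norm (a *\<^sub>C f) = cmod a * norm f"
  proof (cases "a = 0")
    case True
    then show ?thesis using le[of a f] by simp
  next
    case False
    have "inverse a *\<^sub>C a *\<^sub>C f = f"
      using False by transfer (simp add: scaleC_scaleC scaleC_one)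
    then have "norm f \<le> cmod (inverse a) * norm (a *\<^sub>C f)" by (metis le)
    then have "cmod a * norm f \<le> norm (a *\<^sub>C f)" using False
      by (simp add: norm_inverse norm_divide field_simps)
    then show ?thesis using le[of a f] by simp
  qed
  show "a *\<^sub>C f * g = a *\<^sub>C (f * g)" by transfer (simp add: mult_scaleC_left)
  show "f * a *\<^sub>C g = a *\<^sub>C (f * g)" by transfer (simp add: mult_scaleC_right)
  show "star (star f) = f" by transfer (simp add: star_star)
  show "star (f + g) = star f + star g" by transfer (simp add: star_add)
  show "star (a *\<^sub>C f) = cnj a *\<^sub>C star f" by transfer (simp add: star_scaleC)
  show "star (f * g) = star g * star f" by transfer (simp add: star_mult)
  show "norm (star f * f) = (norm f)\<^sup>2"
  proof (rule antisym)
    show "norm (star f * f) \<le> (norm f)\<^sup>2"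
      by (rule norm_bound)
         (simp add: times_bcontfun.rep_eq star_bcontfun.rep_eq cstar_identity norm_bounded power_mono)
    have "norm f \<le> sqrt (norm (star f * f))"
    proof (rule norm_bound)
      fix x
      have "(norm (f x))\<^sup>2 \<le> norm (star f * f)"
        using norm_bounded[of "star f * f" x]
        by (simp add: times_bcontfun.rep_eq star_bcontfun.rep_eq cstar_identity)
      then show "norm (f x) \<le> sqrt (norm (star f * f))" by (rule real_le_rsqrt)
    qed
    then have "(norm f)\<^sup>2 \<le> (sqrt (norm (star f * f)))\<^sup>2" by (rule power_mono) simp
    then show "(norm f)\<^sup>2 \<le> norm (star f * f)" by simp
  qed
qed

end

section \<open>Purely infinite simple C*-algebras\<close>

text \<open>The notions below are stated for a C*-subalgebra \<open>A\<close> of an ambient C*-algebra and refer only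
  to elements of \<open>A\<close>. A C*-algebra that is a type is treated as \<open>UNIV\<close>.\<close>

definition cstar_subalgebra :: "'a::cstar_algebra set \<Rightarrow> bool" where
  "cstar_subalgebra A \<longleftrightarrow> closed A \<and> 0 \<in> A \<and>
     (\<forall>x\<in>A. \<forall>y\<in>A. x + y \<in> A \<and> x * y \<in> A) \<and> (\<forall>x\<in>A. star x \<in> A \<and> (\<forall>c. c *\<^sub>C x \<in> A))"

definition closed_ideal :: "'a::cstar_algebra set \<Rightarrow> 'a set \<Rightarrow> bool" where
  "closed_ideal I A \<longleftrightarrow> I \<subseteq> A \<and> closed I \<and> 0 \<in> I \<and>
     (\<forall>x\<in>I. \<forall>y\<in>I. x + y \<in> I) \<and> (\<forall>x\<in>I. \<forall>c. c *\<^sub>C x \<in> I) \<and>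
     (\<forall>x\<in>I. \<forall>a\<in>A. a * x \<in> I \<and> x * a \<in> I)"

definition simple_cstar :: "'a::cstar_algebra set \<Rightarrow> bool" where
  "simple_cstar A \<longleftrightarrow> cstar_subalgebra A \<and> A \<noteq> {0} \<and> (\<forall>I. closed_ideal I A \<longrightarrow> I = {0} \<or> I = A)"

definition positive_in :: "'a::cstar_algebra set \<Rightarrow> 'a \<Rightarrow> bool" where
  "positive_in A a \<longleftrightarrow> (\<exists>x\<in>A. a = star x * x)"

definition hereditary :: "'a::cstar_algebra set \<Rightarrow> 'a set \<Rightarrow> bool" where
  "hereditary B A \<longleftrightarrow> cstar_subalgebra B \<and> B \<subseteq> A \<and>
     (\<forall>a\<in>A. \<forall>b\<in>B. positive_in A a \<and> positive_in A (b - a) \<longrightarrow> a \<in> B)"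

definition projection :: "'a::cstar_algebra \<Rightarrow> bool" where
  "projection p \<longleftrightarrow> star p = p \<and> p * p = p"

text \<open>\<open>p\<close> is Murray-von Neumann equivalent in \<open>A\<close> to a proper subprojection of itself.\<close>

definition infinite_projection :: "'a::cstar_algebra set \<Rightarrow> 'a \<Rightarrow> bool" where
  "infinite_projection A p \<longleftrightarrow> p \<in> A \<and> projection p \<and>
     (\<exists>q\<in>A. projection q \<and> p * q = q \<and> q \<noteq> p \<and> (\<exists>v\<in>A. star v * v = p \<and> v * star v = q))"

text \<open>Cuntz' definition: every nonzero hereditary C*-subalgebra contains an infinite projection.\<close>

definition purely_infinite_simple :: "'a::cstar_algebra set \<Rightarrow> bool" where
  "purely_infinite_simple A \<longleftrightarrow> simple_cstar A \<and>
     (\<forall>B. hereditary B A \<and> B \<noteq> {0} \<longrightarrow> (\<exists>p\<in>B. infinite_projection A p))"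

section \<open>Homomorphisms and actions\<close>

definition star_hom :: "('a::cstar_algebra \<Rightarrow> 'b::cstar_algebra) \<Rightarrow> bool" where
  "star_hom \<phi> \<longleftrightarrow> (\<forall>x y. \<phi> (x + y) = \<phi> x + \<phi> y) \<and> (\<forall>c x. \<phi> (c *\<^sub>C x) = c *\<^sub>C \<phi> x) \<and>
     (\<forall>x y. \<phi> (x * y) = \<phi> x * \<phi> y) \<and> (\<forall>x. \<phi> (star x) = star (\<phi> x))"

definition star_aut :: "('a::cstar_algebra \<Rightarrow> 'a) \<Rightarrow> bool" where
  "star_aut \<phi> \<longleftrightarrow> star_hom \<phi> \<and> bij \<phi>"

text \<open>Groups are written additively, following the class \<open>group_add\<close>, which does not assume
  commutativity: \<open>0\<close> is the identity of \<open>G\<close>, \<open>g + h\<close> the product \<open>gh\<close> and \<open>- g\<close> the inverse of \<open>g\<close>.\<close>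

definition cstar_action :: "('g::group_add \<Rightarrow> 'a::cstar_algebra \<Rightarrow> 'a) \<Rightarrow> bool" where
  "cstar_action \<alpha> \<longleftrightarrow> (\<forall>g. star_aut (\<alpha> g)) \<and> (\<forall>a. \<alpha> 0 a = a) \<and> (\<forall>g h a. \<alpha> (g + h) a = \<alpha> g (\<alpha> h a))"

definition top_action :: "('g::group_add \<Rightarrow> 'x::topological_space \<Rightarrow> 'x) \<Rightarrow> bool" where
  "top_action act \<longleftrightarrow> (\<forall>g. continuous_on UNIV (act g)) \<and> (\<forall>x. act 0 x = x) \<and>
     (\<forall>g h x. act (g + h) x = act g (act h x))"

definition minimal_action :: "('g::group_add \<Rightarrow> 'x::topological_space \<Rightarrow> 'x) \<Rightarrow> bool" where
  "minimal_action act \<longleftrightarrow> (\<forall>T. closed T \<and> (\<forall>g. act g ` T \<subseteq> T) \<longrightarrow> T = {} \<or> T = UNIV)"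

definition lies_over ::
    "('g::group_add \<Rightarrow> ('x::topological_space \<Rightarrow>\<^sub>C 'd::cstar_algebra) \<Rightarrow> ('x \<Rightarrow>\<^sub>C 'd)) \<Rightarrow>
     ('g \<Rightarrow> 'x \<Rightarrow> 'x) \<Rightarrow> bool" where
  "lies_over \<alpha> act \<longleftrightarrow> (\<exists>\<beta> :: 'g \<Rightarrow> 'x \<Rightarrow> 'd \<Rightarrow> 'd. (\<forall>g x. star_aut (\<beta> g x)) \<and>
     (\<forall>g x a. apply_bcontfun (\<alpha> g a) x = \<beta> g x (apply_bcontfun a (act (- g) x))))"

section \<open>Reduced crossed products\<close>

definition faithful_representation :: "('a::cstar_algebra \<Rightarrow> 'h::chilbert_space bop) \<Rightarrow> bool" where
  "faithful_representation \<pi> \<longleftrightarrow> star_hom \<pi> \<and> inj \<pi>"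

text \<open>The regular representation of the skew group ring (finitely supported functions \<open>f : G \<rightarrow> A\<close>,
  standing for the formal sums of \<open>f(g) u\<^sub>g\<close>) on \<open>l\<^sup>2(G, H)\<close> induced by \<open>\<pi> : A \<rightarrow> B(H)\<close>. It is
  \<open>f \<mapsto> \<Sum>\<^sub>g \<sigma>(f(g)) v\<^sub>g\<close> for the covariant pair
  \<open>(\<sigma>(a) \<xi>)(h) = \<pi>(\<alpha>\<^bsub>h\<^esub>\<inverse>(a)) \<xi>(h)\<close>, \<open>(v\<^sub>g \<xi>)(h) = \<xi>(g\<inverse>h)\<close>.\<close>

definition regular_representation ::
    "('a::cstar_algebra \<Rightarrow> 'h::chilbert_space bop) \<Rightarrow> ('g::group_add \<Rightarrow> 'a \<Rightarrow> 'a) \<Rightarrow>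
     ('g \<Rightarrow> 'a) \<Rightarrow> ('g, 'h) ell2 bop" where
  "regular_representation \<pi> \<alpha> f = (THE T. \<forall>\<xi> h. ell2_apply (bop_apply T \<xi>) h =
     (\<Sum>g | f g \<noteq> 0. bop_apply (\<pi> (\<alpha> (- h) (f g))) (ell2_apply \<xi> (- g + h))))"

text \<open>For faithful \<open>\<pi>\<close> this is the reduced crossed product; up to isomorphism it does not depend on
  the choice of \<open>\<pi>\<close>.\<close>

definition reduced_crossed_product ::
    "('a::cstar_algebra \<Rightarrow> 'h::chilbert_space bop) \<Rightarrow> ('g::group_add \<Rightarrow> 'a \<Rightarrow> 'a) \<Rightarrow>
     ('g, 'h) ell2 bop set" where
  "reduced_crossed_product \<pi> \<alpha> = closure (regular_representation \<pi> \<alpha> ` {f. finite {g. f g \<noteq> 0}})"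

subsection \<open>The regular representation is well defined\<close>

lemma star_one: "star 1 = (1 :: 'a::{cstar_algebra, real_normed_algebra_1})"
  by (metis mult.right_neutral mult.left_neutral star_mult star_star)

lemma abs_half_gchoose_le: "\<bar>(1/2 :: real) gchoose n\<bar> \<le> 1"
proof (induction n)
  case (Suc n)
  have "(1/2 :: real) gchoose Suc n = ((1/2 :: real) gchoose n) * ((1/2 - real n) / (real n + 1))"
    using gbinomial_mult_1[of "1/2 :: real" n] by (simp add: field_simps)
  then have "\<bar>(1/2 :: real) gchoose Suc n\<bar> = \<bar>(1/2 :: real) gchoose n\<bar> * (\<bar>1/2 - real n\<bar> / (real n + 1))"
    by (simp add: abs_mult abs_divide)
  also have "\<dots> \<le> 1 * 1" by (intro mult_mono Suc.IH) (auto simp: field_simps)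
  finally show ?case by simp
qed simp

lemma selfadjoint_sqrt:
  fixes x :: "'a::{cstar_algebra, real_normed_algebra_1}"
  assumes "norm x < 1" "star x = x"
  shows "\<exists>s. s * s = 1 - x \<and> star s = s \<and> (\<forall>y. y * x = x * y \<longrightarrow> y * s = s * y)"
proof -
  define c where "c n = ((1/2 :: real) gchoose n) * (-1) ^ n" for n
  define a where "a n = c n *\<^sub>R x ^ n" for n
  have "norm (a n) \<le> norm x ^ n" for n
  proof -
    have "norm (a n) \<le> 1 * norm x ^ n"
      unfolding a_def norm_scaleR
      by (intro mult_mono norm_power_ineq) (auto simp: c_def abs_mult abs_half_gchoose_le power_abs)
    then show ?thesis by simp
  qed
  then have nsum: "summable (\<lambda>n. norm (a n))"
    by (intro summable_comparison_test[OF _ summable_geometric[of "norm x"]]) (use assms in auto)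
  then have sums: "summable a" by (rule summable_norm_cancel)
  define s where "s = suminf a"
  have coeff: "(\<Sum>i\<le>n. c i * c (n - i)) = (1 gchoose n) * (-1) ^ n" for n
  proof -
    have "(\<Sum>i\<le>n. c i * c (n - i)) = (\<Sum>i\<le>n. ((1/2 gchoose i) * (1/2 gchoose (n - i))) * (-1) ^ n)"
      by (intro sum.cong) (auto simp: c_def power_add[symmetric] mult_ac)
    also have "\<dots> = ((1/2 + 1/2) gchoose n) * (-1) ^ n"
      unfolding sum_distrib_right[symmetric] gbinomial_Vandermonde[symmetric] atLeast0AtMost ..
    finally show ?thesis by simp
  qed
  have "(\<Sum>i\<le>n. a i * a (n - i)) = (\<Sum>i\<le>n. c i * c (n - i)) *\<^sub>R x ^ n" for n
    by (simp add: a_def scaleR_sum_left power_add[symmetric] mult.commute)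
  then have "(\<lambda>n. ((1 gchoose n) * (-1) ^ n) *\<^sub>R x ^ n) sums (s * s)"
    using Cauchy_product_sums[OF nsum nsum] by (simp add: coeff s_def)
  moreover have "(\<lambda>n. ((1 gchoose n) * (-1) ^ n) *\<^sub>R x ^ n) sums
      (\<Sum>n\<in>{0,1}. ((1 gchoose n) * (-1) ^ n) *\<^sub>R x ^ n)"
  proof (rule sums_finite)
    fix n :: nat assume "n \<notin> {0, 1}"
    then have "(1::real) gchoose n = 0"
      using binomial_gbinomial[of 1 n, where ?'a = real] by (simp add: binomial_eq_0)
    then show "((1 gchoose n) * (-1) ^ n) *\<^sub>R x ^ n = 0" by simp
  qed simp
  ultimately have "s * s = 1 - x" using sums_unique2 by fastforce
  moreover have "star s = s"
  proof -
    have "star (x ^ n) = x ^ n" for n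
      by (induction n) (simp_all add: star_one star_mult assms power_commutes)
    then have "star (a n) = a n" for n by (simp add: a_def scaleR_scaleC star_scaleC)
    then show ?thesis
      unfolding s_def by (simp add: bounded_linear.suminf[OF bounded_linear_star sums])
  qed
  moreover have "y * s = s * y" if "y * x = x * y" for y
  proof -
    have "y * x ^ n = x ^ n * y" for n
      by (induction n) (simp_all, metis that mult.assoc)
    then have "y * a n = a n * y" for n by (simp add: a_def)
    then show ?thesis
      unfolding s_def using suminf_mult[OF sums, of y] suminf_mult2[OF sums, of y] by simp
  qed
  ultimately show ?thesis by blast
qed

lemma star_hom_contractive:
  fixes \<phi> :: "'a::{cstar_algebra, real_normed_algebra_1} \<Rightarrow> 'b::cstar_algebra"
  assumes \<phi>: "star_hom \<phi>"
  shows "norm (\<phi> x) \<le> norm x"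
proof -
  have add: "\<And>x y. \<phi> (x + y) = \<phi> x + \<phi> y" and sc: "\<And>c x. \<phi> (c *\<^sub>C x) = c *\<^sub>C \<phi> x"
    and mult: "\<And>x y. \<phi> (x * y) = \<phi> x * \<phi> y" and st: "\<And>x. \<phi> (star x) = star (\<phi> x)"
    using \<phi> by (auto simp: star_hom_def)
  have one: "norm (\<phi> 1) \<le> 1"
  proof -
    have "(norm (\<phi> 1))\<^sup>2 = norm (\<phi> 1)"
      using cstar_identity[of "\<phi> 1"] by (simp flip: st mult add: star_one)
    then show ?thesis by (auto simp: power2_eq_square)
  qed
  have small: "norm (\<phi> y) \<le> 1" if y: "star y = y" "norm y < 1" for y
  proof -
    have "norm (y * y) < 1"
      using norm_mult_ineq[of y y] y(2) mult_strict_mono'[of "norm y" 1 "norm y" 1] by simp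
    then obtain s where s: "s * s = 1 - y * y" "star s = s" "y * s = s * y"
      using selfadjoint_sqrt[of "y * y"] y(1) by (auto simp: star_mult mult.assoc)
    define u where "u = y + \<i> *\<^sub>C s"
    have su: "star u = y + (- \<i>) *\<^sub>C s"
      using s y by (simp add: u_def star_add star_scaleC)
    have "star u * u = 1"
    proof -
      have "star u * u = y * y + (\<i> *\<^sub>C (y * s) + (- \<i>) *\<^sub>C (s * y)) + ((- \<i>) * \<i>) *\<^sub>C (s * s)"
        unfolding su unfolding u_def
        by (simp add: distrib_left distrib_right mult_scaleC_left mult_scaleC_right scaleC_scaleC
            scaleC_add_right)
      also have "\<i> *\<^sub>C (y * s) + (- \<i>) *\<^sub>C (s * y) = (\<i> + (- \<i>)) *\<^sub>C (s * y)"
        unfolding s(3) by (rule scaleC_add_left[symmetric])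
      also have "(\<i> + (- \<i>)) *\<^sub>C (s * y) = 0" using norm_scaleC[of 0 "s * y"] by simp
      finally show ?thesis by (simp add: s scaleC_one)
    qed
    then have "(norm (\<phi> u))\<^sup>2 = norm (\<phi> 1)"
      using cstar_identity[of "\<phi> u"] by (simp flip: st mult)
    then have nu: "norm (\<phi> u) \<le> 1" using one power2_le_imp_le[of "norm (\<phi> u)" 1] by simp
    have "2 *\<^sub>R y = u + star u"
    proof -
      have "\<i> *\<^sub>C s + (- \<i>) *\<^sub>C s = 0"
        using norm_scaleC[of 0 s] scaleC_add_left[of \<i> "-\<i>" s] by simp
      moreover have "u + star u = (y + y) + (\<i> *\<^sub>C s + (- \<i>) *\<^sub>C s)"
        unfolding su unfolding u_def by (simp only: add_ac)
      ultimately show ?thesis by (simp add: scaleR_2)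
    qed
    then have "\<phi> (2 *\<^sub>R y) = \<phi> u + star (\<phi> u)" by (simp add: add st)
    then have "norm (2 *\<^sub>R \<phi> y) \<le> norm (\<phi> u) + norm (star (\<phi> u))"
      by (simp add: scaleR_scaleC sc norm_triangle_ineq)
    then show ?thesis using nu by (simp add: norm_star)
  qed
  have selfadj: "norm (\<phi> y) \<le> norm y" if y: "star y = y" for y
  proof (rule field_le_epsilon)
    fix e :: real assume e: "e > 0"
    define t where "t = norm y + e"
    have t: "t > 0" using e by (simp add: t_def add_nonneg_pos)
    have nt: "cmod (complex_of_real (inverse t)) = inverse t" using t by (simp only: norm_of_real) simp
    have "norm (\<phi> (complex_of_real (inverse t) *\<^sub>C y)) \<le> 1"
    proof (rule small)
      show "star (complex_of_real (inverse t) *\<^sub>C y) = complex_of_real (inverse t) *\<^sub>C y"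
        by (simp add: star_scaleC y)
      have "inverse t * norm y < 1" using t e by (simp add: t_def field_simps)
      then show "norm (complex_of_real (inverse t) *\<^sub>C y) < 1" by (simp only: norm_scaleC nt)
    qed
    then have "inverse t * norm (\<phi> y) \<le> 1" by (simp only: sc norm_scaleC nt)
    then show "norm (\<phi> y) \<le> norm y + e" using t unfolding t_def[symmetric] by (simp add: field_simps)
  qed
  have "(norm (\<phi> x))\<^sup>2 = norm (\<phi> (star x * x))" by (simp add: st mult cstar_identity)
  also have "\<dots> \<le> norm (star x * x)" by (rule selfadj) (simp add: star_mult star_star)
  also have "\<dots> = (norm x)\<^sup>2" by (rule cstar_identity)
  finally show ?thesis by (simp add: power_mono_iff)
qed

lemma regular_summand_exists:
  fixes \<pi> :: "'a::{cstar_algebra, real_normed_algebra_1} \<Rightarrow> 'h::chilbert_space bop"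
    and \<alpha> :: "'g::group_add \<Rightarrow> 'a \<Rightarrow> 'a"
  assumes \<pi>: "star_hom \<pi>" and \<alpha>: "\<And>g. star_hom (\<alpha> g)"
  shows "\<exists>T. \<forall>\<xi> h. ell2_apply (bop_apply T \<xi>) h = bop_apply (\<pi> (\<alpha> (- h) a)) (ell2_apply \<xi> (- g + h))"
proof -
  define F where "F \<xi> h = bop_apply (\<pi> (\<alpha> (- h) a)) (ell2_apply \<xi> (- g + h))" for \<xi> :: "('g, 'h) ell2" and h
  have na: "norm (\<pi> (\<alpha> h a)) \<le> norm a" for h
    using star_hom_contractive[OF \<pi>] star_hom_contractive[OF \<alpha>] order_trans by blast
  have nF: "norm (F \<xi> h) \<le> norm a * norm (ell2_apply \<xi> (- g + h))" for \<xi> h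
    unfolding F_def by (rule order_trans[OF norm_bop_apply mult_right_mono[OF na]]) simp
  have bd: "L2_set (\<lambda>h. norm (F \<xi> h)) S \<le> norm a * norm \<xi>" for \<xi> S
  proof -
    have "L2_set (\<lambda>h. norm (F \<xi> h)) S \<le> L2_set (\<lambda>h. norm a * norm (ell2_apply \<xi> (- g + h))) S"
      by (intro L2_set_mono nF) auto
    also have "\<dots> = norm a * L2_set (\<lambda>h. norm (ell2_apply \<xi> (- g + h))) S"
      by (simp add: L2_set_right_distrib)
    also have "L2_set (\<lambda>h. norm (ell2_apply \<xi> (- g + h))) S
        = L2_set (\<lambda>h. norm (ell2_apply \<xi> h)) ((+) (- g) ` S)"
      unfolding L2_set_def by (subst sum.reindex) (auto simp: inj_on_def o_def)
    also have "norm a * \<dots> \<le> norm a * norm \<xi>" by (intro mult_left_mono L2_set_ell2_le) simp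
    finally show ?thesis .
  qed
  have "(\<lambda>h. (norm (F \<xi> h))\<^sup>2) summable_on UNIV" for \<xi>
    by (rule square_summable_bound(1)[OF _ bd]) simp
  then have F: "ell2_apply (Ell2 (F \<xi>)) = F \<xi>" for \<xi> by (simp add: Ell2_inverse)
  have "bounded_linear (\<lambda>\<xi>. Ell2 (F \<xi>))"
  proof (rule bounded_linear_intro[where K = "norm a"])
    fix \<xi> \<eta> r
    show "Ell2 (F (\<xi> + \<eta>)) = Ell2 (F \<xi>) + Ell2 (F \<eta>)"
      by (rule ell2_eqI)
         (simp add: F ell2_apply_simps, simp add: F_def ell2_apply_simps linear_simps(1)[OF bounded_linear_bop_apply])
    show "Ell2 (F (r *\<^sub>R \<xi>)) = r *\<^sub>R Ell2 (F \<xi>)"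
      by (rule ell2_eqI)
         (simp add: F ell2_apply_simps, simp add: F_def ell2_apply_simps linear_simps(5)[OF bounded_linear_bop_apply])
    show "norm (Ell2 (F \<xi>)) \<le> norm \<xi> * norm a"
      using square_summable_bound(2)[OF _ bd, of \<xi>] by (simp add: norm_ell2.rep_eq[of "Ell2 _"] F mult.commute)
  qed
  moreover have "Ell2 (F (c *\<^sub>C \<xi>)) = c *\<^sub>C Ell2 (F \<xi>)" for c \<xi>
    by (rule ell2_eqI)
       (simp add: F ell2_apply_simps, simp add: F_def ell2_apply_simps bop_apply_scaleC)
  ultimately obtain T where T: "\<And>\<xi>. bop_apply T \<xi> = Ell2 (F \<xi>)"
    using bop_exists[of "\<lambda>\<xi>. Ell2 (F \<xi>)"] by blast
  show ?thesis by (rule exI[of _ T]) (simp add: T F, simp add: F_def)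
qed

lemma bop_apply_sum: "bop_apply (sum T S) x = (\<Sum>i\<in>S. bop_apply (T i) x)"
  by (induction S rule: infinite_finite_induct) (simp_all add: bop_apply_simps)

lemma ell2_apply_sum: "ell2_apply (sum f S) x = (\<Sum>i\<in>S. ell2_apply (f i) x)"
  by (induction S rule: infinite_finite_induct) (simp_all add: ell2_apply_simps)

lemma regular_representation_apply:
  fixes \<pi> :: "'a::{cstar_algebra, real_normed_algebra_1} \<Rightarrow> 'h::chilbert_space bop"
    and \<alpha> :: "'g::group_add \<Rightarrow> 'a \<Rightarrow> 'a"
  assumes "faithful_representation \<pi>" "cstar_action \<alpha>"
  shows "ell2_apply (bop_apply (regular_representation \<pi> \<alpha> f) \<xi>) h =
     (\<Sum>g | f g \<noteq> 0. bop_apply (\<pi> (\<alpha> (- h) (f g))) (ell2_apply \<xi> (- g + h)))"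
proof -
  have "\<exists>T. \<forall>\<xi> h. ell2_apply (bop_apply T \<xi>) h = bop_apply (\<pi> (\<alpha> (- h) (f g))) (ell2_apply \<xi> (- g + h))" for g
    by (rule regular_summand_exists)
       (use assms in \<open>auto simp: faithful_representation_def cstar_action_def star_aut_def\<close>)
  then obtain T where T: "\<And>g \<xi> h. ell2_apply (bop_apply (T g) \<xi>) h =
      bop_apply (\<pi> (\<alpha> (- h) (f g))) (ell2_apply \<xi> (- g + h))" by metis
  let ?P = "\<lambda>T. \<forall>\<xi> h. ell2_apply (bop_apply T \<xi>) h =
     (\<Sum>g | f g \<noteq> 0. bop_apply (\<pi> (\<alpha> (- h) (f g))) (ell2_apply \<xi> (- g + h)))"
  have "?P (sum T {g. f g \<noteq> 0})" by (simp add: bop_apply_sum ell2_apply_sum T)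
  moreover have "S = S'" if "?P S" "?P S'" for S S'
    using that by (intro bop_eqI ell2_eqI) simp
  ultimately have "\<exists>!T. ?P T" by blast
  from theI'[OF this] show ?thesis by (simp add: regular_representation_def)
qed

end

theory Submission
  imports Defs
begin

text \<open>Write \<open>M\<close> for the crossed product and \<open>q\<close> for its unit. Everything follows from one property:
  for each nonzero \<open>y \<in> M\<close> there is \<open>x \<in> M\<close> with \<open>x\<^sup>* y\<^sup>* y x = q\<close>. It puts \<open>q\<close> into every nonzero ideal.
  Applied to \<open>h = b\<^sup>* b\<close> for a nonzero \<open>b\<close> in a hereditary subalgebra it gives an isometry \<open>v = h x\<close>
  whose range projection lies in that subalgebra and is equivalent to \<open>q\<close>, and \<open>q\<close> is infinite because
  the constant functions contain a proper isometry (\<open>purely_infinite_simple_criterion\<close>).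

  The property itself is obtained in two moves. First, \<open>y\<^sup>* y\<close> is compressed almost to a scalar function
  (\<open>compression_into_scalars\<close>). Its conditional expectation \<open>e \<in> C(X, D)\<close> is nonzero and of the form
  \<open>s\<^sup>2\<close>, so pure infiniteness of \<open>D\<close> supplies a constant \<open>z\<close> with \<open>z\<^sup>* e(x) z\<close> close to \<open>1\<close> on a nonempty
  open set \<open>V\<close>. Fix \<open>z\<close>, and only then approximate \<open>y\<^sup>* y\<close> by a finite sum \<open>\<Sum> f(g) u\<^sub>g\<close>; its support
  is moved off a small open \<open>U \<subseteq> V\<close> by density of the points with trivial isotropy, and a bump
  function supported in \<open>U\<close> kills every term with \<open>g \<noteq> 0\<close>. Second, the bump function is spread over
  \<open>X\<close> (\<open>averaging_isometry\<close>): by minimality and compactness finitely many translates of the set where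
  it equals \<open>1\<close> cover \<open>X\<close>, and with a quadratic partition of unity \<open>\<eta>\<^sub>g\<close> and isometries \<open>t\<^sub>g \<in> D\<close> of
  orthogonal ranges the element \<open>Y = \<Sum> t\<^sub>g u\<^sub>g\<^sup>* \<eta>\<^sub>g\<close> is an isometry that carries the bump function to
  \<open>q\<close>. Since \<open>\<parallel>Y\<parallel> \<le> 1\<close>, the errors of the first move are not amplified, and an element near \<open>q\<close> can be
  normalized exactly (\<open>near_unit_normalizable\<close>).

  What is needed of \<open>D\<close> is that \<open>z\<^sup>* d z = 1\<close> is solvable for every nonzero positive \<open>d\<close>
  (\<open>purely_infinite_positive_dominates_unit\<close>). In place of functional calculus, a single
  iteration produces square roots of \<open>1 - x\<close> for \<open>\<parallel>x\<parallel> \<le> 1\<close>, these make injective *-homomorphisms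
  isometric, and positivity is then read off from quadratic forms in the given Hilbert space
  representation.\<close>

section \<open>Elementary facts on C*-algebras\<close>

lemma star_zero [simp]: "star (0 :: 'a::cstar_algebra) = 0"
  using bounded_linear.linear[OF bounded_linear_star] by (rule linear_0)

lemma star_minus: "star (- x) = - star (x :: 'a::cstar_algebra)"
  using bounded_linear.linear[OF bounded_linear_star] by (rule linear_neg)

lemma star_diff: "star (x - y) = star x - star (y :: 'a::cstar_algebra)"
  using bounded_linear.linear[OF bounded_linear_star] by (rule linear_diff)

lemma star_scaleR: "star (r *\<^sub>R x) = r *\<^sub>R star (x :: 'a::cstar_algebra)"
  using bounded_linear.linear[OF bounded_linear_star] by (rule linear_scale)

lemma star_sum: "star (sum f S) = (\<Sum>i\<in>S. star (f i :: 'a::cstar_algebra))"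
  using bounded_linear.linear[OF bounded_linear_star] by (rule linear_sum)

lemmas star_simps = star_star star_add star_mult star_diff star_minus star_scaleR

lemma star_mult_self_eq_0: "star x * x = 0 \<Longrightarrow> x = (0 :: 'a::cstar_algebra)"
  using cstar_identity[of x] by simp

lemma star_homD:
  assumes "star_hom \<phi>"
  shows "\<phi> (x + y) = \<phi> x + \<phi> y" "\<phi> (c *\<^sub>C x) = c *\<^sub>C \<phi> x" "\<phi> (x * y) = \<phi> x * \<phi> y"
    "\<phi> (star x) = star (\<phi> x)" "\<phi> (r *\<^sub>R x) = r *\<^sub>R \<phi> x" "\<phi> (- x) = - \<phi> x" "\<phi> (x - y) = \<phi> x - \<phi> y"
    "\<phi> 0 = 0"
proof -
  show add: "\<phi> (x + y) = \<phi> x + \<phi> y" and sc: "\<phi> (c *\<^sub>C x) = c *\<^sub>C \<phi> x" "\<phi> (x * y) = \<phi> x * \<phi> y"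
    "\<phi> (star x) = star (\<phi> x)" for x y c using assms by (auto simp: star_hom_def)
  show R: "\<phi> (r *\<^sub>R x) = r *\<^sub>R \<phi> x" for r x by (simp add: scaleR_scaleC sc)
  show m: "\<phi> (- x) = - \<phi> x" for x using R[of "-1" x] by simp
  show "\<phi> (x - y) = \<phi> x - \<phi> y" using add[of x "- y"] m[of y] by simp
  show "\<phi> 0 = 0" using add[of 0 0] by simp
qed

lemma star_hom_sum: "star_hom \<phi> \<Longrightarrow> \<phi> (sum f S) = (\<Sum>i\<in>S. \<phi> (f i))"
  by (induction S rule: infinite_finite_induct) (simp_all add: star_homD)

lemma cstar_subalgebraD:
  assumes "cstar_subalgebra M"
  shows "closed M" "0 \<in> M" "x \<in> M \<Longrightarrow> y \<in> M \<Longrightarrow> x + y \<in> M" "x \<in> M \<Longrightarrow> y \<in> M \<Longrightarrow> x * y \<in> M"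
    "x \<in> M \<Longrightarrow> star x \<in> M" "x \<in> M \<Longrightarrow> c *\<^sub>C x \<in> M" "x \<in> M \<Longrightarrow> r *\<^sub>R x \<in> M"
    "x \<in> M \<Longrightarrow> y \<in> M \<Longrightarrow> x - y \<in> M"
proof -
  show "closed M" "0 \<in> M" "x \<in> M \<Longrightarrow> y \<in> M \<Longrightarrow> x * y \<in> M" "x \<in> M \<Longrightarrow> star x \<in> M"
    and a: "x \<in> M \<Longrightarrow> y \<in> M \<Longrightarrow> x + y \<in> M"
    and c: "x \<in> M \<Longrightarrow> c *\<^sub>C x \<in> M" for x y c
    using assms by (auto simp: cstar_subalgebra_def)
  show r: "x \<in> M \<Longrightarrow> r *\<^sub>R x \<in> M" for r x by (simp add: scaleR_scaleC c)
  show "x \<in> M \<Longrightarrow> y \<in> M \<Longrightarrow> x - y \<in> M" using a[of x "- y"] r[of y "-1"] by simp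
qed

lemma cstar_subalgebra_UNIV: "cstar_subalgebra UNIV"
  by (simp add: cstar_subalgebra_def)

lemma cstar_subalgebra_sum:
  "cstar_subalgebra M \<Longrightarrow> (\<And>i. i \<in> S \<Longrightarrow> f i \<in> M) \<Longrightarrow> sum f S \<in> M"
  by (induction S rule: infinite_finite_induct) (auto intro: cstar_subalgebraD)

section \<open>Square roots by iteration\<close>

text \<open>The fixed points of this iteration satisfy \<open>2 t - t\<^sup>2 = x\<close>, that is, \<open>(1 - t)\<^sup>2 = 1 - x\<close>. Working with
  \<open>t = 1 - \<surd>(1 - x)\<close> in place of the root itself makes sense without a unit, so the same construction
  serves in the crossed product, whose unit need not be the identity operator.\<close>

primrec sqrt_iter :: "'a::real_normed_algebra \<Rightarrow> nat \<Rightarrow> 'a" where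
  "sqrt_iter x 0 = 0"
| "sqrt_iter x (Suc n) = (1/2) *\<^sub>R (x + sqrt_iter x n * sqrt_iter x n)"

definition sqrt_defect :: "'a::{real_normed_algebra, banach} \<Rightarrow> 'a" where
  "sqrt_defect x = lim (sqrt_iter x)"

lemma sqrt_iter_real: "0 \<le> sqrt_iter (1::real) n" "sqrt_iter (1::real) n \<le> 1"
  "sqrt_iter (1::real) n \<le> sqrt_iter 1 (Suc n)"
proof -
  have b: "0 \<le> sqrt_iter (1::real) n \<and> sqrt_iter (1::real) n \<le> 1" for n
    by (induction n) (auto simp: mult_le_one add_nonneg_nonneg)
  then show "0 \<le> sqrt_iter (1::real) n" "sqrt_iter (1::real) n \<le> 1" by auto
  have "0 \<le> (1 - sqrt_iter (1::real) n)^2" by simp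
  then show "sqrt_iter (1::real) n \<le> sqrt_iter 1 (Suc n)" by (simp add: power2_eq_square algebra_simps)
qed

text \<open>The iterates are polynomials in \<open>x\<close> with nonnegative coefficients, and so are the differences of
  consecutive ones. Hence for \<open>\<parallel>x\<parallel> \<le> 1\<close> they are dominated by their values at \<open>x = 1\<close>, which increase and stay
  below \<open>1\<close>. This covers \<open>\<parallel>x\<parallel> = 1\<close>, where the iteration is no longer a contraction.\<close>

lemma norm_sqrt_iter_le:
  assumes "norm x \<le> 1"
  shows "norm (sqrt_iter x n) \<le> sqrt_iter 1 n"
    "norm (sqrt_iter x (Suc n) - sqrt_iter x n) \<le> sqrt_iter 1 (Suc n) - sqrt_iter 1 n"
proof -
  let ?t = "sqrt_iter x" and ?\<tau> = "sqrt_iter (1::real)"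
  show b: "norm (?t n) \<le> ?\<tau> n" for n
  proof (induction n)
    case (Suc n)
    have "norm (?t n * ?t n) \<le> ?\<tau> n * ?\<tau> n"
      by (rule order_trans[OF norm_mult_ineq]) (intro mult_mono Suc sqrt_iter_real norm_ge_zero)
    then have "norm (x + ?t n * ?t n) \<le> 1 + ?\<tau> n * ?\<tau> n"
      using assms norm_triangle_ineq[of x "?t n * ?t n"] by linarith
    then show ?case by simp
  qed simp
  show "norm (?t (Suc n) - ?t n) \<le> ?\<tau> (Suc n) - ?\<tau> n"
  proof (induction n)
    case 0 then show ?case using assms by simp
  next
    case (Suc n)
    define a b \<alpha> \<beta> where ab: "a = ?t (Suc n)" "b = ?t n" "\<alpha> = ?\<tau> (Suc n)" "\<beta> = ?\<tau> n"
    have IH: "norm (a - b) \<le> \<alpha> - \<beta>" and na: "norm a \<le> \<alpha>" and nb: "norm b \<le> \<beta>" and "0 \<le> \<alpha> - \<beta>"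
      using Suc b[of n] b[of "Suc n"] sqrt_iter_real(3)[of n] unfolding ab by auto
    have "a * a - b * b = a * (a - b) + (a - b) * b" by (simp add: algebra_simps)
    then have "norm (a * a - b * b) \<le> norm (a * (a - b)) + norm ((a - b) * b)"
      using norm_triangle_ineq by metis
    also have "\<dots> \<le> \<alpha> * (\<alpha> - \<beta>) + (\<alpha> - \<beta>) * \<beta>"
      by (intro add_mono order_trans[OF norm_mult_ineq] mult_mono na nb IH \<open>0 \<le> \<alpha> - \<beta>\<close>
          order_trans[OF norm_ge_zero na] norm_ge_zero)
    finally have *: "norm (a * a - b * b) \<le> \<alpha> * \<alpha> - \<beta> * \<beta>" by (simp add: algebra_simps)
    have "?t (Suc (Suc n)) - ?t (Suc n) = (1/2) *\<^sub>R (a * a - b * b)"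
      unfolding ab sqrt_iter.simps(2)[of x "Suc n"] by (subst (3) sqrt_iter.simps(2)) (simp add: algebra_simps)
    moreover have "?\<tau> (Suc (Suc n)) - ?\<tau> (Suc n) = (1/2) * (\<alpha> * \<alpha> - \<beta> * \<beta>)"
      unfolding ab sqrt_iter.simps(2)[of 1 "Suc n"] by (subst (3) sqrt_iter.simps(2)) (simp add: algebra_simps)
    ultimately show ?case using * by simp
  qed
qed

lemma sqrt_iter_tendsto:
  fixes x :: "'a::{real_normed_algebra, banach}"
  assumes "norm x \<le> 1"
  shows "sqrt_iter x \<longlonglongrightarrow> sqrt_defect x"
proof -
  let ?t = "sqrt_iter x" and ?\<tau> = "sqrt_iter (1::real)"
  have "incseq ?\<tau>" by (intro incseq_SucI sqrt_iter_real)
  then obtain l where "?\<tau> \<longlonglongrightarrow> l"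
    using incseq_convergent[of ?\<tau> 1] sqrt_iter_real by metis
  then have "summable (\<lambda>n. ?\<tau> (Suc n) - ?\<tau> n)" by (rule telescope_summable)
  then have "summable (\<lambda>n. ?t (Suc n) - ?t n)"
    by (rule summable_comparison_test') (rule norm_sqrt_iter_le(2)[OF assms])
  then have "(\<lambda>n. \<Sum>k<n. ?t (Suc k) - ?t k) \<longlonglongrightarrow> (\<Sum>n. ?t (Suc n) - ?t n)"
    by (rule summable_LIMSEQ)
  then have "convergent ?t" unfolding sum_lessThan_telescope by (auto simp: convergent_def)
  then show ?thesis by (simp add: sqrt_defect_def convergent_LIMSEQ_iff)
qed

lemma sqrt_defect_eq:
  fixes x :: "'a::{real_normed_algebra, banach}"
  assumes "norm x \<le> 1"
  shows "2 *\<^sub>R sqrt_defect x = x + sqrt_defect x * sqrt_defect x"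
proof -
  note t = sqrt_iter_tendsto[OF assms]
  have "(\<lambda>n. (1/2) *\<^sub>R (x + sqrt_iter x n * sqrt_iter x n)) \<longlonglongrightarrow>
      (1/2) *\<^sub>R (x + sqrt_defect x * sqrt_defect x)"
    by (intro tendsto_intros t)
  with LIMSEQ_Suc[OF t] have "sqrt_defect x = (1/2) *\<^sub>R (x + sqrt_defect x * sqrt_defect x)"
    by (auto intro: LIMSEQ_unique)
  then show ?thesis by (metis scaleR_half_double scaleR_2 scaleR_add_right)
qed

lemma norm_sqrt_defect_le_1:
  fixes x :: "'a::{real_normed_algebra, banach}"
  assumes "norm x \<le> 1"
  shows "norm (sqrt_defect x) \<le> 1"
  by (rule LIMSEQ_le_const2[OF tendsto_norm[OF sqrt_iter_tendsto[OF assms]]])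
     (use norm_sqrt_iter_le(1)[OF assms] sqrt_iter_real(2) order_trans in blast)

text \<open>The ball of radius \<open>\<sigma> = 1 - \<surd>(1 - \<parallel>x\<parallel>)\<close> is mapped into itself by the iteration.\<close>

lemma norm_sqrt_defect_less_1:
  fixes x :: "'a::{real_normed_algebra, banach}"
  assumes "norm x < 1"
  shows "norm (sqrt_defect x) < 1"
proof -
  define \<sigma> where "\<sigma> = 1 - sqrt (1 - norm x)"
  have \<sigma>: "norm x = 2 * \<sigma> - \<sigma> * \<sigma>" "\<sigma> < 1" "0 \<le> \<sigma>"
    using assms by (auto simp: \<sigma>_def algebra_simps real_le_rsqrt)
  have "norm (sqrt_iter x n) \<le> \<sigma>" for n
  proof (induction n)
    case (Suc n)
    have "norm (sqrt_iter x n * sqrt_iter x n) \<le> \<sigma> * \<sigma>"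
      by (rule order_trans[OF norm_mult_ineq]) (intro mult_mono Suc \<sigma> norm_ge_zero)
    then show ?case
      using \<sigma> norm_triangle_ineq[of x "sqrt_iter x n * sqrt_iter x n"] by simp
  qed (simp add: \<sigma>)
  then have "norm (sqrt_defect x) \<le> \<sigma>"
    using LIMSEQ_le_const2[OF tendsto_norm[OF sqrt_iter_tendsto]] assms by (metis less_imp_le)
  with \<sigma> show ?thesis by simp
qed

lemma sqrt_defect_commute:
  fixes x :: "'a::{real_normed_algebra, banach}"
  assumes "norm x \<le> 1" "y * x = x * y"
  shows "y * sqrt_defect x = sqrt_defect x * y"
proof -
  have "y * sqrt_iter x n = sqrt_iter x n * y" for n
  proof (induction n)
    case (Suc n)
    then have "y * (sqrt_iter x n * sqrt_iter x n) = sqrt_iter x n * sqrt_iter x n * y"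
      by (metis mult.assoc)
    then show ?case using assms(2) by (simp add: distrib_left distrib_right)
  qed simp
  with sqrt_iter_tendsto[OF assms(1)] show ?thesis
    by (metis (lifting) LIMSEQ_unique tendsto_mult_left tendsto_mult_right ext)
qed

lemma sqrt_defect_in_subalgebra:
  fixes x :: "'a::cstar_algebra"
  assumes "cstar_subalgebra M" "norm x \<le> 1" "x \<in> M"
  shows "sqrt_defect x \<in> M"
proof -
  have "sqrt_iter x n \<in> M" for n
    by (induction n) (auto intro!: cstar_subalgebraD[OF assms(1)] assms)
  then show ?thesis
    using sqrt_iter_tendsto[OF assms(2)] cstar_subalgebraD(1)[OF assms(1)]
    by (meson closed_sequentially)
qed

lemma sqrt_defect_selfadjoint:
  fixes x :: "'a::cstar_algebra"
  assumes "norm x \<le> 1" "star x = x"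
  shows "star (sqrt_defect x) = sqrt_defect x"
proof -
  have "star (sqrt_iter x n) = sqrt_iter x n" for n
    by (induction n) (auto simp: star_simps assms)
  with sqrt_iter_tendsto[OF assms(1)] bounded_linear.tendsto[OF bounded_linear_star sqrt_iter_tendsto[OF assms(1)]]
  show ?thesis by (auto intro: LIMSEQ_unique)
qed

lemma selfadjoint_sqrt_closed:
  fixes x :: "'a::{cstar_algebra, real_normed_algebra_1}"
  assumes "norm x \<le> 1" "star x = x"
  shows "\<exists>s. s * s = 1 - x \<and> star s = s \<and> norm (1 - s) \<le> 1 \<and> (\<forall>y. y * x = x * y \<longrightarrow> y * s = s * y)"
proof (intro exI[of _ "1 - sqrt_defect x"] conjI allI impI)
  show "(1 - sqrt_defect x) * (1 - sqrt_defect x) = 1 - x"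
    using sqrt_defect_eq[OF assms(1)] by (simp add: algebra_simps scaleR_2)
  show "y * (1 - sqrt_defect x) = (1 - sqrt_defect x) * y" if "y * x = x * y" for y
    using sqrt_defect_commute[OF assms(1) that] by (simp add: algebra_simps)
qed (use sqrt_defect_selfadjoint[OF assms] norm_sqrt_defect_le_1[OF assms(1)] in
      \<open>auto simp: star_diff star_one\<close>)

text \<open>The witness is \<open>r = k\<^sup>-\<^sup>1\<^sup>/\<^sup>2\<close>: with \<open>s = q - t\<close> the root of \<open>k\<close> obtained from the iteration, \<open>\<parallel>t\<parallel> < 1\<close>
  makes \<open>s\<close> invertible relative to \<open>q\<close>.\<close>

lemma near_unit_normalizable:
  fixes M :: "'a::cstar_algebra set"
  assumes M: "cstar_subalgebra M" and q: "q \<in> M" "star q = q"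
    and unit: "\<And>x. x \<in> M \<Longrightarrow> q * x = x \<and> x * q = x"
    and k: "k \<in> M" "star k = k" "norm (q - k) < 1"
  shows "\<exists>r\<in>M. star r * k * r = q"
proof -
  note D = cstar_subalgebraD[OF M]
  define t where "t = sqrt_defect (q - k)"
  have e: "norm (q - k) \<le> 1" using k by simp
  have tM: "t \<in> M" unfolding t_def by (rule sqrt_defect_in_subalgebra[OF M e]) (intro D q k)
  have ts: "star t = t" unfolding t_def by (rule sqrt_defect_selfadjoint[OF e]) (simp add: star_simps q k)
  have tn: "norm t < 1" unfolding t_def by (rule norm_sqrt_defect_less_1[OF k(3)])
  have k_eq: "k = (q - t) * (q - t)"
    using sqrt_defect_eq[OF e] unit[OF q(1)] unit[OF tM]
    by (simp add: t_def[symmetric] algebra_simps scaleR_2)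
  \<comment> \<open>The fixed point is the Neumann series \<open>t + t\<^sup>2 + \<dots>\<close>, which stays in the closed set \<open>M\<close>.\<close>
  have "\<exists>!u\<in>M. t + t * u = u"
  proof (rule Banach_fix[of M "norm t"])
    show "complete M" using D(1) by (simp add: complete_eq_closed)
    show "(\<lambda>u. t + t * u) ` M \<subseteq> M" by (auto intro!: D tM)
    show "dist (t + t * x) (t + t * y) \<le> norm t * dist x y" for x y
      using norm_mult_ineq[of t "x - y"] by (simp add: dist_norm algebra_simps)
  qed (use D tn in auto)
  then obtain u where u: "u \<in> M" "t + t * u = u" by blast
  have s: "(q - t) * (q + u) = q"
    using unit[OF q(1)] unit[OF tM] unit[OF u(1)] u(2) by (simp add: algebra_simps)
  have "star (q + u) * k * (q + u) = star ((q - t) * (q + u)) * ((q - t) * (q + u))"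
    unfolding k_eq by (simp add: star_simps ts q mult.assoc)
  also have "\<dots> = q" unfolding s using unit[OF q(1)] q by simp
  finally show ?thesis using D(3)[OF q(1) u(1)] by blast
qed

section \<open>Injective *-homomorphisms are isometric\<close>

text \<open>Up to a factor \<open>\<surd>c\<close> the element \<open>x + \<i> s\<close> is unitary and \<open>x\<close> is its real part. The lemma converts
  the existence of square roots into norm bounds.\<close>

lemma commuting_squares_norm:
  fixes x s :: "'a::{cstar_algebra, real_normed_algebra_1}"
  assumes "star x = x" "star s = s" "x * s = s * x" "x * x + s * s = c *\<^sub>R 1" "0 \<le> c"
  shows "(norm x)\<^sup>2 \<le> c"
proof -
  define u where "u = x + \<i> *\<^sub>C s"
  have su: "star u = x - \<i> *\<^sub>C s"
    using scaleC_minus1[of "\<i> *\<^sub>C s"]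
    by (simp add: u_def star_add star_scaleC assms scaleC_scaleC)
  have "star u * u = x * x + s * s"
    using scaleC_minus1[of "s * s"] unfolding su unfolding u_def
    by (simp add: algebra_simps mult_scaleC_left mult_scaleC_right scaleC_scaleC
        scaleC_diff_right assms)
  then have nu: "(norm u)\<^sup>2 = c"
    using cstar_identity[of u] assms by simp
  have "2 *\<^sub>R x = u + star u" unfolding su unfolding u_def by (simp add: scaleR_2)
  then have "norm (2 *\<^sub>R x) \<le> norm u + norm u"
    using norm_triangle_ineq[of u "star u"] by (simp add: norm_star)
  then have "norm x \<le> norm u" by simp
  then show ?thesis unfolding nu[symmetric] by (intro power_mono) auto
qed

lemma norm_one_minus_square_le_1:
  fixes y :: "'a::{cstar_algebra, real_normed_algebra_1}"
  assumes "star y = y" "norm y \<le> 1"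
  shows "norm (1 - y * y) \<le> 1"
proof -
  have "norm (y * y) \<le> 1"
    using norm_mult_ineq[of y y] mult_le_one[of "norm y" "norm y"] assms(2) by simp
  then obtain s where s: "s * s = 1 - y * y" "star s = s" "y * s = s * y"
    using selfadjoint_sqrt_closed[of "y * y"] assms(1) by (auto simp: star_mult mult.assoc)
  have "(norm s)\<^sup>2 \<le> 1" by (rule commuting_squares_norm[of s y]) (use s assms in auto)
  then show ?thesis using norm_mult_ineq[of s s] s(1) by (simp add: power2_eq_square)
qed

text \<open>Suppose \<open>x\<close> is selfadjoint of norm \<open>1\<close> and \<open>\<parallel>\<phi> x\<parallel>\<^sup>2 < \<mu> < 1\<close>. For \<open>y = x\<^sup>2 - \<mu>\<close> the image \<open>\<phi> y\<close> is
  strictly negative, so the uniqueness of positive roots gives \<open>\<phi> \<bar>y\<bar> = \<phi> (- y)\<close>. By injectivity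
  \<open>\<mu> - x\<^sup>2 = \<bar>y\<bar>\<close> already holds in the domain; it has a square root, and so \<open>\<parallel>x\<parallel>\<^sup>2 \<le> \<mu>\<close>, which is absurd.\<close>

lemma star_hom_isometric:
  fixes \<phi> :: "'a::{cstar_algebra, real_normed_algebra_1} \<Rightarrow> 'b::cstar_algebra"
  assumes \<phi>: "star_hom \<phi>" and inj: "inj \<phi>"
  shows "norm (\<phi> x) = norm x"
proof -
  note H = star_homD[OF \<phi>] and contr = star_hom_contractive[OF \<phi>]
  have unit: "1 \<le> norm (\<phi> x)" if x: "star x = x" "norm x = 1" for x
  proof (rule ccontr)
    assume "\<not> 1 \<le> norm (\<phi> x)"
    then have "(norm (\<phi> x))\<^sup>2 < 1" by (simp add: power_less_one_iff)
    then obtain \<mu> where \<mu>: "(norm (\<phi> x))\<^sup>2 < \<mu>" "\<mu> < 1" using dense by blast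
    then have "0 < \<mu>" using zero_le_power2[of "norm (\<phi> x)"] by linarith
    define y where "y = x * x - \<mu> *\<^sub>R 1"
    have ys: "star y = y" by (simp add: y_def star_simps star_one x)
    have "norm (x * x) = 1" using cstar_identity[of x] x by simp
    moreover have "norm (1 - x * x) \<le> 1" by (rule norm_one_minus_square_le_1) (use x in auto)
    moreover have "y = (1 - \<mu>) *\<^sub>R (x * x) - \<mu> *\<^sub>R (1 - x * x)"
      by (simp add: y_def algebra_simps)
    ultimately have "norm y \<le> (1 - \<mu>) * 1 + \<mu> * norm (1 - x * x)"
      using \<mu> \<open>0 < \<mu>\<close> norm_triangle_ineq4[of "(1 - \<mu>) *\<^sub>R (x * x)" "\<mu> *\<^sub>R (1 - x * x)"]
      by simp
    also have "\<dots> \<le> (1 - \<mu>) * 1 + \<mu> * 1"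
      using mult_left_mono[OF \<open>norm (1 - x * x) \<le> 1\<close>, of \<mu>] \<open>0 < \<mu>\<close> by simp
    finally have "norm y \<le> 1" by simp
    then have n1: "norm (1 - y * y) \<le> 1" using norm_one_minus_square_le_1[OF ys] by simp
    \<comment> \<open>Both \<open>t = 1 - \<bar>y\<bar>\<close> and \<open>z = 1 - (- y)\<close> solve \<open>2 u = 1 - y\<^sup>2 + u\<^sup>2\<close>; the difference of
      the two equations forces \<open>\<phi> (t - z) = 0\<close> as soon as \<open>\<phi> (t + z)\<close> has norm below \<open>2\<close>.\<close>
    define t z where "t = sqrt_defect (1 - y * y)" and "z = 1 + y"
    have t: "2 *\<^sub>R t = 1 - y * y + t * t" "norm t \<le> 1" "y * t = t * y"
      using sqrt_defect_eq[OF n1] norm_sqrt_defect_le_1[OF n1] sqrt_defect_commute[OF n1, of y]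
      by (simp_all add: t_def algebra_simps)
    have z: "2 *\<^sub>R z = 1 - y * y + z * z" "z * t = t * z"
      using t(3) by (simp_all add: z_def algebra_simps scaleR_2)
    have "2 *\<^sub>R (t - z) = t * t - z * z"
      unfolding scaleR_diff_right t(1) z(1) by simp
    also have "\<dots> = (t - z) * (t + z)" using z(2) by (simp add: algebra_simps)
    finally have "2 *\<^sub>R \<phi> (t - z) = \<phi> (t - z) * \<phi> (t + z)" by (simp flip: H)
    then have "2 * norm (\<phi> (t - z)) \<le> norm (\<phi> (t - z)) * norm (\<phi> (t + z))"
      using norm_mult_ineq[of "\<phi> (t - z)" "\<phi> (t + z)"] norm_scaleR[of 2 "\<phi> (t - z)"] by simp
    moreover have "norm (\<phi> (t + z)) < 2"
    proof -
      have "z = x * x + (1 - \<mu>) *\<^sub>R 1" by (simp add: z_def y_def algebra_simps)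
      then have "norm (\<phi> z) \<le> norm (\<phi> x * \<phi> x) + norm ((1 - \<mu>) *\<^sub>R \<phi> 1)"
        using norm_triangle_ineq[of "\<phi> x * \<phi> x" "(1 - \<mu>) *\<^sub>R \<phi> 1"] by (simp add: H)
      also have "\<dots> \<le> (norm (\<phi> x))\<^sup>2 + (1 - \<mu>) * 1"
        using norm_mult_ineq[of "\<phi> x" "\<phi> x"] contr[of 1] \<mu>
        by (intro add_mono) (auto simp: power2_eq_square)
      also have "\<dots> < 1" using \<mu> by simp
      finally show ?thesis
        using t(2) contr[of t] norm_triangle_ineq[of "\<phi> t" "\<phi> z"] by (simp add: H)
    qed
    ultimately have "norm (\<phi> (t - z)) = 0"
      using mult_strict_left_mono[of "norm (\<phi> (t + z))" 2 "norm (\<phi> (t - z))"]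
      by (cases "norm (\<phi> (t - z)) = 0") auto
    then have "\<phi> (t - z) = \<phi> 0" by (simp add: H)
    then have "t = 1 + y" using inj by (auto simp: inj_eq z_def)
    then have "norm (1 + y) \<le> 1" using t(2) by simp
    moreover have "star (1 + y) = 1 + y" by (simp add: star_add star_one ys)
    ultimately obtain s where s: "s * s = 1 - (1 + y)" "star s = s"
        and comm: "\<forall>w. w * (1 + y) = (1 + y) * w \<longrightarrow> w * s = s * w"
      using selfadjoint_sqrt_closed by metis
    have xs: "x * s = s * x" by (rule comm[rule_format]) (simp add: y_def algebra_simps)
    have "(norm x)\<^sup>2 \<le> \<mu>"
      by (rule commuting_squares_norm[of x s])
         (use s x xs \<open>0 < \<mu>\<close> in \<open>auto simp: y_def\<close>)
    then show False using x \<mu> by simp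
  qed
  have selfadj: "norm x \<le> norm (\<phi> x)" if x: "star x = x" for x
  proof (cases "x = 0")
    case False
    have "1 \<le> norm (\<phi> (inverse (norm x) *\<^sub>R x))"
      by (rule unit) (use False in \<open>auto simp: star_simps x\<close>)
    then show ?thesis using False by (simp add: H field_simps)
  qed simp
  have "(norm x)\<^sup>2 = norm (star x * x)" by (rule cstar_identity[symmetric])
  also have "\<dots> \<le> norm (\<phi> (star x * x))" by (rule selfadj) (simp add: star_simps)
  also have "\<dots> = (norm (\<phi> x))\<^sup>2" by (simp add: H cstar_identity)
  finally have "norm x \<le> norm (\<phi> x)" by (simp add: power_mono_iff)
  then show ?thesis using contr[of x] by simp
qed

text \<open>The element \<open>s * s\<close> plays the role of the absolute value of \<open>y\<close>; taking the further root \<open>s\<close> records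
  that it is positive.\<close>

lemma fourth_root_of_square:
  fixes y :: "'a::{cstar_algebra, real_normed_algebra_1}"
  assumes "star y = y"
  shows "\<exists>s. star s = s \<and> s * y = y * s \<and> (s * s) * (s * s) = y * y"
proof (cases "y = 0")
  case True
  then show ?thesis by (intro exI[of _ 0]) simp
next
  case False
  define z where "z = inverse (norm y) *\<^sub>R y"
  have z: "star z = z" "norm z \<le> 1" using False by (auto simp: z_def star_simps assms)
  have "star (1 - z * z) = 1 - z * z" by (simp add: star_simps star_one z)
  then obtain a where a': "a * a = 1 - (1 - z * z)" "star a = a" "norm (1 - a) \<le> 1"
      and comm: "\<forall>w. w * (1 - z * z) = (1 - z * z) * w \<longrightarrow> w * a = a * w"
    using selfadjoint_sqrt_closed norm_one_minus_square_le_1[OF z] by metis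
  have "z * a = a * z" by (rule comm[rule_format]) (simp add: algebra_simps)
  with a' have a: "a * a = z * z" "star a = a" "norm (1 - a) \<le> 1" "z * a = a * z" by simp_all
  have "star (1 - a) = 1 - a" by (simp add: star_simps star_one a)
  then obtain s where s': "s * s = 1 - (1 - a)" "star s = s"
      and comm': "\<forall>w. w * (1 - a) = (1 - a) * w \<longrightarrow> w * s = s * w"
    using selfadjoint_sqrt_closed a(3) by metis
  have "z * s = s * z" by (rule comm'[rule_format]) (simp add: algebra_simps a(4))
  with s' have s: "s * s = a" "star s = s" "z * s = s * z" by simp_all
  have y: "y = norm y *\<^sub>R z" using False by (simp add: z_def)
  show ?thesis
  proof (intro exI[of _ "sqrt (norm y) *\<^sub>R s"] conjI)
    show "star (sqrt (norm y) *\<^sub>R s) = sqrt (norm y) *\<^sub>R s" by (simp add: star_simps s)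
    have "s * (norm y *\<^sub>R z) = (norm y *\<^sub>R z) * s" using s(3) by simp
    then show "sqrt (norm y) *\<^sub>R s * y = y * sqrt (norm y) *\<^sub>R s" by (simp flip: y)
    have "(sqrt (norm y) *\<^sub>R s) * (sqrt (norm y) *\<^sub>R s) = norm y *\<^sub>R a" by (simp add: s)
    moreover have "(norm y *\<^sub>R a) * (norm y *\<^sub>R a) = (norm y *\<^sub>R z) * (norm y *\<^sub>R z)" by (simp add: a)
    ultimately show "((sqrt (norm y) *\<^sub>R s) * (sqrt (norm y) *\<^sub>R s)) *
        ((sqrt (norm y) *\<^sub>R s) * (sqrt (norm y) *\<^sub>R s)) = y * y"
      by (simp only: flip: y)
  qed
qed

section \<open>Order by quadratic forms\<close>

text \<open>By polarization the form bounds the real part of \<open>\<langle>w, T u\<rangle>\<close> by \<open>c (\<parallel>u\<parallel>\<^sup>2 + \<parallel>w\<parallel>\<^sup>2) / 2\<close>. The vector \<open>w\<close> is taken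
  in the direction of \<open>T u\<close> and of the same length as \<open>u\<close>, where the bound is sharp.\<close>

lemma norm_bop_le_numeric_radius:
  fixes T :: "'h::chilbert_space bop"
  assumes T: "star T = T" and c: "0 \<le> c"
    and form: "\<And>v. \<bar>Re (cinner v (bop_apply T v))\<bar> \<le> c * (norm v)\<^sup>2"
  shows "norm T \<le> c"
proof (rule norm_bop_bound[OF c])
  fix u
  note lin = linear_simps[OF bounded_linear_bop_apply[of T]]
  have polar: "2 * Re (cinner w (bop_apply T u)) \<le> c * ((norm u)\<^sup>2 + (norm w)\<^sup>2)" for w
  proof -
    have sym: "Re (cinner u (bop_apply T w)) = Re (cinner w (bop_apply T u))"
      using cinner_star_left[of T u w] T cinner_commute[of w "bop_apply T u"] by simp
    have "4 * Re (cinner w (bop_apply T u)) =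
        Re (cinner (u + w) (bop_apply T (u + w))) - Re (cinner (u - w) (bop_apply T (u - w)))"
      by (simp add: lin cinner_add_left cinner_add_right cinner_diff_left cinner_diff_right sym)
    also have "\<dots> \<le> c * (norm (u + w))\<^sup>2 + c * (norm (u - w))\<^sup>2"
      using form[of "u + w"] form[of "u - w"] by linarith
    also have "\<dots> = c * ((norm (u + w))\<^sup>2 + (norm (u - w))\<^sup>2)" by (simp add: distrib_left)
    also have "(norm (u + w))\<^sup>2 + (norm (u - w))\<^sup>2 = 2 * ((norm u)\<^sup>2 + (norm w)\<^sup>2)"
      using norm_add_sq[of u w] norm_add_sq[of u "- w"] by (simp add: cinner_minus_right)
    finally show ?thesis by (simp add: algebra_simps)
  qed
  show "norm (bop_apply T u) \<le> c * norm u"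
  proof (cases "bop_apply T u = 0")
    case False
    define w where "w = (norm u / norm (bop_apply T u)) *\<^sub>R bop_apply T u"
    have "norm w = norm u" using False by (simp add: w_def)
    moreover have "Re (cinner w (bop_apply T u)) = norm u * norm (bop_apply T u)"
      using False by (simp add: w_def cinner_scaleR_left cinner_self power2_eq_square)
    ultimately have "norm u * norm (bop_apply T u) \<le> norm u * (c * norm u)"
      using polar[of w] by (simp add: power2_eq_square algebra_simps)
    moreover have "norm u > 0" using False lin(3) by auto
    ultimately show ?thesis by simp
  qed (use c in simp)
qed

text \<open>Inequalities between these forms replace the order of the C*-algebra. The lower and upper
  bounds are stated in terms of \<open>\<parallel>\<pi> 1 v\<parallel>\<^sup>2\<close>, the form of the unit, as \<open>\<pi>\<close> may be degenerate.\<close>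

definition quad_form ::
    "('a::cstar_algebra \<Rightarrow> 'h::chilbert_space bop) \<Rightarrow> 'a \<Rightarrow> 'h \<Rightarrow> real" where
  "quad_form \<pi> x v = Re (cinner v (bop_apply (\<pi> x) v))"

context
  fixes \<pi> :: "'a::{cstar_algebra, real_normed_algebra_1} \<Rightarrow> 'h::chilbert_space bop"
  assumes \<pi>: "faithful_representation \<pi>"
begin

lemma rep_hom: "star_hom \<pi>" and rep_inj: "inj \<pi>"
  using \<pi> by (auto simp: faithful_representation_def)

lemma rep_isometric: "norm (\<pi> x) = norm x"
  by (rule star_hom_isometric[OF rep_hom rep_inj])

lemma quad_form_linear:
  "quad_form \<pi> (x + y) v = quad_form \<pi> x v + quad_form \<pi> y v"
  "quad_form \<pi> (x - y) v = quad_form \<pi> x v - quad_form \<pi> y v"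
  "quad_form \<pi> (- x) v = - quad_form \<pi> x v"
  "quad_form \<pi> (r *\<^sub>R x) v = r * quad_form \<pi> x v"
  by (simp_all add: quad_form_def star_homD[OF rep_hom] bop_apply_simps cinner_add_right
      cinner_diff_right cinner_minus_right cinner_scaleR_right)

lemma quad_form_square: "quad_form \<pi> (star x * y) v = Re (cinner (bop_apply (\<pi> x) v) (bop_apply (\<pi> y) v))"
  using cinner_star_right[of v "\<pi> x"]
  by (simp add: quad_form_def star_homD[OF rep_hom] bop_apply_simps)

lemma quad_form_star_self: "quad_form \<pi> (star x * x) v = (norm (bop_apply (\<pi> x) v))\<^sup>2"
  by (simp add: quad_form_square cinner_self)

lemma quad_form_sandwich: "quad_form \<pi> (star y * x * y) v = quad_form \<pi> x (bop_apply (\<pi> y) v)"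
  using cinner_star_right[of v "\<pi> y"]
  by (simp add: quad_form_def star_homD[OF rep_hom] bop_apply_simps)

lemma quad_form_one: "quad_form \<pi> 1 v = (norm (bop_apply (\<pi> 1) v))\<^sup>2"
  using quad_form_star_self[of 1 v] by (simp add: star_one)

lemma abs_quad_form_le: "\<bar>quad_form \<pi> x v\<bar> \<le> norm x * (norm (bop_apply (\<pi> 1) v))\<^sup>2"
proof -
  let ?w = "bop_apply (\<pi> 1) v"
  have "\<bar>quad_form \<pi> x v\<bar> = \<bar>Re (cinner ?w (bop_apply (\<pi> x) ?w))\<bar>"
    using quad_form_sandwich[of 1 x v] by (simp add: star_one quad_form_def)
  also have "\<dots> \<le> norm ?w * norm (bop_apply (\<pi> x) ?w)"
    by (rule order_trans[OF abs_Re_le_cmod cmod_cinner_le])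
  also have "\<dots> \<le> norm ?w * (norm x * norm ?w)"
    using norm_bop_apply[of "\<pi> x" ?w] by (intro mult_left_mono) (auto simp: rep_isometric)
  finally show ?thesis by (simp add: power2_eq_square mult_ac)
qed

lemma norm_le_if_quad_form_le:
  assumes x: "star x = x" and c: "0 \<le> c"
    and le: "\<And>v. \<bar>quad_form \<pi> x v\<bar> \<le> c * (norm (bop_apply (\<pi> 1) v))\<^sup>2"
  shows "norm x \<le> c"
proof -
  have "norm (\<pi> x) \<le> c"
  proof (rule norm_bop_le_numeric_radius[OF _ c])
    show "star (\<pi> x) = \<pi> x" by (simp flip: star_homD[OF rep_hom] add: x)
    fix v
    have "norm (bop_apply (\<pi> 1) v) \<le> norm v"
      using norm_bop_apply[of "\<pi> 1" v] by (simp add: rep_isometric)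
    then have "c * (norm (bop_apply (\<pi> 1) v))\<^sup>2 \<le> c * (norm v)\<^sup>2"
      by (intro mult_left_mono power_mono c) auto
    then show "\<bar>Re (cinner v (bop_apply (\<pi> x) v))\<bar> \<le> c * (norm v)\<^sup>2"
      using le[of v] by (simp add: quad_form_def)
  qed
  then show ?thesis by (simp add: rep_isometric)
qed

text \<open>After scaling to norm \<open>1\<close> the form of \<open>1 - x\<close> lies between \<open>0\<close> and that of the unit, so
  \<open>\<parallel>1 - x\<parallel> \<le> 1\<close> and \<open>x = 1 - (1 - x)\<close> is within reach of the iteration.\<close>

lemma positive_form_has_sqrt:
  assumes x: "star x = x" and pos: "\<And>v. 0 \<le> quad_form \<pi> x v"
  shows "\<exists>s. star s = s \<and> s * s = x"
proof (cases "x = 0")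
  case False
  define z where "z = inverse (norm x) *\<^sub>R x"
  have zs: "star z = z" and nz: "norm z = 1" using False by (auto simp: z_def star_simps x)
  have "norm (1 - z) \<le> 1"
  proof (rule norm_le_if_quad_form_le)
    fix v
    have "0 \<le> quad_form \<pi> z v" using pos by (simp add: z_def quad_form_linear)
    then show "\<bar>quad_form \<pi> (1 - z) v\<bar> \<le> 1 * (norm (bop_apply (\<pi> 1) v))\<^sup>2"
      using abs_quad_form_le[of z v] by (simp add: quad_form_linear quad_form_one nz)
  qed (simp_all add: star_simps star_one zs)
  then obtain s where "s * s = z" "star s = s"
    using selfadjoint_sqrt_closed[of "1 - z"] by (auto simp: star_simps star_one zs)
  then show ?thesis using False
    by (intro exI[of _ "sqrt (norm x) *\<^sub>R s"]) (simp add: star_simps z_def flip: mult.assoc)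
qed (intro exI[of _ 0], simp)

text \<open>A large multiple \<open>K\<close> of the unit dominates \<open>k\<close>, and then the form of \<open>1 - k / K\<close> lies between \<open>0\<close> and
  \<open>1 - e / K\<close>. So \<open>k / K\<close> is near the unit.\<close>

lemma bounded_below_normalizable:
  assumes k: "star k = k" and e: "0 < e"
    and ge: "\<And>v. e * (norm (bop_apply (\<pi> 1) v))\<^sup>2 \<le> quad_form \<pi> k v"
  shows "\<exists>r. star r * k * r = 1"
proof -
  define K where "K = norm k + e"
  have K: "0 < K" using e by (simp add: K_def add_nonneg_pos)
  have "norm (1 - inverse K *\<^sub>R k) \<le> 1 - e / K"
  proof (rule norm_le_if_quad_form_le)
    fix v
    let ?n = "(norm (bop_apply (\<pi> 1) v))\<^sup>2"
    have "quad_form \<pi> k v \<le> K * ?n"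
      using abs_quad_form_le[of k v] e by (simp add: K_def distrib_right add_increasing2)
    then have "inverse K * quad_form \<pi> k v \<le> ?n" using K by (simp add: field_simps)
    moreover have "e / K * ?n \<le> inverse K * quad_form \<pi> k v"
      using ge[of v] K by (simp add: field_simps)
    ultimately show "\<bar>quad_form \<pi> (1 - inverse K *\<^sub>R k) v\<bar> \<le> (1 - e / K) * ?n"
      by (simp add: quad_form_linear quad_form_one algebra_simps)
  qed (use K in \<open>auto simp: star_simps star_one k K_def\<close>)
  also have "\<dots> < 1" using e K by simp
  finally obtain r where r: "star r * (inverse K *\<^sub>R k) * r = 1"
    using near_unit_normalizable[OF cstar_subalgebra_UNIV, of "1::'a" "inverse K *\<^sub>R k"]
    by (auto simp: star_simps star_one k)
  have "star (sqrt (inverse K) *\<^sub>R r) * k * (sqrt (inverse K) *\<^sub>R r) = 1"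
    using r K by (simp add: star_simps)
  then show ?thesis by blast
qed

text \<open>From \<open>\<parallel>\<pi> 1 v\<parallel> \<le> \<parallel>l\<parallel> \<parallel>\<pi> y v\<parallel>\<close> the element \<open>y\<^sup>* y\<close> is bounded below. The isometry is the polar part
  \<open>y (y\<^sup>* y)\<^sup>-\<^sup>1\<^sup>/\<^sup>2\<close>.\<close>

lemma left_invertible_to_isometry:
  fixes l y :: 'a
  assumes "l * y = 1"
  shows "\<exists>r. star (y * r) * (y * r) = 1"
proof -
  have l: "norm l > 0" using assms by auto
  have "\<exists>r. star r * (star y * y) * r = 1"
  proof (rule bounded_below_normalizable[where e = "1 / (norm l)\<^sup>2"])
    fix v
    have "norm (bop_apply (\<pi> 1) v) \<le> norm l * norm (bop_apply (\<pi> y) v)"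
      using norm_bop_apply[of "\<pi> l" "bop_apply (\<pi> y) v"]
      by (simp flip: assms add: star_homD[OF rep_hom] bop_apply_simps rep_isometric)
    then have "(norm (bop_apply (\<pi> 1) v))\<^sup>2 \<le> (norm l * norm (bop_apply (\<pi> y) v))\<^sup>2"
      by (intro power_mono) auto
    then show "1 / (norm l)\<^sup>2 * (norm (bop_apply (\<pi> 1) v))\<^sup>2 \<le> quad_form \<pi> (star y * y) v"
      using l by (simp add: quad_form_star_self field_simps power_mult_distrib)
  qed (use l in \<open>auto simp: star_simps\<close>)
  then show ?thesis by (simp add: star_mult mult.assoc)
qed

end

section \<open>Isometries in purely infinite simple algebras\<close>

definition ideal_sums :: "'a::ring \<Rightarrow> 'a set" where
  "ideal_sums e = {\<Sum>i<n. a i * e * b i | (n::nat) a b. True}"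

lemma ideal_sums_add:
  assumes "x \<in> ideal_sums e" "y \<in> ideal_sums e"
  shows "x + y \<in> ideal_sums e"
proof -
  obtain n a b where x: "x = (\<Sum>i<(n::nat). a i * e * b i)" using assms by (auto simp: ideal_sums_def)
  obtain m c d where y: "y = (\<Sum>i<(m::nat). c i * e * d i)" using assms by (auto simp: ideal_sums_def)
  let ?f = "\<lambda>i. (if i < n then a i else c (i - n)) * e * (if i < n then b i else d (i - n))"
  have "(\<Sum>i<n+m. ?f i) = (\<Sum>i<n. ?f i) + (\<Sum>i=n..<n+m. ?f i)"
    using sum.atLeastLessThan_concat[of 0 n "n + m" ?f] by (simp add: atLeast0LessThan)
  also have "(\<Sum>i=n..<n+m. ?f i) = (\<Sum>i<m. ?f (i + n))"
    using sum.shift_bounds_nat_ivl[of ?f 0 n m] by (simp add: atLeast0LessThan add.commute)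
  finally have "x + y = (\<Sum>i<n+m. ?f i)" by (simp add: x y)
  then show ?thesis unfolding ideal_sums_def mem_Collect_eq by (intro exI conjI TrueI)
qed

lemma ideal_sums_mult:
  assumes "x \<in> ideal_sums e"
  shows "c * x \<in> ideal_sums e" "x * c \<in> ideal_sums e"
proof -
  obtain n a b where x: "x = (\<Sum>i<(n::nat). a i * e * b i)" using assms by (auto simp: ideal_sums_def)
  have "c * x = (\<Sum>i<n. (c * a i) * e * b i)"
    by (simp add: x sum_distrib_left mult.assoc)
  then show "c * x \<in> ideal_sums e"
    unfolding ideal_sums_def mem_Collect_eq by (intro exI conjI TrueI)
  have "x * c = (\<Sum>i<n. a i * e * (b i * c))"
    by (simp add: x sum_distrib_right mult.assoc)
  then show "x * c \<in> ideal_sums e"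
    unfolding ideal_sums_def mem_Collect_eq by (intro exI conjI TrueI)
qed

text \<open>By simplicity the closure of the algebraic ideal generated by \<open>e\<close> is everything, so the ideal
  contains an element \<open>j\<close> at distance less than \<open>1\<close> from the unit. Such a \<open>j\<close> is invertible.\<close>

lemma simple_unit_in_ideal_sums:
  fixes e :: "'a::{cstar_algebra, real_normed_algebra_1}"
  assumes simple: "simple_cstar (UNIV :: 'a set)" and e: "e \<noteq> 0"
  shows "1 \<in> ideal_sums e"
proof -
  have e_in: "e \<in> ideal_sums e"
    unfolding ideal_sums_def by (auto intro!: exI[of _ "1::nat"] exI[of _ "\<lambda>_. 1"])
  have zero: "0 \<in> ideal_sums e" using ideal_sums_mult(1)[OF e_in, of 0] by simp
  let ?I = "closure (ideal_sums e)"
  have "closed_ideal ?I UNIV"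
    unfolding closed_ideal_def
  proof (intro conjI ballI allI)
    show "0 \<in> ?I" using zero closure_subset by blast
    show "x + y \<in> ?I" if xy: "x \<in> ?I" "y \<in> ?I" for x y
    proof -
      obtain f where f: "\<And>n. f n \<in> ideal_sums e" "f \<longlonglongrightarrow> x"
        using xy(1) unfolding closure_sequential by blast
      obtain g where g: "\<And>n. g n \<in> ideal_sums e" "g \<longlonglongrightarrow> y"
        using xy(2) unfolding closure_sequential by blast
      have "(\<lambda>n. f n + g n) \<longlonglongrightarrow> x + y" by (intro tendsto_intros f g)
      then show ?thesis unfolding closure_sequential
        using ideal_sums_add[OF f(1) g(1)] by (intro exI[of _ "\<lambda>n. f n + g n"]) auto
    qed
    have m: "c * x \<in> ?I" "x * c \<in> ?I" if x: "x \<in> ?I" for x c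
    proof -
      obtain f where f: "\<And>n. f n \<in> ideal_sums e" "f \<longlonglongrightarrow> x"
        using x unfolding closure_sequential by blast
      have lim: "(\<lambda>n. c * f n) \<longlonglongrightarrow> c * x" "(\<lambda>n. f n * c) \<longlonglongrightarrow> x * c"
        by (intro tendsto_intros f)+
      have S: "\<forall>n. c * f n \<in> ideal_sums e" "\<forall>n. f n * c \<in> ideal_sums e"
        by (simp_all add: ideal_sums_mult f(1))
      show "c * x \<in> ?I" unfolding closure_sequential
        by (intro exI[of _ "\<lambda>n. c * f n"] conjI S(1) lim(1))
      show "x * c \<in> ?I" unfolding closure_sequential
        by (intro exI[of _ "\<lambda>n. f n * c"] conjI S(2) lim(2))
    qed
    then show "c * x \<in> ?I" "x * c \<in> ?I" if "x \<in> ?I" for x c using that by auto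
    show "c *\<^sub>C x \<in> ?I" if "x \<in> ?I" for x c
      using m(1)[OF that, of "c *\<^sub>C 1"] by (simp add: mult_scaleC_left)
  qed auto
  moreover have "?I \<noteq> {0}" using e e_in closure_subset by blast
  ultimately have "?I = UNIV" using simple by (auto simp: simple_cstar_def)
  then obtain j where j: "j \<in> ideal_sums e" "norm (1 - j) < 1"
    using closure_approachable[of 1 "ideal_sums e"] zero_less_one
    by (metis UNIV_I dist_norm norm_minus_commute)
  \<comment> \<open>The fixed point \<open>u\<close> is the Neumann series of the inverse of \<open>j\<close>.\<close>
  have "\<exists>!u\<in>UNIV. 1 + u * (1 - j) = u"
  proof (rule Banach_fix[of UNIV "norm (1 - j)"])
    show "dist (1 + x * (1 - j)) (1 + y * (1 - j)) \<le> norm (1 - j) * dist x y" for x y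
      using norm_mult_ineq[of "x - y" "1 - j"] by (simp add: dist_norm algebra_simps)
  qed (use j in \<open>auto simp: complete_UNIV\<close>)
  then obtain u where "1 + u * (1 - j) = u" by blast
  then have "u * j = 1" by (simp add: algebra_simps)
  then show ?thesis using ideal_sums_mult(1)[OF j(1), of u] by simp
qed

text \<open>The translates of a wandering element under the powers of a partial isometry are orthogonal.
  The two cancellation hypotheses make \<open>star v * v\<close> act as the identity on all products that occur,
  so that an isometry of \<open>D\<close> and one of a corner of \<open>D\<close> are both covered.\<close>

lemma isometry_shift_orthogonal:
  fixes v e f :: "'a::{cstar_algebra, real_normed_algebra_1}"
  assumes cancel: "star v * v * f = f" "star v * v * v = v" and ev: "e * v = 0" and vf: "star v * f = 0"
  shows "(e * star v ^ i) * (v ^ j * f) = (if i = j then e * f else 0)"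
proof (induction i arbitrary: j)
  case 0
  show ?case using ev by (cases j) (simp_all flip: mult.assoc)
next
  case (Suc i)
  show ?case
  proof (cases j)
    case 0
    then show ?thesis using vf by (simp add: power_Suc2 mult.assoc del: power_Suc)
  next
    case (Suc k)
    have "star v * (v * (v ^ k * f)) = v ^ k * f"
      using cancel by (cases k) (simp_all flip: mult.assoc)
    then have "(e * star v ^ Suc i) * (v ^ j * f) = (e * star v ^ i) * (v ^ k * f)"
      unfolding power_Suc2[of "star v"] Suc power_Suc[of v] by (simp only: mult.assoc)
    then show ?thesis using Suc.IH[of k] Suc by simp
  qed
qed

text \<open>Let \<open>v\<close> implement the equivalence of \<open>p\<close> with \<open>q < p\<close> and put \<open>e = p - q\<close>. The projections
  \<open>v\<^sup>i e v\<^sup>*\<^sup>i\<close> are orthogonal copies of \<open>e\<close> below \<open>p\<close>, so there is room under \<open>p\<close> for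
  \<open>y = \<Sum> v\<^sup>i e b\<^sub>i\<close>, however many terms are needed in \<open>1 = \<Sum> a\<^sub>i e b\<^sub>i\<close>. The element \<open>\<Sum> a\<^sub>i e v\<^sup>*\<^sup>i\<close> is a
  left inverse of \<open>y\<close>.\<close>

lemma infinite_projection_dominates_unit:
  fixes \<pi> :: "'d::{cstar_algebra, real_normed_algebra_1} \<Rightarrow> 'h::chilbert_space bop"
  assumes \<pi>: "faithful_representation \<pi>" and simple: "simple_cstar (UNIV :: 'd set)"
    and p: "infinite_projection UNIV (p :: 'd)"
  shows "\<exists>w. star w * w = 1 \<and> p * w = w"
proof -
  obtain q v where pp: "star p = p" "p * p = p" and q: "star q = q" "q * q = q" "p * q = q" "q \<noteq> p"
    and v: "star v * v = p" "v * star v = q"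
    using p by (auto simp: infinite_projection_def projection_def)
  have qp: "q * p = q" using q pp by (metis star_mult)
  have vp: "v * p = v"
  proof -
    have "star (v * p - v) * (v * p - v) = 0"
      using v(1) pp by (simp add: star_simps algebra_simps) (metis mult.assoc pp(2) diff_self)
    then show ?thesis using star_mult_self_eq_0 by fastforce
  qed
  have qv: "q * v = v" using v vp by (metis mult.assoc)
  have pv: "p * v = v" using qv q(3) by (metis mult.assoc)
  define e where "e = p - q"
  have e: "e \<noteq> 0" "star e = e" "e * e = e" "e * v = 0" "p * e = e"
    using q pp qp qv pv by (auto simp: e_def star_simps algebra_simps)
  have "star v * e = 0" using e(2,4) by (metis star_mult star_zero)
  moreover have "star v * v * e = e" by (simp add: v e)
  moreover have "star v * v * v = v" by (simp add: v pv)
  ultimately have orth: "(e * star v ^ i) * (v ^ j * e) = (if i = j then e else 0)" for i j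
    using isometry_shift_orthogonal[of v e e i j] e by simp
  obtain n a b where one: "1 = (\<Sum>i<(n::nat). a i * e * b i)"
    using simple_unit_in_ideal_sums[OF simple e(1)] by (auto simp: ideal_sums_def)
  define l y where "l = (\<Sum>i<n. a i * (e * star v ^ i))" and "y = (\<Sum>j<n. (v ^ j * e) * b j)"
  have "l * y = (\<Sum>i<n. \<Sum>j<n. a i * ((e * star v ^ i) * (v ^ j * e)) * b j)"
    unfolding l_def y_def sum_product by (intro sum.cong refl) (simp add: mult.assoc)
  also have "\<dots> = (\<Sum>i<n. a i * e * b i)"
    unfolding orth by (intro sum.cong refl) (simp add: if_distrib if_distribR sum.delta cong: if_cong)
  finally have "l * y = 1" using one by simp
  from left_invertible_to_isometry[OF \<pi> this] obtain r where r: "star (y * r) * (y * r) = 1" by blast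
  have "p * (v ^ j * e) = v ^ j * e" for j using e(5) pv by (cases j) (simp_all flip: mult.assoc)
  then have "p * y = y" by (simp add: y_def sum_distrib_left flip: mult.assoc)
  then have "p * (y * r) = y * r" by (simp flip: mult.assoc)
  with r show ?thesis by blast
qed

text \<open>Put \<open>d = y\<^sup>* y\<close>, \<open>c = d - \<epsilon>\<close> with \<open>0 < \<epsilon> < \<parallel>d\<parallel>\<close>, and \<open>m = \<bar>c\<bar>\<close>. The annihilator \<open>B\<close> of \<open>k = \<bar>c\<bar> - c\<close>, twice
  the negative part of \<open>c\<close>, is a hereditary subalgebra that contains the nonzero element \<open>\<bar>c\<bar> + c\<close>. It
  is easier to handle than the closure of \<open>d D d\<close>: no approximate units enter. An infinite projection
  \<open>p \<in> B\<close> satisfies \<open>p k = 0\<close>, hence \<open>p c p = p \<bar>c\<bar> p \<ge> 0\<close> and \<open>p d p \<ge> \<epsilon> p\<close>; so \<open>d\<close> is bounded below on the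
  range of an isometry \<open>w = p w\<close>.\<close>

lemma purely_infinite_positive_dominates_unit:
  fixes \<pi> :: "'d::{cstar_algebra, real_normed_algebra_1} \<Rightarrow> 'h::chilbert_space bop"
  assumes \<pi>: "faithful_representation \<pi>" and pis: "purely_infinite_simple (UNIV :: 'd set)"
    and y: "y \<noteq> (0 :: 'd)"
  shows "\<exists>z. star z * (star y * y) * z = 1"
proof -
  note ql = quad_form_linear[OF \<pi>] and qs = quad_form_star_self[OF \<pi>]
  define d where "d = star y * y"
  have ds: "star d = d" and "d \<noteq> 0" using y star_mult_self_eq_0 by (auto simp: d_def star_simps)
  define \<epsilon> where "\<epsilon> = norm d / 2"
  have \<epsilon>: "0 < \<epsilon>" "\<epsilon> < norm d" using \<open>d \<noteq> 0\<close> by (auto simp: \<epsilon>_def)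
  define c where "c = d - \<epsilon> *\<^sub>R 1"
  have cs: "star c = c" by (simp add: c_def star_simps star_one ds)
  obtain s where s: "star s = s" "s * c = c * s" "(s * s) * (s * s) = c * c"
    using fourth_root_of_square[OF cs] by blast
  define m where "m = s * s"
  have m: "star m = m" "m * c = c * m" "m * m = c * c"
    using s by (simp_all add: m_def star_simps) (metis mult.assoc)
  define k where "k = m - c"
  have ks: "star k = k" by (simp add: k_def star_simps m cs)
  \<comment> \<open>Otherwise \<open>\<epsilon> - d = \<bar>c\<bar> \<ge> 0\<close>, against \<open>\<epsilon> < \<parallel>d\<parallel>\<close>.\<close>
  have nonzero: "m + c \<noteq> 0"
  proof
    assume "m + c = 0"
    then have "m = \<epsilon> *\<^sub>R 1 - d" by (simp add: c_def eq_neg_iff_add_eq_0 algebra_simps)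
    then have sd: "star s * s = \<epsilon> *\<^sub>R 1 - d" by (simp add: m_def s)
    have "norm d \<le> \<epsilon>"
    proof (rule norm_le_if_quad_form_le[OF \<pi> ds])
      fix v
      have "0 \<le> quad_form \<pi> (\<epsilon> *\<^sub>R 1 - d) v" unfolding sd[symmetric] qs by simp
      moreover have "0 \<le> quad_form \<pi> d v" unfolding d_def qs by simp
      ultimately show "\<bar>quad_form \<pi> d v\<bar> \<le> \<epsilon> * (norm (bop_apply (\<pi> 1) v))\<^sup>2"
        by (simp add: ql quad_form_one[OF \<pi>])
    qed (use \<epsilon> in simp)
    with \<epsilon> show False by simp
  qed
  define B where "B = {b. b * k = 0 \<and> k * b = 0}"
  have "cstar_subalgebra B"
    unfolding cstar_subalgebra_def
  proof (intro conjI ballI allI)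
    have "B = (\<lambda>b. b * k) -` {0} \<inter> (\<lambda>b. k * b) -` {0}" by (auto simp: B_def)
    then show "closed B"
      by (simp add: closed_Int closed_vimage continuous_intros)
    show "star b \<in> B" if "b \<in> B" for b
      using that ks unfolding B_def by (metis (mono_tags, lifting) mem_Collect_eq star_mult star_zero)
    show "x * y \<in> B" if "x \<in> B" "y \<in> B" for x y
    proof -
      have "x * y * k = x * (y * k)" "k * (x * y) = (k * x) * y" by (simp_all add: mult.assoc)
      then show ?thesis using that by (simp add: B_def)
    qed
  qed (auto simp: B_def algebra_simps mult_scaleC_left mult_scaleC_right scaleC_zero_right)
  moreover have "a \<in> B" if b: "b \<in> B" and pos: "positive_in UNIV a" "positive_in UNIV (b - a)" for a b
  proof -
    \<comment> \<open>With \<open>k b k = 0\<close> the two positive summands \<open>k a k\<close> and \<open>k (b - a) k\<close> add up to zero, so both vanish.\<close>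
    obtain f g where f: "a = star f * f" and g: "b - a = star g * g"
      using pos by (auto simp: positive_in_def)
    have "b = star f * f + star g * g" using f g by (simp add: algebra_simps)
    then have "star (f * k) * (f * k) + star (g * k) * (g * k) = k * b * k"
      by (simp add: star_simps ks algebra_simps)
    also have "\<dots> = 0" using b by (simp add: B_def)
    finally have z: "star (f * k) * (f * k) + star (g * k) * (g * k) = 0" .
    have "norm (f * k) = 0"
    proof -
      have "(norm (bop_apply (\<pi> (f * k)) v))\<^sup>2 + (norm (bop_apply (\<pi> (g * k)) v))\<^sup>2 = 0" for v
        using arg_cong[OF z, of "\<lambda>x. quad_form \<pi> x v"] ql(4)[of 0 0 v] by (simp add: ql qs)
      then have "bop_apply (\<pi> (f * k)) v = 0" for v by (simp add: sum_power2_eq_zero_iff)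
      then have "\<pi> (f * k) = 0" by (intro bop_eqI) (simp add: bop_apply_simps)
      then show ?thesis using rep_isometric[OF \<pi>, of "f * k"] by simp
    qed
    then have ak: "a * k = 0" by (simp add: f mult.assoc)
    moreover have "k * a = 0"
      using arg_cong[OF ak, of star] ks by (simp add: star_mult f star_star)
    ultimately show ?thesis by (simp add: B_def)
  qed
  ultimately have "hereditary B UNIV" by (auto simp: hereditary_def)
  moreover have "m + c \<in> B" using m by (simp add: B_def k_def algebra_simps)
  ultimately obtain p where p: "p \<in> B" "infinite_projection UNIV p"
    using pis nonzero by (auto simp: purely_infinite_simple_def)
  have pp: "star p = p" using p(2) by (simp add: infinite_projection_def projection_def)
  have simple: "simple_cstar (UNIV :: 'd set)" using pis by (simp add: purely_infinite_simple_def)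
  obtain w where w: "star w * w = 1" "p * w = w"
    using infinite_projection_dominates_unit[OF \<pi> simple p(2)] by blast
  have wk: "k * w = 0" using p(1) w(2) by (metis (mono_tags, lifting) B_def mem_Collect_eq mult.assoc mult_zero_left)
  then have cw: "c * w = m * w" by (simp add: k_def algebra_simps)
  have "star w * d * w = \<epsilon> *\<^sub>R 1 + star w * (c * w)"
    by (simp add: c_def algebra_simps w)
  also have "star w * (c * w) = star (s * w) * (s * w)"
    unfolding cw m_def by (simp add: star_simps s mult.assoc)
  finally have eq: "star w * d * w = \<epsilon> *\<^sub>R 1 + star (s * w) * (s * w)" .
  have "\<exists>r. star r * (star w * d * w) * r = 1"
  proof (rule bounded_below_normalizable[OF \<pi> _ \<epsilon>(1)])
    show "\<epsilon> * (norm (bop_apply (\<pi> 1) v))\<^sup>2 \<le> quad_form \<pi> (star w * d * w) v" for v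
      unfolding eq by (simp add: ql qs quad_form_one[OF \<pi>])
  qed (simp add: star_simps ds mult.assoc)
  then obtain r where "star r * (star w * d * w) * r = 1" by blast
  then have "star (w * r) * d * (w * r) = 1" by (simp add: star_mult mult.assoc)
  then show ?thesis unfolding d_def by blast
qed

text \<open>A projection \<open>q\<close> strictly between \<open>0\<close> and some other projection \<open>p\<close> is not \<open>1\<close>, yet \<open>z\<^sup>* q z = 1\<close> is
  solvable: \<open>q z\<close> is an isometry whose range projection lies below \<open>q\<close>.\<close>

lemma purely_infinite_proper_isometry:
  fixes \<pi> :: "'d::{cstar_algebra, real_normed_algebra_1} \<Rightarrow> 'h::chilbert_space bop"
  assumes \<pi>: "faithful_representation \<pi>" and pis: "purely_infinite_simple (UNIV :: 'd set)"
  shows "\<exists>v :: 'd. star v * v = 1 \<and> v * star v \<noteq> 1"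
proof -
  have "hereditary (UNIV :: 'd set) UNIV" by (simp add: hereditary_def cstar_subalgebra_UNIV)
  moreover have "(UNIV :: 'd set) \<noteq> {0}" by (metis UNIV_I singletonD zero_neq_one)
  ultimately obtain p :: 'd where "infinite_projection UNIV p"
    using pis unfolding purely_infinite_simple_def by blast
  then obtain q v where p: "star p = p" "p * p = p" and q: "star q = q" "q * q = q" "p * q = q" "q \<noteq> p"
    and v: "star v * v = p" "v * star v = q"
    by (auto simp: infinite_projection_def projection_def)
  have "q \<noteq> 0"
  proof
    assume "q = 0"
    then have "star v = 0" using v(2) star_mult_self_eq_0[of "star v"] by (simp add: star_star)
    then show False using v q \<open>q = 0\<close> by simp
  qed
  then obtain z where "star z * (star q * q) * z = 1"
    using purely_infinite_positive_dominates_unit[OF \<pi> pis] by blast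
  then have z: "star (q * z) * (q * z) = 1" by (simp add: star_mult mult.assoc)
  have "(q * z) * star (q * z) \<noteq> 1"
  proof
    assume "(q * z) * star (q * z) = 1"
    then have "q = 1" using q(2) by (metis mult.assoc mult.right_neutral)
    then show False using q by simp
  qed
  with z show ?thesis by blast
qed

text \<open>Given a proper isometry \<open>v\<close>, the defect \<open>1 - v v\<^sup>*\<close> dominates the unit, so it contains the range of an
  isometry \<open>w\<close>. The isometries \<open>v\<^sup>i w\<close> have orthogonal ranges.\<close>

lemma purely_infinite_orthogonal_isometries:
  fixes \<pi> :: "'d::{cstar_algebra, real_normed_algebra_1} \<Rightarrow> 'h::chilbert_space bop"
  assumes \<pi>: "faithful_representation \<pi>" and pis: "purely_infinite_simple (UNIV :: 'd set)"
  shows "\<exists>t :: nat \<Rightarrow> 'd. \<forall>i j. star (t i) * t j = (if i = j then 1 else 0)"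
proof -
  obtain v :: 'd where v: "star v * v = 1" "v * star v \<noteq> 1"
    using purely_infinite_proper_isometry[OF \<pi> pis] by blast
  define e where "e = 1 - v * star v"
  have e: "e \<noteq> 0" "star v * e = 0" using v by (auto simp: e_def algebra_simps simp flip: mult.assoc)
  obtain z where z: "star z * (star e * e) * z = 1"
    using purely_infinite_positive_dominates_unit[OF \<pi> pis e(1)] by blast
  define w where "w = e * z"
  have w: "star w * w = 1" "star v * w = 0"
    using z e(2) by (simp_all add: w_def star_mult mult.assoc) (simp flip: mult.assoc)
  have "star w * v = 0" using w(2) by (metis star_mult star_star star_zero)
  have "star (v ^ i) = star v ^ i" for i
    by (induction i) (simp_all add: star_one star_mult power_commutes)
  then have "star (v ^ i * w) * (v ^ j * w) = (if i = j then 1 else 0)" for i j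
    using isometry_shift_orthogonal[of v w "star w" i j] w v(1) \<open>star w * v = 0\<close>
    by (simp add: star_mult)
  then show ?thesis by (intro exI[of _ "\<lambda>i. v ^ i * w"]) blast
qed

section \<open>The algebra of the regular representation\<close>

lemma closure_cstar_subalgebra:
  fixes S :: "'a::cstar_algebra set"
  assumes zero: "0 \<in> S" and add: "\<And>x y. x \<in> S \<Longrightarrow> y \<in> S \<Longrightarrow> x + y \<in> S"
    and mult: "\<And>x y. x \<in> S \<Longrightarrow> y \<in> S \<Longrightarrow> x * y \<in> S"
    and st: "\<And>x. x \<in> S \<Longrightarrow> star x \<in> S" and sc: "\<And>x c. x \<in> S \<Longrightarrow> c *\<^sub>C x \<in> S"
  shows "cstar_subalgebra (closure S)"
  unfolding cstar_subalgebra_def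
proof (intro conjI ballI allI)
  show "0 \<in> closure S" using zero closure_subset by blast
  fix x y c
  assume x: "x \<in> closure S" and "y \<in> closure S"
  then obtain f g where f: "\<forall>n. f n \<in> S" "f \<longlonglongrightarrow> x" and g: "\<forall>n. g n \<in> S" "g \<longlonglongrightarrow> y"
    unfolding closure_sequential by blast
  have lim: "(\<lambda>n. f n + g n) \<longlonglongrightarrow> x + y" "(\<lambda>n. f n * g n) \<longlonglongrightarrow> x * y"
    by (intro tendsto_intros f g)+
  have S: "f n + g n \<in> S" "f n * g n \<in> S" for n
    using f g add mult by auto
  show "x + y \<in> closure S" unfolding closure_sequential using lim(1) S(1) by (intro exI[of _ "\<lambda>n. f n + g n"]) auto
  show "x * y \<in> closure S" unfolding closure_sequential using lim(2) S(2) by (intro exI[of _ "\<lambda>n. f n * g n"]) auto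
next
  fix x c
  assume x: "x \<in> closure S"
  then obtain f where f: "\<forall>n. f n \<in> S" "f \<longlonglongrightarrow> x"
    unfolding closure_sequential by blast
  have lim: "(\<lambda>n. star (f n)) \<longlonglongrightarrow> star x" "(\<lambda>n. c *\<^sub>C f n) \<longlonglongrightarrow> c *\<^sub>C x"
    by (intro bounded_linear.tendsto[OF bounded_linear_star] tendsto_scaleC f)+
  have S: "star (f n) \<in> S" "c *\<^sub>C f n \<in> S" for n
    using f st sc by auto
  show "star x \<in> closure S" unfolding closure_sequential using lim(1) S(1) by (intro exI[of _ "\<lambda>n. star (f n)"]) auto
  show "c *\<^sub>C x \<in> closure S" unfolding closure_sequential using lim(2) S(2) by (intro exI[of _ "\<lambda>n. c *\<^sub>C f n"]) auto
qed simp

lemma cstar_actionD: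
  assumes "cstar_action \<alpha>"
  shows "star_hom (\<alpha> g)" "\<alpha> 0 a = a" "\<alpha> (g + h) a = \<alpha> g (\<alpha> h a)" "bij (\<alpha> g)"
  using assms by (auto simp: cstar_action_def star_aut_def)

text \<open>Multiply \<open>\<beta> 1\<close> by the image of a preimage of \<open>1\<close>.\<close>

lemma star_aut_one:
  fixes \<beta> :: "'a::{cstar_algebra, real_normed_algebra_1} \<Rightarrow> 'a"
  assumes "star_aut \<beta>"
  shows "\<beta> 1 = 1"
proof -
  obtain x where x: "\<beta> x = 1" using assms by (metis bij_pointE star_aut_def)
  have "\<beta> (1 * x) = \<beta> 1 * \<beta> x" using assms by (simp only: star_aut_def star_homD)
  then show ?thesis using x by simp
qed

definition ell2_delta :: "'g \<Rightarrow> 'h::chilbert_space \<Rightarrow> ('g, 'h) ell2" where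
  "ell2_delta h v = Ell2 (\<lambda>k. if k = h then v else 0)"

lemma ell2_delta_apply: "ell2_apply (ell2_delta h v) k = (if k = h then v else 0)"
proof -
  have "(\<lambda>k. (norm (if k = h then v else 0))\<^sup>2) summable_on UNIV"
    by (rule finite_nonzero_values_imp_summable_on) (auto intro: finite_subset[of _ "{h}"])
  then show ?thesis by (simp add: ell2_delta_def Ell2_inverse)
qed

lemma cinner_ell2_delta: "cinner (ell2_delta h v) \<xi> = cinner v (ell2_apply \<xi> h)"
proof -
  have "cinner (ell2_delta h v) \<xi> = (\<Sum>\<^sub>\<infinity>g\<in>{h}. cinner v (ell2_apply \<xi> g))"
    unfolding cinner_ell2.rep_eq
    by (rule infsum_cong_neutral) (auto simp: ell2_delta_apply)
  then show ?thesis by simp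
qed

lemma norm_ell2_delta: "norm (ell2_delta h v) = norm v"
proof -
  have "complex_of_real ((norm (ell2_delta h v))\<^sup>2) = complex_of_real ((norm v)\<^sup>2)"
    unfolding cinner_self[symmetric] cinner_ell2_delta by (simp add: ell2_delta_apply)
  then have "(norm (ell2_delta h v))\<^sup>2 = (norm v)\<^sup>2" by (simp only: of_real_eq_iff)
  then show ?thesis by simp
qed

context
  fixes \<pi> :: "'a::{cstar_algebra, real_normed_algebra_1} \<Rightarrow> 'h::chilbert_space bop"
    and \<alpha> :: "'g::group_add \<Rightarrow> 'a \<Rightarrow> 'a"
  assumes \<pi>: "faithful_representation \<pi>" and \<alpha>: "cstar_action \<alpha>"
begin

abbreviation (input) "reg \<equiv> regular_representation \<pi> \<alpha>"
abbreviation (input) "skew_ring \<equiv> {f :: 'g \<Rightarrow> 'a. finite {g. f g \<noteq> 0}}"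
abbreviation (input) "CP \<equiv> reduced_crossed_product \<pi> \<alpha>"

lemmas \<pi>_hom = star_homD[OF rep_hom[OF \<pi>]]
lemmas \<alpha>_hom = star_homD[OF cstar_actionD(1)[OF \<alpha>]]
lemmas reg_apply = regular_representation_apply[OF \<pi> \<alpha>]

text \<open>The operator written \<open>a u\<^sub>g\<close> in the skew group ring. As \<open>\<pi>\<close> may be degenerate, \<open>u\<^sub>g\<close> stands for
  \<open>monomial 1 g\<close>, which is unitary relative to the projection \<open>monomial 1 0\<close>.\<close>

definition monomial :: "'a \<Rightarrow> 'g \<Rightarrow> ('g, 'h) ell2 bop" where
  "monomial a g = reg (\<lambda>k. if k = g then a else 0)"

lemma monomial_apply:
  "ell2_apply (bop_apply (monomial a g) \<xi>) h = bop_apply (\<pi> (\<alpha> (- h) a)) (ell2_apply \<xi> (- g + h))"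
proof (cases "a = 0")
  case True
  then show ?thesis by (simp add: monomial_def reg_apply \<alpha>_hom \<pi>_hom bop_apply_simps)
next
  case False
  then have "{k. (if k = g then a else 0) \<noteq> 0} = {g}" by auto
  then show ?thesis by (simp add: monomial_def reg_apply)
qed

lemma monomial_add: "monomial (a + b) g = monomial a g + monomial b g"
  by (intro bop_eqI ell2_eqI) (simp add: monomial_apply bop_apply_simps ell2_apply_simps \<alpha>_hom \<pi>_hom)

lemma monomial_scaleC: "monomial (c *\<^sub>C a) g = c *\<^sub>C monomial a g"
  by (intro bop_eqI ell2_eqI)
     (simp add: monomial_apply bop_apply_scaleC_left ell2_apply_simps \<alpha>_hom \<pi>_hom)

lemma monomial_zero: "monomial 0 g = 0"
  by (intro bop_eqI ell2_eqI) (simp add: monomial_apply bop_apply_simps ell2_apply_simps \<alpha>_hom \<pi>_hom)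

lemma monomial_mult: "monomial a g * monomial b h = monomial (a * \<alpha> g b) (g + h)"
  by (intro bop_eqI ell2_eqI)
     (simp add: monomial_apply bop_apply_simps \<alpha>_hom \<pi>_hom minus_add add.assoc
       cstar_actionD(3)[OF \<alpha>, symmetric] del: add_uminus_conv_diff)

lemma star_monomial: "star (monomial a g) = monomial (\<alpha> (- g) (star a)) (- g)"
proof (rule bop_star_eqI[symmetric])
  fix x y
  let ?F = "\<lambda>h. cinner (ell2_apply x h) (bop_apply (\<pi> (\<alpha> (- h) a)) (ell2_apply y (- g + h)))"
  \<comment> \<open>Left translation by \<open>g\<close> in the sum over the group moves the adjoint to the first argument.\<close>
  have "cinner x (bop_apply (monomial a g) y) = (\<Sum>\<^sub>\<infinity>h. ?F h)"
    by (simp add: cinner_ell2.rep_eq monomial_apply)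
  also have "\<dots> = (\<Sum>\<^sub>\<infinity>h. ?F (g + h))"
    by (rule infsum_reindex_bij_betw[symmetric])
       (rule bij_betwI[where g = "\<lambda>h. - g + h"], auto simp flip: add.assoc)
  also have "\<dots> = cinner (bop_apply (monomial (\<alpha> (- g) (star a)) (- g)) x) y"
    by (simp add: cinner_ell2.rep_eq monomial_apply \<alpha>_hom \<pi>_hom cinner_star_left minus_add
        cstar_actionD(3)[OF \<alpha>, symmetric] flip: add.assoc)
  finally show "cinner (bop_apply (monomial (\<alpha> (- g) (star a)) (- g)) x) y =
      cinner x (bop_apply (monomial a g) y)" ..
qed

lemma reg_eq_sum:
  assumes "finite S" "{g. f g \<noteq> 0} \<subseteq> S"
  shows "reg f = (\<Sum>g\<in>S. monomial (f g) g)"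
proof (intro bop_eqI ell2_eqI)
  fix \<xi> h
  have "ell2_apply (bop_apply (reg f) \<xi>) h =
      (\<Sum>g\<in>S. bop_apply (\<pi> (\<alpha> (- h) (f g))) (ell2_apply \<xi> (- g + h)))"
    unfolding reg_apply
    by (rule sum.mono_neutral_left) (use assms in \<open>auto simp: \<alpha>_hom \<pi>_hom bop_apply_simps\<close>)
  then show "ell2_apply (bop_apply (reg f) \<xi>) h =
      ell2_apply (bop_apply (\<Sum>g\<in>S. monomial (f g) g) \<xi>) h"
    by (simp add: bop_apply_sum ell2_apply_sum monomial_apply)
qed

lemma reg_diff:
  assumes f: "f \<in> skew_ring" and f': "f' \<in> skew_ring"
  shows "(\<lambda>g. f g - f' g) \<in> skew_ring" "reg (\<lambda>g. f g - f' g) = reg f - reg f'"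
proof -
  let ?S = "{g. f g \<noteq> 0} \<union> {g. f' g \<noteq> 0}"
  have S: "finite ?S" and sub: "{g. f g - f' g \<noteq> 0} \<subseteq> ?S" using f f' by auto
  then show "(\<lambda>g. f g - f' g) \<in> skew_ring" using finite_subset by blast
  have m: "monomial (a - b) g = monomial a g - monomial b g" for a b g
    using monomial_add[of "a - b" b g] by simp
  show "reg (\<lambda>g. f g - f' g) = reg f - reg f'"
    using reg_eq_sum[OF S sub] reg_eq_sum[OF S, of f] reg_eq_sum[OF S, of f']
    by (auto simp: m sum_subtractf)
qed

lemma monomial_in_image: "monomial a g \<in> reg ` skew_ring"
proof -
  have "finite {k. (if k = g then a else 0) \<noteq> 0}" by (rule finite_subset[of _ "{g}"]) auto
  then show ?thesis unfolding monomial_def by blast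
qed

lemma reg_image_add: "x \<in> reg ` skew_ring \<Longrightarrow> y \<in> reg ` skew_ring \<Longrightarrow> x + y \<in> reg ` skew_ring"
proof (elim imageE)
  fix f f' assume ff: "x = reg f" "y = reg f'" and f: "f \<in> skew_ring" and f': "f' \<in> skew_ring"
  let ?S = "{g. f g \<noteq> 0} \<union> {g. f' g \<noteq> 0}"
  have S: "finite ?S" and sub: "{g. f g + f' g \<noteq> 0} \<subseteq> ?S" using f f' by auto
  then have "(\<lambda>g. f g + f' g) \<in> skew_ring" using finite_subset by blast
  moreover have "x + y = reg (\<lambda>g. f g + f' g)"
    using reg_eq_sum[OF S sub] reg_eq_sum[OF S, of f] reg_eq_sum[OF S, of f']
    by (auto simp: monomial_add sum.distrib ff)
  ultimately show ?thesis by blast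
qed

lemma reg_image_sum:
  assumes "\<And>i. i \<in> S \<Longrightarrow> x i \<in> reg ` skew_ring"
  shows "sum x S \<in> reg ` skew_ring"
  using assms
proof (induction S rule: infinite_finite_induct)
  case (insert i S)
  then show ?case by (simp add: reg_image_add)
qed (use monomial_in_image[of 0 0] in \<open>simp_all add: monomial_zero\<close>)

lemma reg_image_eq_sum: "x \<in> reg ` skew_ring \<Longrightarrow> \<exists>S f. finite S \<and> x = (\<Sum>g\<in>S. monomial (f g) g)"
  using reg_eq_sum by blast

lemma CP_subalgebra: "cstar_subalgebra CP"
  unfolding reduced_crossed_product_def
proof (rule closure_cstar_subalgebra)
  show "0 \<in> reg ` skew_ring" using monomial_in_image[of 0 0] by (simp add: monomial_zero)
  fix x y c assume x: "x \<in> reg ` skew_ring"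
  obtain S f where xs: "x = (\<Sum>g\<in>S. monomial (f g) g)" using reg_image_eq_sum[OF x] by blast
  show "star x \<in> reg ` skew_ring" "c *\<^sub>C x \<in> reg ` skew_ring"
  proof -
    have "star x = (\<Sum>g\<in>S. star (monomial (f g) g))" by (simp add: xs star_sum)
    also have "\<dots> \<in> reg ` skew_ring" unfolding star_monomial by (intro reg_image_sum monomial_in_image)
    finally show "star x \<in> reg ` skew_ring" .
    have "c *\<^sub>C x = (\<Sum>g\<in>S. c *\<^sub>C monomial (f g) g)"
      unfolding xs by (induction S rule: infinite_finite_induct) (simp_all add: scaleC_zero_right scaleC_add_right)
    also have "\<dots> \<in> reg ` skew_ring"
      unfolding monomial_scaleC[symmetric] by (intro reg_image_sum monomial_in_image)
    finally show "c *\<^sub>C x \<in> reg ` skew_ring" .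
  qed
  assume y: "y \<in> reg ` skew_ring"
  obtain T f' where ys: "y = (\<Sum>g\<in>T. monomial (f' g) g)" using reg_image_eq_sum[OF y] by blast
  show "x * y \<in> reg ` skew_ring"
    unfolding xs ys sum_product monomial_mult by (intro reg_image_sum monomial_in_image)
  show "x + y \<in> reg ` skew_ring" using x y by (rule reg_image_add)
qed

lemma monomial_in_CP: "monomial a g \<in> CP"
  unfolding reduced_crossed_product_def using monomial_in_image closure_subset by blast

lemma \<alpha>_one: "\<alpha> g 1 = 1"
  using \<alpha> by (intro star_aut_one) (auto simp: cstar_action_def)

abbreviation (input) "unit \<equiv> monomial 1 0"

lemma unit_mult:
  assumes "x \<in> CP"
  shows "unit * x = x \<and> x * unit = x"
proof -
  have "closed {x. unit * x = x}" "closed {x. x * unit = x}"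
    by (intro closed_Collect_eq continuous_intros)+
  then have cl: "closed {x. unit * x = x \<and> x * unit = x}" by (simp add: closed_Collect_conj)
  have "reg ` skew_ring \<subseteq> {x. unit * x = x \<and> x * unit = x}"
  proof
    fix x assume "x \<in> reg ` skew_ring"
    then obtain S f where "x = (\<Sum>g\<in>S. monomial (f g) g)" using reg_image_eq_sum by blast
    then show "x \<in> {x. unit * x = x \<and> x * unit = x}"
      by (simp add: sum_distrib_left sum_distrib_right monomial_mult \<alpha>_one cstar_actionD(2)[OF \<alpha>])
  qed
  from closure_minimal[OF this cl] show ?thesis
    using assms unfolding reduced_crossed_product_def by auto
qed

lemma unit_projection: "star unit = unit" "unit * unit = unit"
  by (simp_all add: star_monomial monomial_mult star_one \<alpha>_one)

lemma coefficient_hom: "star_hom (\<lambda>a. monomial a 0)"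
  by (simp add: star_hom_def monomial_add monomial_scaleC monomial_mult star_monomial cstar_actionD(2)[OF \<alpha>])

lemma norm_coefficient_le: "norm (monomial a 0) \<le> norm a"
  using star_hom_contractive[OF coefficient_hom] .

section \<open>The conditional expectation\<close>

text \<open>The diagonal matrix coefficients of an operator on \<open>l\<^sup>2(G, H)\<close>; on the skew group ring the one at
  \<open>0\<close> is the canonical conditional expectation followed by \<open>\<pi>\<close>.\<close>

definition coeff_at :: "('g, 'h) ell2 bop \<Rightarrow> 'g \<Rightarrow> 'h \<Rightarrow> 'h" where
  "coeff_at T h v = ell2_apply (bop_apply T (ell2_delta h v)) h"

lemma norm_coeff_at_le: "norm (coeff_at T h v) \<le> norm T * norm v"
  using norm_ell2_apply_le[of "bop_apply T (ell2_delta h v)" h] norm_bop_apply[of T "ell2_delta h v"]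
  by (simp add: coeff_at_def norm_ell2_delta)

lemma coeff_at_diff: "coeff_at (S - T) h v = coeff_at S h v - coeff_at T h v"
  by (simp add: coeff_at_def bop_apply_simps ell2_apply_simps)

lemma coeff_at_reg:
  assumes "f \<in> skew_ring"
  shows "coeff_at (reg f) h v = bop_apply (\<pi> (\<alpha> (- h) (f 0))) v"
proof -
  have eq: "- g + h = h \<longleftrightarrow> g = 0" for g :: 'g
    using add_right_cancel[of "- g" h 0] by simp
  have "coeff_at (reg f) h v = (\<Sum>g | f g \<noteq> 0. if g = 0 then bop_apply (\<pi> (\<alpha> (- h) (f g))) v else 0)"
    unfolding coeff_at_def reg_apply ell2_delta_apply eq
    by (intro sum.cong) (auto simp: linear_simps(3)[OF bounded_linear_bop_apply])
  also have "\<dots> = (if f 0 \<noteq> 0 then bop_apply (\<pi> (\<alpha> (- h) (f 0))) v else 0)"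
    using assms by (simp add: sum.delta)
  finally show ?thesis by (simp add: \<alpha>_hom \<pi>_hom bop_apply_simps)
qed

lemma norm_coeff_zero_le:
  assumes "f \<in> skew_ring"
  shows "norm (f 0) \<le> norm (reg f)"
proof -
  have "norm (\<pi> (f 0)) \<le> norm (reg f)"
    using norm_coeff_at_le[of "reg f" 0] coeff_at_reg[OF assms, of 0]
    by (intro norm_bop_bound) (auto simp: cstar_actionD(2)[OF \<alpha>])
  then show ?thesis by (simp add: rep_isometric[OF \<pi>])
qed

text \<open>The coefficient \<open>f(0)\<close> is bounded by the norm of the operator because \<open>\<pi>\<close> is isometric, so along a
  sequence of skew ring elements converging to \<open>T\<close> these coefficients form a Cauchy sequence in the
  algebra itself. The limit \<open>e\<close> determines all diagonal coefficients of \<open>T\<close>, through the action.\<close>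

lemma expectation_exists:
  assumes "T \<in> CP"
  shows "\<exists>e. (\<forall>h v. coeff_at T h v = bop_apply (\<pi> (\<alpha> (- h) e)) v) \<and>
     (\<forall>f\<in>skew_ring. norm (e - f 0) \<le> norm (T - reg f))"
proof -
  obtain F where F: "\<forall>n. F n \<in> reg ` skew_ring" "F \<longlonglongrightarrow> T"
    using assms unfolding reduced_crossed_product_def closure_sequential by blast
  then have "\<forall>n. \<exists>f. F n = reg f \<and> f \<in> skew_ring" by blast
  then obtain \<Phi> where \<Phi>: "\<And>n. F n = reg (\<Phi> n)" "\<And>n. \<Phi> n \<in> skew_ring" by metis
  have le: "norm (\<Phi> n 0 - f 0) \<le> norm (F n - reg f)" if "f \<in> skew_ring" for n f
    using norm_coeff_zero_le[OF reg_diff(1)[OF \<Phi>(2) that]] by (simp add: reg_diff[OF \<Phi>(2) that] \<Phi>(1))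
  have "Cauchy (\<lambda>n. \<Phi> n 0)"
  proof (rule metric_CauchyI)
    fix \<epsilon> :: real assume "\<epsilon> > 0"
    then obtain N where N: "\<And>m n. m \<ge> N \<Longrightarrow> n \<ge> N \<Longrightarrow> dist (F m) (F n) < \<epsilon>"
      using LIMSEQ_imp_Cauchy[OF F(2)] unfolding Cauchy_def by blast
    have "dist (\<Phi> m 0) (\<Phi> n 0) < \<epsilon>" if "m \<ge> N" "n \<ge> N" for m n
      using N[OF that] le[OF \<Phi>(2), of m n] by (simp add: dist_norm \<Phi>(1))
    then show "\<exists>N. \<forall>m\<ge>N. \<forall>n\<ge>N. dist (\<Phi> m 0) (\<Phi> n 0) < \<epsilon>" by blast
  qed
  then obtain e where e: "(\<lambda>n. \<Phi> n 0) \<longlonglongrightarrow> e"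
    using Cauchy_convergent convergent_def by blast
  have "coeff_at T h v = bop_apply (\<pi> (\<alpha> (- h) e)) v" for h v
  proof (rule LIMSEQ_unique)
    have "(\<lambda>n. bop_apply (\<pi> (\<alpha> (- h) (\<Phi> n 0)) - \<pi> (\<alpha> (- h) e)) v) \<longlonglongrightarrow> 0"
    proof (rule Lim_null_comparison)
      have "norm (bop_apply (\<pi> (\<alpha> (- h) (\<Phi> n 0)) - \<pi> (\<alpha> (- h) e)) v) \<le> norm (\<Phi> n 0 - e) * norm v" for n
      proof -
        have "norm (\<pi> (\<alpha> (- h) (\<Phi> n 0)) - \<pi> (\<alpha> (- h) e)) = norm (\<alpha> (- h) (\<Phi> n 0 - e))"
          by (simp flip: \<pi>_hom \<alpha>_hom add: rep_isometric[OF \<pi>])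
        also have "\<dots> \<le> norm (\<Phi> n 0 - e)" by (rule star_hom_contractive[OF cstar_actionD(1)[OF \<alpha>]])
        finally show ?thesis using norm_bop_apply mult_right_mono norm_ge_zero order_trans by metis
      qed
      then show "\<forall>\<^sub>F n in sequentially. norm (bop_apply (\<pi> (\<alpha> (- h) (\<Phi> n 0)) - \<pi> (\<alpha> (- h) e)) v) \<le> norm (\<Phi> n 0 - e) * norm v"
        by simp
      show "(\<lambda>n. norm (\<Phi> n 0 - e) * norm v) \<longlonglongrightarrow> 0"
        using e by (intro tendsto_mult_left_zero) (simp add: tendsto_norm_zero LIM_zero)
    qed
    then show "(\<lambda>n. coeff_at (F n) h v) \<longlonglongrightarrow> bop_apply (\<pi> (\<alpha> (- h) e)) v"
      unfolding \<Phi>(1) coeff_at_reg[OF \<Phi>(2)] by (simp add: bop_apply_simps LIM_zero_iff)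
    have "(\<lambda>n. coeff_at (F n - T) h v) \<longlonglongrightarrow> 0"
    proof (rule Lim_null_comparison)
      show "\<forall>\<^sub>F n in sequentially. norm (coeff_at (F n - T) h v) \<le> norm (F n - T) * norm v"
        by (simp add: norm_coeff_at_le)
      show "(\<lambda>n. norm (F n - T) * norm v) \<longlonglongrightarrow> 0"
        using F(2) by (intro tendsto_mult_left_zero) (simp add: tendsto_norm_zero LIM_zero)
    qed
    then show "(\<lambda>n. coeff_at (F n) h v) \<longlonglongrightarrow> coeff_at T h v"
      by (simp add: coeff_at_diff LIM_zero_iff)
  qed
  moreover have "norm (e - f 0) \<le> norm (T - reg f)" if "f \<in> skew_ring" for f
    by (rule LIMSEQ_le[of "\<lambda>n. norm (\<Phi> n 0 - f 0)" _ "\<lambda>n. norm (F n - reg f)"])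
       (intro tendsto_intros e F, intro tendsto_intros F, use le[OF that] in blast)
  ultimately show ?thesis by blast
qed

text \<open>Here the expectation of \<open>y\<^sup>* y\<close> appears as \<open>s\<^sup>2\<close> with \<open>s\<close> selfadjoint. It is positive since its form at
  \<open>v\<close> is \<open>\<parallel>y \<delta>\<^sub>0 v\<parallel>\<^sup>2\<close>, and it is faithful: if it is zero then all diagonal coefficients \<open>\<parallel>y \<delta>\<^sub>h v\<parallel>\<^sup>2\<close> vanish,
  so \<open>y\<close> kills every \<open>\<delta>\<^sub>h v\<close> and the values of \<open>y\<^sup>*\<close> have only zero components.\<close>

lemma expectation_of_square:
  assumes y: "y \<in> CP" "y \<noteq> 0"
  shows "\<exists>s. s \<noteq> 0 \<and> star s = s \<and> (\<forall>f\<in>skew_ring. norm (s * s - f 0) \<le> norm (star y * y - reg f))"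
proof -
  define T where "T = star y * y"
  have "T \<in> CP" using y unfolding T_def by (intro cstar_subalgebraD[OF CP_subalgebra])
  then obtain e where e: "\<And>h v. coeff_at T h v = bop_apply (\<pi> (\<alpha> (- h) e)) v"
      and approx: "\<forall>f\<in>skew_ring. norm (e - f 0) \<le> norm (T - reg f)"
    using expectation_exists by blast
  have e0: "coeff_at T 0 v = bop_apply (\<pi> e) v" for v using e[of 0] by (simp add: cstar_actionD(2)[OF \<alpha>])
  have form: "cinner w (coeff_at T h v) =
      cinner (bop_apply y (ell2_delta h w)) (bop_apply y (ell2_delta h v))" for h v w
    by (simp add: coeff_at_def T_def bop_apply_simps cinner_star_right flip: cinner_ell2_delta)
  have "star (\<pi> e) = \<pi> e"
  proof (rule bop_star_eqI[symmetric])
    fix v w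
    have "cinner (bop_apply (\<pi> e) v) w = cnj (cinner w (coeff_at T 0 v))"
      unfolding e0 by (rule cinner_commute)
    also have "\<dots> = cinner v (coeff_at T 0 w)" unfolding form by (rule cinner_commute[symmetric])
    finally show "cinner (bop_apply (\<pi> e) v) w = cinner v (bop_apply (\<pi> e) w)" unfolding e0 .
  qed
  then have "\<pi> (star e) = \<pi> e" by (simp add: \<pi>_hom)
  then have "star e = e" using rep_inj[OF \<pi>] by (simp add: inj_eq)
  moreover have "0 \<le> quad_form \<pi> e v" for v
    using form[of v 0 v] by (simp add: quad_form_def flip: e0) (simp add: cinner_self)
  ultimately obtain s where s: "star s = s" "s * s = e"
    using positive_form_has_sqrt[OF \<pi>] by blast
  have "s \<noteq> 0"
  proof
    assume "s = 0"
    then have "coeff_at T h v = 0" for h v using s by (simp add: e \<alpha>_hom \<pi>_hom bop_apply_simps)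
    then have "cinner (bop_apply y (ell2_delta h v)) (bop_apply y (ell2_delta h v)) = 0" for h v
      by (simp flip: form)
    then have yd: "bop_apply y (ell2_delta h v) = 0" for h v by (simp add: cinner_self)
    have "bop_apply (star y) \<xi> = 0" for \<xi>
    proof (rule ell2_eqI)
      fix h
      let ?v = "ell2_apply (bop_apply (star y) \<xi>) h"
      have "cinner ?v ?v = cinner (bop_apply y (ell2_delta h ?v)) \<xi>"
        by (simp add: cinner_star_right flip: cinner_ell2_delta)
      then have "?v = 0" by (simp add: yd cinner_self)
      then show "?v = ell2_apply 0 h" by (simp add: ell2_apply_simps)
    qed
    then have "star y = 0" by (intro bop_eqI) (simp add: bop_apply_simps)
    then show False using y(2) star_star[of y] by simp
  qed
  then show ?thesis using s approx by (auto simp: T_def)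
qed

end

section \<open>A criterion for pure infiniteness\<close>

text \<open>If every nonzero positive element dominates the unit, a nonzero ideal contains the unit. In a
  hereditary subalgebra pick a nonzero selfadjoint \<open>h\<close> and \<open>x\<close> with \<open>x\<^sup>* h\<^sup>2 x = q\<close>. Then \<open>v = h x\<close> is an
  isometry with \<open>v v\<^sup>* \<le> K h\<^sup>2\<close> for a constant \<open>K\<close>, so its range projection belongs to the subalgebra, and
  conjugation by \<open>v\<close> transports a proper isometry \<open>u\<close> below it.\<close>

lemma purely_infinite_simple_criterion:
  fixes M :: "'a::cstar_algebra set"
  assumes M: "cstar_subalgebra M" and q: "q \<in> M" "star q = q" "q \<noteq> 0"
    and unit: "\<And>x. x \<in> M \<Longrightarrow> q * x = x \<and> x * q = x"
    and dominates: "\<And>y. y \<in> M \<Longrightarrow> y \<noteq> 0 \<Longrightarrow> \<exists>x\<in>M. star x * (star y * y) * x = q"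
    and isometry: "u \<in> M" "star u * u = q" "u * star u \<noteq> q"
  shows "purely_infinite_simple M"
  unfolding purely_infinite_simple_def simple_cstar_def
proof (intro conjI allI impI)
  note D = cstar_subalgebraD[OF M]
  show "cstar_subalgebra M" by fact
  show "M \<noteq> {0}" using q by auto
  show "I = {0} \<or> I = M" if I: "closed_ideal I M" for I
  proof (cases "I = {0}")
    case False
    have ideal: "I \<subseteq> M" "\<And>x a. x \<in> I \<Longrightarrow> a \<in> M \<Longrightarrow> a * x \<in> I" "\<And>x a. x \<in> I \<Longrightarrow> a \<in> M \<Longrightarrow> x * a \<in> I"
      using I by (auto simp: closed_ideal_def)
    have "0 \<in> I" using I by (simp add: closed_ideal_def)
    with False obtain y where y: "y \<in> I" "y \<noteq> 0" by blast
    then have yM: "y \<in> M" using ideal(1) by blast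
    obtain x where x: "x \<in> M" "star x * (star y * y) * x = q" using dominates[OF yM y(2)] by blast
    have "q \<in> I" unfolding x(2)[symmetric] by (intro ideal y D x yM)
    then have "x \<in> I" if "x \<in> M" for x using ideal(2)[OF _ that, of q] unit[OF that] by simp
    then show ?thesis using ideal(1) by blast
  qed simp
  fix B assume B: "hereditary B M \<and> B \<noteq> {0}"
  then have BS: "cstar_subalgebra B" and BM: "B \<subseteq> M"
    and her: "\<And>a b. a \<in> M \<Longrightarrow> b \<in> B \<Longrightarrow> positive_in M a \<Longrightarrow> positive_in M (b - a) \<Longrightarrow> a \<in> B"
    by (auto simp: hereditary_def)
  obtain b where b: "b \<in> B" "b \<noteq> 0" using B cstar_subalgebraD(2)[OF BS] by blast
  define h where "h = star b * b"
  have h: "h \<in> B" "star h = h" "h \<noteq> 0" "h \<in> M"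
    using b star_mult_self_eq_0[of b] BM cstar_subalgebraD[OF BS] by (auto simp: h_def star_simps)
  obtain x where x: "x \<in> M" "star x * (star h * h) * x = q" using dominates[OF h(4,3)] by blast
  define v where "v = h * x"
  have v: "v \<in> M" "star v * v = q"
    using x h by (auto simp: v_def star_simps mult.assoc intro!: D)
  have vq: "v * q = v" using unit[OF v(1)] by simp
  define p where "p = v * star v"
  have p: "p \<in> M" "star p = p" "p * p = p"
  proof -
    show "p \<in> M" "star p = p" by (auto simp: p_def star_simps intro!: D v)
    have "p * p = v * (star v * v) * star v" by (simp add: p_def mult.assoc)
    then show "p * p = p" by (simp add: p_def v vq)
  qed
  have "p \<in> B"
  proof -
    \<comment> \<open>The difference \<open>K h\<^sup>2 - p\<close> equals \<open>h (K - x x\<^sup>*) h\<close>; it is exhibited as \<open>c\<^sup>* c\<close> by means of the root of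
      \<open>K - x x\<^sup>*\<close>.\<close>
    define K where "K = norm (x * star x) + 1"
    have K: "0 < K" by (simp add: K_def add_nonneg_pos)
    define e where "e = inverse K *\<^sub>R (x * star x)"
    have e: "e \<in> M" "star e = e" "norm e \<le> 1"
      using K by (auto simp: e_def star_simps K_def field_simps intro!: D x)
    define t where "t = sqrt_defect e"
    have t: "t \<in> M" "star t = t" "2 *\<^sub>R t = e + t * t"
      using sqrt_defect_in_subalgebra[OF M e(3,1)] sqrt_defect_selfadjoint[OF e(3,2)]
        sqrt_defect_eq[OF e(3)] by (simp_all add: t_def)
    have sq: "(q - t) * (q - t) = q - e"
      using unit[OF q(1)] unit[OF t(1)] t(3) by (simp add: algebra_simps scaleR_2)
    define c where "c = (q - t) * (sqrt K *\<^sub>R h)"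
    have "star c * c = K *\<^sub>R (h * ((q - t) * (q - t)) * h)"
      using K by (simp add: c_def star_simps q t h mult.assoc)
    also have "\<dots> = K *\<^sub>R (h * q * h) - K *\<^sub>R (h * e * h)"
      unfolding sq by (simp add: algebra_simps)
    also have "h * q = h" using unit[OF h(4)] by simp
    also have "K *\<^sub>R (h * e * h) = p"
      using K by (simp add: e_def p_def v_def star_simps h mult.assoc)
    finally have "K *\<^sub>R (h * h) - p = star c * c" by simp
    moreover have "c \<in> M" unfolding c_def by (intro D q t h)
    ultimately have "positive_in M (K *\<^sub>R (h * h) - p)" unfolding positive_in_def by blast
    moreover have "positive_in M p"
      unfolding positive_in_def using D(5)[OF v(1)] by (intro bexI[of _ "star v"]) (auto simp: p_def star_star)
    moreover have "K *\<^sub>R (h * h) \<in> B" by (intro cstar_subalgebraD[OF BS] h)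
    ultimately show ?thesis using her p(1) by blast
  qed
  moreover have "infinite_projection M p"
  proof -
    have uq: "u * q = u" using unit[OF isometry(1)] by simp
    have c1: "star v * (v * a) = q * a" for a using v(2) by (simp flip: mult.assoc)
    have c2: "star u * (u * a) = q * a" for a using isometry(2) by (simp flip: mult.assoc)
    have qa: "q * (star v) = star v" "q * u = u" "q * (u * a) = u * a" "q * (star u * a) = star u * a"
      "v * (q * a) = v * a" "u * (q * a) = u * a" for a
      using unit[OF D(5)[OF v(1)]] unit[OF isometry(1)] unit[OF D(5)[OF isometry(1)]] vq uq
      by (simp_all flip: mult.assoc)
    let ?r = "v * u * star u * star v"
    have "projection p" using p by (simp add: projection_def)
    moreover have "?r \<in> M" "v * u * star v \<in> M" by (intro D v isometry)+
    moreover have "projection ?r"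
      by (simp add: projection_def star_simps mult.assoc c1 c2 qa)
    moreover have "p * ?r = ?r"
      by (simp add: p_def mult.assoc c1 c2 qa)
    moreover have "star (v * u * star v) * (v * u * star v) = p" "v * u * star v * star (v * u * star v) = ?r"
      by (simp_all add: p_def star_simps mult.assoc c1 c2 qa)
    moreover have "?r \<noteq> p"
    proof
      assume "?r = p"
      then have "star v * ?r * v = star v * p * v" by simp
      then have "q * (u * star u) * q = q * q"
        by (simp add: p_def mult.assoc c1 v)
      then have "u * star u = q"
        using unit[OF D(4)[OF isometry(1) D(5)[OF isometry(1)]]] unit[OF q(1)] by simp
      then show False using isometry by simp
    qed
    ultimately show ?thesis using p(1) unfolding infinite_projection_def by blast
  qed
  ultimately show "\<exists>p\<in>B. infinite_projection M p" by blast
qed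

section \<open>Compact spaces and their group actions\<close>

lemma apply_Bcontfun_compact:
  fixes F :: "'x::topological_space \<Rightarrow> 'd::real_normed_vector"
  assumes "compact (UNIV :: 'x set)" "continuous_on UNIV F"
  shows "apply_bcontfun (Bcontfun F) = F"
  using compact_imp_bounded[OF compact_continuous_image[OF assms(2,1)]] assms(2)
  by (intro Bcontfun_inverse) (simp add: bcontfun_def)

lemma compact_bump_function:
  fixes U :: "'x::t2_space set"
  assumes "compact (UNIV :: 'x set)" "open U" "x0 \<in> U"
  shows "\<exists>\<phi> :: 'x \<Rightarrow> real. continuous_on UNIV \<phi> \<and> (\<forall>x. 0 \<le> \<phi> x \<and> \<phi> x \<le> 1) \<and> \<phi> x0 = 1 \<and> (\<forall>x. x \<notin> U \<longrightarrow> \<phi> x = 0)"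
proof -
  have "compact_space (euclidean :: 'x topology)" using assms(1) by (simp add: compact_space_def)
  moreover have "Hausdorff_space (euclidean :: 'x topology)"
    unfolding Hausdorff_space_def disjnt_def by (simp, metis hausdorff)
  ultimately have "normal_space (euclidean :: 'x topology)"
    by (intro compact_Hausdorff_or_regular_imp_normal_space disjI1)
  moreover have "closedin euclidean (- U)" "closedin euclidean {x0}" using assms by auto
  moreover have "disjnt (- U) {x0}" using assms by (simp add: disjnt_def)
  ultimately obtain \<phi> where "continuous_map euclidean (top_of_set {0..1::real}) \<phi>" "\<phi> ` (- U) \<subseteq> {0}" "\<phi> ` {x0} \<subseteq> {1}"
    using Urysohn_lemma[of "euclidean :: 'x topology" "- U" "{x0}" 0 1] by auto
  then show ?thesis
    by (intro exI[of _ \<phi>]) (auto simp: continuous_map_in_subtopology)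
qed

text \<open>The points whose whole orbit avoids \<open>W\<close> form a closed invariant proper subset, which is empty by
  minimality.\<close>

lemma minimal_finite_cover:
  fixes act :: "'g::group_add \<Rightarrow> 'x::topological_space \<Rightarrow> 'x"
  assumes "compact (UNIV :: 'x set)" "top_action act" "minimal_action act" "open W" "W \<noteq> {}"
  shows "\<exists>K. finite K \<and> (\<forall>x. \<exists>g\<in>K. act (- g) x \<in> W)"
proof -
  have cont: "continuous_on UNIV (act g)" and add: "act (g + h) x = act g (act h x)" and z: "act 0 x = x" for g h x
    using assms(2) by (auto simp: top_action_def)
  have op: "open (act g -` W)" for g using open_vimage[OF assms(4) cont] .
  define T where "T = {x. \<forall>g. act g x \<notin> W}"
  have "T = (\<Inter>g. - (act g -` W))" by (auto simp: T_def)
  then have "closed T" using op by (auto intro!: closed_INT simp: closed_Compl)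
  moreover have "act g ` T \<subseteq> T" for g by (auto simp: T_def simp flip: add)
  moreover have "T \<noteq> UNIV" using assms(5) z by (auto simp: T_def) (metis UNIV_I mem_Collect_eq)
  ultimately have "T = {}" using assms(3) unfolding minimal_action_def by blast
  then have "UNIV \<subseteq> (\<Union>g. act (- g) -` W)" by (auto simp: T_def) (metis minus_minus mem_Collect_eq empty_iff)
  then obtain K where "finite K" "UNIV \<subseteq> (\<Union>g\<in>K. act (- g) -` W)"
    using compactE_image[OF assms(1), of UNIV "\<lambda>g. act (- g) -` W"] op by auto
  then show ?thesis by (intro exI[of _ K]) blast
qed

lemma free_neighbourhood:
  fixes act :: "'g::group_add \<Rightarrow> 'x::t2_space \<Rightarrow> 'x"
  assumes "top_action act" "finite S" "open V" "x0 \<in> V" "\<And>g. g \<in> S \<Longrightarrow> act g x0 \<noteq> x0"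
  shows "\<exists>U. open U \<and> x0 \<in> U \<and> U \<subseteq> V \<and> (\<forall>g\<in>S. \<forall>x\<in>U. act (- g) x \<notin> U)"
proof -
  have cont: "continuous_on UNIV (act g)" and add: "act (g + h) x = act g (act h x)" and z: "act 0 x = x" for g h x
    using assms(1) by (auto simp: top_action_def)
  have "\<exists>U. open U \<and> x0 \<in> U \<and> (\<forall>x\<in>U. act (- g) x \<notin> U)" if "g \<in> S" for g
  proof -
    have "act (- g) x0 \<noteq> x0"
    proof
      assume "act (- g) x0 = x0"
      then have "act g x0 = act (g + - g) x0" by (simp only: add)
      then show False using assms(5)[OF that] z by simp
    qed
    then obtain A B where AB: "open A" "open B" "x0 \<in> A" "act (- g) x0 \<in> B" "A \<inter> B = {}"
      using hausdorff[of x0 "act (- g) x0"] by metis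
    have "open (A \<inter> act (- g) -` B)" using AB open_vimage[OF AB(2) cont] by blast
    then show ?thesis using AB by (intro exI[of _ "A \<inter> act (- g) -` B"]) auto
  qed
  then obtain U where U: "\<And>g. g \<in> S \<Longrightarrow> open (U g)" "\<And>g. g \<in> S \<Longrightarrow> x0 \<in> U g"
    "\<And>g x. g \<in> S \<Longrightarrow> x \<in> U g \<Longrightarrow> act (- g) x \<notin> U g" by metis
  have "open (V \<inter> (\<Inter>g\<in>S. U g))" using assms U by (intro open_Int open_INT) auto
  then show ?thesis using U assms by (intro exI[of _ "V \<inter> (\<Inter>g\<in>S. U g)"]) blast
qed

text \<open>This gives access to the quadratic forms for \<open>D\<close>, which comes without a representation of its own.\<close>

lemma const_bcontfun_rep:
  fixes \<pi> :: "('x::topological_space \<Rightarrow>\<^sub>C 'd::cstar_algebra) \<Rightarrow> 'h::chilbert_space bop"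
  assumes "faithful_representation \<pi>"
  shows "faithful_representation (\<lambda>d. \<pi> (const_bcontfun d))"
proof -
  have h: "star_hom \<pi>" and i: "inj \<pi>" using assms by (auto simp: faithful_representation_def)
  have "inj (\<lambda>d. \<pi> (const_bcontfun d))"
  proof (rule injI)
    fix a b assume "\<pi> (const_bcontfun a) = \<pi> (const_bcontfun b)"
    then have "const_bcontfun a = (const_bcontfun b :: 'x \<Rightarrow>\<^sub>C 'd)" using i by (simp add: inj_eq)
    then have "apply_bcontfun (const_bcontfun a :: 'x \<Rightarrow>\<^sub>C 'd) undefined = apply_bcontfun (const_bcontfun b) undefined" by simp
    then show "a = b" by simp
  qed
  moreover have "star_hom (\<lambda>d. const_bcontfun d :: 'x \<Rightarrow>\<^sub>C 'd)"
    unfolding star_hom_def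
    by (auto intro!: bcontfun_eqI simp: times_bcontfun.rep_eq star_bcontfun.rep_eq scaleC_bcontfun.rep_eq plus_bcontfun.rep_eq)
  ultimately show ?thesis using h by (simp add: faithful_representation_def star_hom_def)
qed

section \<open>Crossed products by essentially free minimal actions\<close>

context
  fixes act :: "'g::group_add \<Rightarrow> 'x::t2_space \<Rightarrow> 'x"
    and \<alpha> :: "'g \<Rightarrow> ('x \<Rightarrow>\<^sub>C 'd::{cstar_algebra, real_normed_algebra_1}) \<Rightarrow> ('x \<Rightarrow>\<^sub>C 'd)"
    and \<pi> :: "('x \<Rightarrow>\<^sub>C 'd) \<Rightarrow> 'h::chilbert_space bop"
  assumes compact: "compact (UNIV :: 'x set)"
    and top: "top_action act"
    and minimal: "minimal_action act"
    and free: "\<And>S. finite S \<Longrightarrow> S \<subseteq> - {0} \<Longrightarrow> closure {x. \<forall>g\<in>S. act g x \<noteq> x} = UNIV"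
    and pis: "purely_infinite_simple (UNIV :: 'd set)"
    and action: "cstar_action \<alpha>"
    and over: "lies_over \<alpha> act"
    and faithful: "faithful_representation \<pi>"
begin

abbreviation (input) "mon \<equiv> monomial \<pi> \<alpha>"

lemmas apply_Bcontfun = apply_Bcontfun_compact[OF compact]
lemmas CP_closed = cstar_subalgebraD[OF CP_subalgebra[OF faithful action]]
lemmas mon_mult = monomial_mult[OF faithful action]
lemmas mon_star = star_monomial[OF faithful action]
lemmas mon_in_CP = monomial_in_CP[OF faithful action]
lemmas coeff_hom = star_homD[OF coefficient_hom[OF faithful action]]
lemmas bcontfun_reps = times_bcontfun.rep_eq star_bcontfun.rep_eq scaleC_bcontfun.rep_eq
  plus_bcontfun.rep_eq minus_bcontfun.rep_eq one_bcontfun.rep_eq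

lemma act_continuous: "continuous_on UNIV (act g)"
  using top by (auto simp: top_action_def)

definition scalar :: "('x \<Rightarrow> real) \<Rightarrow> 'x \<Rightarrow>\<^sub>C 'd" where
  "scalar \<gamma> = Bcontfun (\<lambda>x. \<gamma> x *\<^sub>R 1)"

lemma scalar_apply: "continuous_on UNIV \<gamma> \<Longrightarrow> apply_bcontfun (scalar \<gamma>) x = \<gamma> x *\<^sub>R 1"
  unfolding scalar_def by (subst apply_Bcontfun) (auto intro!: continuous_intros)

lemma star_scalar: "continuous_on UNIV \<gamma> \<Longrightarrow> star (scalar \<gamma>) = scalar \<gamma>"
  by (rule bcontfun_eqI) (simp add: bcontfun_reps scalar_apply star_scaleR star_one)

lemma action_local:
  "\<exists>\<beta>. (\<forall>g x. star_aut (\<beta> g x)) \<and>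
     (\<forall>g a x. apply_bcontfun (\<alpha> g a) x = \<beta> g x (apply_bcontfun a (act (- g) x)))"
  using over unfolding lies_over_def by blast

lemma action_scalar:
  assumes "continuous_on UNIV \<gamma>"
  shows "apply_bcontfun (\<alpha> g (scalar \<gamma>)) x = \<gamma> (act (- g) x) *\<^sub>R 1"
proof -
  obtain \<beta> where \<beta>: "\<And>g x. star_aut (\<beta> g x)"
    "\<And>g a x. apply_bcontfun (\<alpha> g a) x = \<beta> g x (apply_bcontfun a (act (- g) x))"
    using action_local by blast
  have "star_hom (\<beta> g x)" using \<beta>(1) by (simp add: star_aut_def)
  then show ?thesis by (simp add: \<beta>(2) scalar_apply assms star_homD star_aut_one[OF \<beta>(1)])
qed

text \<open>The element is \<open>Y = \<Sum> t\<^sub>g u\<^sub>g\<^sup>* \<eta>\<^sub>g\<close>, with constant isometries \<open>t\<^sub>g\<close> of orthogonal ranges. Scalar functions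
  commute with constants, so in \<open>Y\<^sup>* \<gamma> Y\<close> the relations \<open>t\<^sub>i\<^sup>* t\<^sub>j = \<delta>\<^sub>i\<^sub>j\<close> remove all mixed terms and leave a sum of
  translates of \<open>\<gamma>\<close>. By the case
  \<open>\<gamma> = 1\<close>, \<open>Y\<close> is an isometry when the squares of the \<open>\<eta>\<^sub>g\<close> add up to \<open>1\<close>.\<close>

lemma averaging_isometry:
  fixes \<eta> :: "'g \<Rightarrow> 'x \<Rightarrow> real"
  assumes K: "finite K" and \<eta>: "\<And>g. continuous_on UNIV (\<eta> g)"
  shows "\<exists>Y\<in>CP \<pi> \<alpha>. \<forall>\<gamma>. continuous_on UNIV \<gamma> \<longrightarrow>
    star Y * mon (scalar \<gamma>) 0 * Y = mon (scalar (\<lambda>x. \<Sum>g\<in>K. (\<eta> g x)\<^sup>2 * \<gamma> (act (- g) x))) 0"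
proof -
  obtain t' :: "nat \<Rightarrow> 'd" where t': "\<And>i j. star (t' i) * t' j = (if i = j then 1 else 0)"
    using purely_infinite_orthogonal_isometries[OF const_bcontfun_rep[OF faithful] pis] by blast
  obtain idx :: "'g \<Rightarrow> nat" where idx: "inj_on idx K" using finite_imp_inj_to_nat_seg[OF K] by blast
  define t :: "'g \<Rightarrow> 'x \<Rightarrow>\<^sub>C 'd" where "t g = const_bcontfun (t' (idx g))" for g
  define h where "h g = scalar (\<eta> g)" for g
  define Z where "Z g = mon (t g) 0 * mon 1 (- g) * mon (h g) 0" for g
  define Y where "Y = (\<Sum>g\<in>K. Z g)"
  have YM: "Y \<in> CP \<pi> \<alpha>" unfolding Y_def Z_def
    by (intro cstar_subalgebra_sum[OF CP_subalgebra[OF faithful action]] CP_closed mon_in_CP)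
  have main: "star Y * mon (scalar \<gamma>) 0 * Y = mon (scalar (\<lambda>x. \<Sum>g\<in>K. (\<eta> g x)\<^sup>2 * \<gamma> (act (- g) x))) 0"
    if \<gamma>: "continuous_on UNIV \<gamma>" for \<gamma>
  proof -
    have middle: "star (t i) * scalar \<gamma> * t j = (if i = j then scalar \<gamma> else 0)" if "i \<in> K" "j \<in> K" for i j
      using idx that by (intro bcontfun_eqI) (auto simp: bcontfun_reps t_def scalar_apply[OF \<gamma>] t' inj_on_eq_iff)
    have ij: "star (Z i) * mon (scalar \<gamma>) 0 * Z j = (if i = j then mon (h i * \<alpha> i (scalar \<gamma>) * h i) 0 else 0)"
      if K: "i \<in> K" "j \<in> K" for i j
    proof -
      have "star (Z i) = mon (h i) 0 * mon 1 i * mon (star (t i)) 0"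
        by (simp add: Z_def star_mult mon_star h_def star_scalar[OF \<eta>] star_one cstar_actionD(2)[OF action]
            \<alpha>_one[OF faithful action] mult.assoc)
      then have "star (Z i) * mon (scalar \<gamma>) 0 * Z j
          = mon (h i) 0 * mon 1 i * mon (star (t i) * scalar \<gamma> * t j) 0 * mon 1 (- j) * mon (h j) 0"
        by (simp add: Z_def coeff_hom mult.assoc)
      also have "\<dots> = (if i = j then mon (h i * \<alpha> i (scalar \<gamma>) * h i) 0 else 0)"
        unfolding middle[OF K]
        by (simp add: coeff_hom) (simp add: mon_mult \<alpha>_one[OF faithful action] cstar_actionD(2)[OF action])
      finally show ?thesis .
    qed
    have "star Y * mon (scalar \<gamma>) 0 * Y = (\<Sum>i\<in>K. \<Sum>j\<in>K. star (Z i) * mon (scalar \<gamma>) 0 * Z j)"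
      unfolding Y_def star_sum sum_distrib_right by (simp add: sum_distrib_left)
    also have "\<dots> = (\<Sum>i\<in>K. mon (h i * \<alpha> i (scalar \<gamma>) * h i) 0)"
      using K by (intro sum.cong refl) (simp add: ij sum.delta cong: sum.cong_simp)
    also have "\<dots> = mon (\<Sum>i\<in>K. h i * \<alpha> i (scalar \<gamma>) * h i) 0"
      by (simp add: star_hom_sum[OF coefficient_hom[OF faithful action]])
    also have "(\<Sum>i\<in>K. h i * \<alpha> i (scalar \<gamma>) * h i) = scalar (\<lambda>x. \<Sum>g\<in>K. (\<eta> g x)\<^sup>2 * \<gamma> (act (- g) x))"
    proof (rule bcontfun_eqI)
      fix x
      have c: "continuous_on UNIV (\<lambda>x. \<Sum>g\<in>K. (\<eta> g x)\<^sup>2 * \<gamma> (act (- g) x))"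
        by (intro continuous_intros \<eta> continuous_on_compose2[OF \<gamma> act_continuous]) auto
      have s: "apply_bcontfun (sum F K) x = (\<Sum>i\<in>K. apply_bcontfun (F i) x)" for F :: "'g \<Rightarrow> 'x \<Rightarrow>\<^sub>C 'd"
        by (induction K rule: infinite_finite_induct) simp_all
      show "apply_bcontfun (\<Sum>i\<in>K. h i * \<alpha> i (scalar \<gamma>) * h i) x =
          apply_bcontfun (scalar (\<lambda>x. \<Sum>g\<in>K. (\<eta> g x)\<^sup>2 * \<gamma> (act (- g) x))) x"
        unfolding scalar_apply[OF c]
        by (simp add: s bcontfun_reps h_def scalar_apply[OF \<eta>] action_scalar[OF \<gamma>]
            scaleR_sum_left power2_eq_square mult_ac)
    qed
    finally show ?thesis .
  qed
  show ?thesis using YM main by blast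
qed

text \<open>Compression by \<open>w = F z\<close>, with \<open>F\<close> a bump function supported in \<open>U\<close> and \<open>z\<close> constant. For \<open>g \<noteq> 0\<close> in the
  support of the approximant \<open>b\<close> the term at \<open>x\<close> contains the factor \<open>F(x) F(g\<^sup>-\<^sup>1 x) = 0\<close>, and the
  remaining term is \<open>F(x)\<^sup>2 z\<^sup>* f(0)(x) z\<close>, close to \<open>F(x)\<^sup>2\<close> because \<open>f(0)\<close> is close to the expectation of \<open>y\<^sup>* y\<close>. The
  total error is \<open>1/4\<close> from replacing \<open>y\<^sup>* y\<close> by \<open>b\<close>, \<open>1/4\<close> from replacing \<open>f(0)\<close> by the expectation and \<open>1/4\<close>
  from its variation over \<open>V\<close>.\<close>

lemma compression_into_scalars:
  assumes y: "y \<in> CP \<pi> \<alpha>" "y \<noteq> 0"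
  shows "\<exists>w\<in>CP \<pi> \<alpha>. \<exists>F W. continuous_on UNIV F \<and> open W \<and> W \<noteq> {} \<and> (\<forall>x\<in>W. F x = 1) \<and>
    norm (star w * (star y * y) * w - mon (scalar F) 0) \<le> 3/4"
proof -
  obtain s where s: "s \<noteq> 0" "star s = s"
    and approx: "\<And>f. finite {g. f g \<noteq> 0} \<Longrightarrow>
      norm (s * s - f 0) \<le> norm (star y * y - regular_representation \<pi> \<alpha> f)"
    using expectation_of_square[OF faithful action y] by blast
  define e where "e = s * s"
  obtain x1 where x1: "apply_bcontfun s x1 \<noteq> 0" using s(1) bcontfun_eqI[of s 0] by auto
  obtain z where z: "star z * (star (apply_bcontfun s x1) * apply_bcontfun s x1) * z = 1"
    using purely_infinite_positive_dominates_unit[OF const_bcontfun_rep[OF faithful] pis x1] by blast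
  have sx: "star (apply_bcontfun s x) = apply_bcontfun s x" for x
    using s(2) by (metis star_bcontfun.rep_eq)
  have ex1: "star z * apply_bcontfun e x1 * z = 1" using z by (simp add: e_def bcontfun_reps sx)
  define V where "V = {x. norm (star z * apply_bcontfun e x * z - 1) < 1/4}"
  have "continuous_on UNIV (apply_bcontfun e)" using apply_bcontfun[of e] by (simp add: bcontfun_def)
  then have "open V" unfolding V_def by (intro open_Collect_less continuous_intros)
  have "x1 \<in> V" by (simp add: V_def ex1)
  \<comment> \<open>The constant \<open>z\<close> is already fixed, so the approximation of \<open>y\<^sup>* y\<close> can be chosen fine enough to survive
    compression by \<open>z\<close>; the set of group elements to be avoided is determined only afterwards.\<close>
  define \<delta> where "\<delta> = 1 / (4 * ((norm z)\<^sup>2 + 1))"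
  have "0 < (norm z)\<^sup>2 + 1" by (simp add: add_nonneg_pos)
  then have \<delta>: "\<delta> > 0" "(norm z)\<^sup>2 * \<delta> \<le> 1/4"
    by (auto simp: \<delta>_def field_simps)
  have "star y * y \<in> closure (regular_representation \<pi> \<alpha> ` {f. finite {g. f g \<noteq> 0}})"
    using y unfolding reduced_crossed_product_def[symmetric] by (intro CP_closed)
  then obtain f where f: "finite {g. f g \<noteq> 0}" and fy: "norm (star y * y - regular_representation \<pi> \<alpha> f) < \<delta>"
    using \<delta>(1) unfolding closure_approachable by (auto simp: dist_norm norm_minus_commute)
  define b where "b = regular_representation \<pi> \<alpha> f"
  define S where "S = {g. f g \<noteq> 0} - {0}"
  have S: "finite S" "S \<subseteq> - {0}" using f by (auto simp: S_def)
  have "V \<inter> closure {x. \<forall>g\<in>S. act g x \<noteq> x} \<noteq> {}" using free[OF S] \<open>x1 \<in> V\<close> by auto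
  then have "V \<inter> {x. \<forall>g\<in>S. act g x \<noteq> x} \<noteq> {}"
    unfolding open_Int_closure_eq_empty[OF \<open>open V\<close>] .
  then obtain x0 where x0: "x0 \<in> V" "\<And>g. g \<in> S \<Longrightarrow> act g x0 \<noteq> x0" by blast
  obtain U where U: "open U" "x0 \<in> U" "U \<subseteq> V" "\<And>g x. g \<in> S \<Longrightarrow> x \<in> U \<Longrightarrow> act (- g) x \<notin> U"
    using free_neighbourhood[OF top S(1) \<open>open V\<close> x0] by blast
  obtain \<phi> :: "'x \<Rightarrow> real" where \<phi>: "continuous_on UNIV \<phi>" "\<And>x. 0 \<le> \<phi> x" "\<phi> x0 = 1" "\<And>x. x \<notin> U \<Longrightarrow> \<phi> x = 0"
    using compact_bump_function[OF compact U(1,2)] by metis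
  \<comment> \<open>Truncation makes \<open>F\<close> equal to \<open>1\<close> on a whole neighbourhood \<open>W\<close> of \<open>x0\<close>, as translates of \<open>W\<close> are to cover the space.\<close>
  define F where "F x = min 1 (2 * \<phi> x)" for x
  have F: "continuous_on UNIV F" "0 \<le> F x" "F x \<le> 1" "x \<notin> U \<Longrightarrow> F x = 0" for x
    unfolding F_def by (intro continuous_intros \<phi>) (use \<phi> in auto)
  define W where "W = {x. 1/2 < \<phi> x}"
  have W: "open W" "x0 \<in> W" "\<And>x. x \<in> W \<Longrightarrow> F x = 1"
    unfolding W_def by (intro open_Collect_less continuous_intros \<phi>) (auto simp: \<phi> F_def)
  define w where "w = Bcontfun (\<lambda>x. F x *\<^sub>R z)"
  have w: "apply_bcontfun w x = F x *\<^sub>R z" for x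
    unfolding w_def by (subst apply_Bcontfun) (auto intro!: continuous_intros F)
  have "norm w \<le> norm z"
    by (rule norm_bound) (use F mult_right_mono[of "F _" 1 "norm z"] in \<open>auto simp: w\<close>)
  define \<omega> where "\<omega> = mon w 0"
  have n\<omega>: "norm \<omega> \<le> norm z"
    using norm_coefficient_le[OF faithful action, of w] \<open>norm w \<le> norm z\<close> by (simp add: \<omega>_def)
  have s\<omega>: "star \<omega> = mon (star w) 0" by (simp add: \<omega>_def flip: coeff_hom)
  have compress: "star \<omega> * b * \<omega> = mon (star w * f 0 * w) 0"
  proof -
    obtain \<beta> where \<beta>: "\<And>g x. star_aut (\<beta> g x)"
      "\<And>g a x. apply_bcontfun (\<alpha> g a) x = \<beta> g x (apply_bcontfun a (act (- g) x))"
      using action_local by blast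
    have hom: "star_hom (\<beta> g x)" for g x using \<beta>(1) by (simp add: star_aut_def)
    have off: "star w * f g * \<alpha> g w = 0" if "g \<in> S" for g
    proof (rule bcontfun_eqI)
      fix x
      have "F x = 0 \<or> F (act (- g) x) = 0" using U(4)[OF that] F(4) by blast
      then show "apply_bcontfun (star w * f g * \<alpha> g w) x = apply_bcontfun 0 x"
        by (auto simp: bcontfun_reps \<beta>(2) w star_homD[OF hom])
    qed
    have "b = (\<Sum>g\<in>insert 0 S. mon (f g) g)"
      unfolding b_def by (rule reg_eq_sum[OF faithful action]) (use S in \<open>auto simp: S_def\<close>)
    then have "star \<omega> * b * \<omega> = (\<Sum>g\<in>insert 0 S. star \<omega> * mon (f g) g * \<omega>)"
      by (simp only: sum_distrib_left sum_distrib_right)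
    also have "\<dots> = (\<Sum>g\<in>insert 0 S. mon (star w * f g * \<alpha> g w) g)"
      unfolding s\<omega> unfolding \<omega>_def by (simp add: mon_mult cstar_actionD(2)[OF action])
    also have "\<dots> = mon (star w * f 0 * w) 0"
      using S off by (auto simp: monomial_zero[OF faithful action] cstar_actionD(2)[OF action] intro!: sum.neutral)
    finally show ?thesis .
  qed
  have near: "norm (star w * f 0 * w - scalar (\<lambda>x. F x * F x)) \<le> 1/2"
  proof (rule norm_bound)
    fix x
    let ?d = "star z * apply_bcontfun (f 0) x * z - 1"
    have "continuous_on UNIV (\<lambda>x. F x * F x)" by (intro continuous_intros F)
    then have eq: "apply_bcontfun (star w * f 0 * w - scalar (\<lambda>x. F x * F x)) x = (F x * F x) *\<^sub>R ?d"
      by (simp add: bcontfun_reps scalar_apply w star_scaleR algebra_simps)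
    show "norm (apply_bcontfun (star w * f 0 * w - scalar (\<lambda>x. F x * F x)) x) \<le> 1/2"
    proof (cases "x \<in> U")
      case True
      have "norm (e - f 0) \<le> \<delta>" using approx[OF f] fy by (simp add: e_def)
      then have "norm (apply_bcontfun (e - f 0) x) \<le> \<delta>" using norm_bounded order_trans by blast
      then have ef: "norm (apply_bcontfun e x - apply_bcontfun (f 0) x) \<le> \<delta>" by (simp add: bcontfun_reps)
      have "?d = (star z * apply_bcontfun e x * z - 1) - star z * (apply_bcontfun e x - apply_bcontfun (f 0) x) * z"
        by (simp add: algebra_simps)
      then have "norm ?d \<le> norm (star z * apply_bcontfun e x * z - 1)
          + norm (star z * (apply_bcontfun e x - apply_bcontfun (f 0) x) * z)"
        by (simp only: norm_triangle_ineq4)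
      also have "\<dots> \<le> 1/4 + norm z * \<delta> * norm z"
      proof (rule add_mono)
        show "norm (star z * apply_bcontfun e x * z - 1) \<le> 1/4" using True U(3) by (auto simp: V_def)
        show "norm (star z * (apply_bcontfun e x - apply_bcontfun (f 0) x) * z) \<le> norm z * \<delta> * norm z"
          by (intro order_trans[OF norm_mult_ineq] mult_right_mono norm_ge_zero)
             (intro order_trans[OF norm_mult_ineq] mult_mono ef, simp_all add: norm_star)
      qed
      also have "\<dots> \<le> 1/2" using \<delta>(2) by (simp add: power2_eq_square mult_ac)
      finally have d: "norm ?d \<le> 1/2" .
      have "F x * F x \<le> 1" using F(2,3)[of x] by (simp add: mult_le_one)
      then have "(F x * F x) * norm ?d \<le> 1 * (1/2)" by (intro mult_mono d) auto
      then show ?thesis using F(2)[of x] unfolding eq by simp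
    next
      case False
      then show ?thesis unfolding eq by (simp add: F)
    qed
  qed
  have "star \<omega> * (star y * y) * \<omega> - mon (scalar (\<lambda>x. F x * F x)) 0 =
      star \<omega> * (star y * y - b) * \<omega> + mon (star w * f 0 * w - scalar (\<lambda>x. F x * F x)) 0"
    by (simp add: coeff_hom(7) flip: compress) (simp add: algebra_simps)
  then have "norm (star \<omega> * (star y * y) * \<omega> - mon (scalar (\<lambda>x. F x * F x)) 0) \<le>
      norm (star \<omega> * (star y * y - b) * \<omega>) + norm (mon (star w * f 0 * w - scalar (\<lambda>x. F x * F x)) 0)"
    by (simp only: norm_triangle_ineq)
  also have "\<dots> \<le> norm z * \<delta> * norm z + 1/2"
  proof (rule add_mono)
    show "norm (star \<omega> * (star y * y - b) * \<omega>) \<le> norm z * \<delta> * norm z"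
      using fy n\<omega>
      by (intro order_trans[OF norm_mult_ineq] mult_mono)
         (auto intro!: order_trans[OF norm_mult_ineq] mult_mono simp: norm_star b_def \<delta>(1) less_imp_le)
    show "norm (mon (star w * f 0 * w - scalar (\<lambda>x. F x * F x)) 0) \<le> 1/2"
      by (rule order_trans[OF norm_coefficient_le[OF faithful action] near])
  qed
  also have "\<dots> \<le> 3/4" using \<delta>(2) by (simp add: power2_eq_square mult_ac)
  finally have n: "norm (star \<omega> * (star y * y) * \<omega> - mon (scalar (\<lambda>x. F x * F x)) 0) \<le> 3/4" .
  have c: "continuous_on UNIV (\<lambda>x. F x * F x)" by (intro continuous_intros F)
  show ?thesis
    unfolding \<omega>_def[symmetric]
  proof (intro bexI[of _ \<omega>] exI conjI ballI)
    show "norm (star \<omega> * (star y * y) * \<omega> - mon (scalar (\<lambda>x. F x * F x)) 0) \<le> 3/4" by fact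
    show "W \<noteq> {}" using W by blast
    show "\<omega> \<in> CP \<pi> \<alpha>" unfolding \<omega>_def by (rule mon_in_CP)
  qed (use W c in auto)
qed

text \<open>The compression \<open>m\<close> is within \<open>3/4\<close> of a scalar function \<open>F\<close> equal to \<open>1\<close> on an open set \<open>W\<close>. Translates
  of a bump function \<open>\<phi>\<close> supported in \<open>W\<close>, normalized by the sum of their squares, form a quadratic
  partition of unity \<open>\<eta>\<^sub>g\<close> subordinate to translates of \<open>W\<close>. For the isometry \<open>Y\<close> built from it
  \<open>Y\<^sup>* F Y\<close> is the unit, and \<open>Y\<^sup>* m Y\<close> is still within \<open>3/4\<close> of it.\<close>

lemma crossed_product_dominates_unit:
  assumes y: "y \<in> CP \<pi> \<alpha>" "y \<noteq> 0"
  shows "\<exists>x\<in>CP \<pi> \<alpha>. star x * (star y * y) * x = mon 1 0"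
proof -
  obtain w F W where w: "w \<in> CP \<pi> \<alpha>" and F: "continuous_on UNIV F" and W: "open W" "W \<noteq> {}" "\<And>x. x \<in> W \<Longrightarrow> F x = 1"
    and near: "norm (star w * (star y * y) * w - mon (scalar F) 0) \<le> 3/4"
    using compression_into_scalars[OF y] by blast
  obtain x0 where "x0 \<in> W" using W by blast
  obtain \<phi> :: "'x \<Rightarrow> real" where \<phi>: "continuous_on UNIV \<phi>" "\<And>x. 0 \<le> \<phi> x" "\<phi> x0 = 1" "\<And>x. x \<notin> W \<Longrightarrow> \<phi> x = 0"
    using compact_bump_function[OF compact W(1) \<open>x0 \<in> W\<close>] by metis
  have "open {x. 0 < \<phi> x}" by (intro open_Collect_less continuous_intros \<phi>)
  moreover have "x0 \<in> {x. 0 < \<phi> x}" by (simp add: \<phi>(3))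
  ultimately obtain K where K: "finite K" "\<And>x. \<exists>g\<in>K. 0 < \<phi> (act (- g) x)"
    using minimal_finite_cover[OF compact top minimal, of "{x. 0 < \<phi> x}"] by auto
  define \<sigma> where "\<sigma> x = (\<Sum>g\<in>K. (\<phi> (act (- g) x))\<^sup>2)" for x
  have \<phi>c: "continuous_on UNIV (\<lambda>x. \<phi> (act (- g) x))" for g
    by (rule continuous_on_compose2[OF \<phi>(1) act_continuous]) auto
  have \<sigma>c: "continuous_on UNIV \<sigma>" unfolding \<sigma>_def by (intro continuous_intros \<phi>c)
  have \<sigma>: "0 < \<sigma> x" for x
  proof -
    obtain g where g: "g \<in> K" "0 < \<phi> (act (- g) x)" using K(2) by blast
    then show ?thesis unfolding \<sigma>_def by (intro sum_pos2[OF K(1) g(1)]) auto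
  qed
  define \<eta> where "\<eta> g x = \<phi> (act (- g) x) / sqrt (\<sigma> x)" for g x
  have \<eta>: "continuous_on UNIV (\<eta> g)" for g
    unfolding \<eta>_def by (intro continuous_intros \<phi>c \<sigma>c) (use \<sigma> in \<open>auto simp: less_imp_neq[symmetric]\<close>)
  have \<eta>_sum: "(\<Sum>g\<in>K. (\<eta> g x)\<^sup>2) = 1" for x
  proof -
    have "(\<Sum>g\<in>K. (\<eta> g x)\<^sup>2) = \<sigma> x / \<sigma> x"
      using \<sigma>[of x] by (simp add: \<eta>_def power_divide \<sigma>_def[of x] flip: sum_divide_distrib)
    then show ?thesis using \<sigma>[of x] by simp
  qed
  obtain Y where Y: "Y \<in> CP \<pi> \<alpha>" and YY: "\<forall>\<gamma>. continuous_on UNIV \<gamma> \<longrightarrow>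
      star Y * mon (scalar \<gamma>) 0 * Y = mon (scalar (\<lambda>x. \<Sum>g\<in>K. (\<eta> g x)\<^sup>2 * \<gamma> (act (- g) x))) 0"
    by (rule bexE[OF averaging_isometry[OF K(1) \<eta>]])
  have one: "scalar (\<lambda>x. 1) = 1" by (rule bcontfun_eqI) (simp add: scalar_apply bcontfun_reps)
  have unit: "\<And>x. x \<in> CP \<pi> \<alpha> \<Longrightarrow> mon 1 0 * x = x \<and> x * mon 1 0 = x" by (rule unit_mult[OF faithful action])
  have "star Y * Y = mon 1 0" using YY[rule_format, of "\<lambda>x. 1"] unit[OF CP_closed(5)[OF Y]] by (simp add: \<eta>_sum one)
  then have "(norm Y)\<^sup>2 \<le> 1"
    using cstar_identity[of Y] norm_coefficient_le[OF faithful action, of 1] by simp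
  then have nY: "norm Y \<le> 1" using power2_le_imp_le[of "norm Y" 1] by simp
  have \<eta>F: "(\<eta> g x)\<^sup>2 * F (act (- g) x) = (\<eta> g x)\<^sup>2" for g x
    using W(3) \<phi>(4) by (cases "act (- g) x \<in> W") (auto simp: \<eta>_def)
  have YF: "star Y * mon (scalar F) 0 * Y = mon 1 0"
    using YY[rule_format, OF F] unfolding \<eta>F \<eta>_sum one .
  define m where "m = star w * (star y * y) * w"
  have m: "m \<in> CP \<pi> \<alpha>" "star m = m"
    using w y by (auto simp: m_def star_simps mult.assoc intro!: CP_closed)
  have "norm (star Y * (mon (scalar F) 0 - m) * Y) \<le> norm (star Y * (mon (scalar F) 0 - m)) * norm Y"
    by (rule norm_mult_ineq)
  also have "\<dots> \<le> (norm (star Y) * norm (mon (scalar F) 0 - m)) * norm Y"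
    by (intro mult_right_mono norm_mult_ineq norm_ge_zero)
  also have "\<dots> \<le> (1 * (3/4)) * 1"
    using near by (intro mult_mono mult_nonneg_nonneg) (auto simp: nY norm_star m_def norm_minus_commute)
  finally have "norm (mon 1 0 - star Y * m * Y) < 1"
    by (simp add: YF left_diff_distrib right_diff_distrib)
  then have "\<exists>r\<in>CP \<pi> \<alpha>. star r * (star Y * m * Y) * r = mon 1 0"
    using unit_projection[OF faithful action] unit m Y
    by (intro near_unit_normalizable[OF CP_subalgebra[OF faithful action]])
       (auto simp: star_simps mult.assoc intro!: CP_closed mon_in_CP)
  then obtain r where r: "r \<in> CP \<pi> \<alpha>" "star r * (star Y * m * Y) * r = mon 1 0" by blast
  then have "star (w * Y * r) * (star y * y) * (w * Y * r) = mon 1 0"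
    by (simp add: m_def star_mult mult.assoc)
  then show ?thesis using r(1) Y w by (intro bexI[of _ "w * Y * r"] CP_closed)
qed

lemma crossed_product_purely_infinite: "purely_infinite_simple (CP \<pi> \<alpha>)"
proof -
  obtain v :: 'd where v: "star v * v = 1" "v * star v \<noteq> 1"
    using purely_infinite_proper_isometry[OF const_bcontfun_rep[OF faithful] pis] by blast
  define c :: "'x \<Rightarrow>\<^sub>C 'd" where "c = const_bcontfun v"
  have c: "star c * c = 1" by (rule bcontfun_eqI) (simp add: c_def bcontfun_reps v)
  have inj: "a = 0" if "mon a 0 = 0" for a
  proof -
    have "bop_apply (\<pi> a) v = 0" for v
      using monomial_apply[OF faithful action, of a 0 "ell2_delta 0 v" 0] that
      by (simp add: bop_apply_simps ell2_apply_simps ell2_delta_apply cstar_actionD(2)[OF action])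
    then have "\<pi> a = 0" by (intro bop_eqI) (simp add: bop_apply_simps)
    then show ?thesis using rep_isometric[OF faithful, of a] by simp
  qed
  show ?thesis
  proof (rule purely_infinite_simple_criterion[where q = "mon 1 0" and u = "mon c 0"])
    show "mon 1 0 \<noteq> 0" using inj[of 1] by auto
    show "star (mon c 0) * mon c 0 = mon 1 0" by (simp add: c flip: coeff_hom)
    show "mon c 0 * star (mon c 0) \<noteq> mon 1 0"
    proof
      assume "mon c 0 * star (mon c 0) = mon 1 0"
      then have "mon (c * star c - 1) 0 = 0" by (simp add: coeff_hom)
      then have "c * star c = 1" using inj by fastforce
      then have "apply_bcontfun (c * star c) undefined = apply_bcontfun 1 (undefined :: 'x)" by simp
      then show False using v by (simp add: c_def bcontfun_reps)
    qed
  qed (use CP_subalgebra[OF faithful action] unit_mult[OF faithful action] unit_projection[OF faithful action]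
      crossed_product_dominates_unit mon_in_CP in auto)
qed

end

theorem theorem2p13:
  fixes act :: "'g::group_add \<Rightarrow> 'x::t2_space \<Rightarrow> 'x"
    and \<alpha> :: "'g \<Rightarrow> ('x \<Rightarrow>\<^sub>C 'd::{cstar_algebra, real_normed_algebra_1}) \<Rightarrow> ('x \<Rightarrow>\<^sub>C 'd)"
    and \<pi> :: "('x \<Rightarrow>\<^sub>C 'd) \<Rightarrow> 'h::chilbert_space bop"
  assumes "compact (UNIV :: 'x set)"
    and "top_action act"
    and "minimal_action act"
    and "\<And>S. finite S \<Longrightarrow> S \<subseteq> - {0} \<Longrightarrow> closure {x. \<forall>g\<in>S. act g x \<noteq> x} = UNIV"
    and "purely_infinite_simple (UNIV :: 'd set)"
    and "cstar_action \<alpha>"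
    and "lies_over \<alpha> act"
    and "faithful_representation \<pi>"
  shows "purely_infinite_simple (reduced_crossed_product \<pi> \<alpha>)"
  by (rule crossed_product_purely_infinite[OF assms])

end
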